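(* Let $K$ be a field, $N\geq 1$, and let $R$ be a quadric $K$-algebra of solvable type with respect to $x=(x_1,\dots,x_N)$ and a monomial ordering $\leq$ of $\mathbb{N}^N$. Suppose $\leq$ is degree-compatible. Put $D(N,d):=2\left(\frac{d^2}{2}+d\right)^{2^{N-1}}$. Let $f_1,\dots,f_n\in R$ be of degree at most $d$, and let $f\in R$. If there are $y_1,\dots,y_n\in R$ such that $$y_1f_1+\cdots+y_nf_n=f,$$ then there are such $y_i$ of degree at most $\deg(f)+D(N,d)$. Moreover, the left $R$-module of solutions $(y_1,\dots,y_n)\in R^n$ to the linear homogeneous equation $$y_1f_1+\cdots+y_nf_n=0$$ is generated by solutions all of whose components have degree at most $3D(N,d)$.
   Context: Here $\mathbb{N}=\{0,1,2,\dots\}$ and $|\alpha|=\alpha_1+\cdots+\alpha_N$ for $\alpha\in\mathbb{N}^N$. A monomial ordering of $\mathbb{N}^N$ is a total ordering compatible with addition whose smallest element is $0$; it is degree-compatible if $|\alpha|<|\beta|$ implies $\alpha\leq\beta$. $K$-algebras are associative with unit. For a $K$-algebra $R$ and $x=(x_1,\dots,x_N)\in R^N$ put $x^\alpha:=x_1^{\alpha_1}\cdots x_N^{\alpha_N}$; these are the monomials. $R$ is of solvable type with respect to $x$ and $\leq$ if $\{x^\alpha\}_{\alpha\in\mathbb{N}^N}$ is a $K$-basis of $R$ and for $1\leq i<j\leq N$ there are $0\neq c_{ij}\in K$ and $p_{ij}\in R$ with $x_jx_i=c_{ij}x_ix_j+p_{ij}$ and $\operatorname{lm}(p_{ij})<x_ix_j$.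 Here monomials are ordered by $x^\alpha\leq x^\beta\iff\alpha\leq\beta$, $\operatorname{lm}(f)$ is the $\leq$-largest monomial occurring in $f\neq 0$, and $\operatorname{lm}(0):=0$ is smaller than every monomial. $R$ is quadric if each $p_{ij}$ is a $K$-linear combination of monomials $x^\alpha$ with $|\alpha|\leq 2$. The degree of a nonzero $f\in R$ is the smallest $e$ such that $f$ is a $K$-linear combination of products (words) of at most $e$ of the generators $x_1,\dots,x_N$; for quadric $R$ this equals the maximum of $|\alpha|$ over the monomials $x^\alpha$ occurring in $f$. The zero element satisfies every degree bound. *)

theory Defs
  imports Complex_Main "HOL-Library.Function_Algebras"
begin

text \<open>
  Multi-indices in $N$ variables are functions on the index set \<open>{1..N}\<close>, extended by zero to all
  of \<open>nat\<close>; addition and zero are the pointwise ones of \<open>HOL-Library.Function_Algebras\<close>.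
\<close>

definition multi_indices :: "nat \<Rightarrow> (nat \<Rightarrow> nat) set" where
  "multi_indices N = {\<alpha>. \<forall>i. i \<notin> {1..N} \<longrightarrow> \<alpha> i = 0}"

definition total_degree :: "nat \<Rightarrow> (nat \<Rightarrow> nat) \<Rightarrow> nat" where
  "total_degree N \<alpha> = (\<Sum>i = 1..N. \<alpha> i)"

definition unit_index :: "nat \<Rightarrow> nat \<Rightarrow> nat" where
  "unit_index i = (\<lambda>k. if k = i then 1 else 0)"

definition monomial_ordering :: "nat \<Rightarrow> ((nat \<Rightarrow> nat) \<times> (nat \<Rightarrow> nat)) set \<Rightarrow> bool" where
  "monomial_ordering N le \<longleftrightarrow>
     linear_order_on (multi_indices N) le \<and>
     (\<forall>\<alpha>\<in>multi_indices N. \<forall>\<beta>\<in>multi_indices N. \<forall>\<gamma>\<in>multi_indices N.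
        (\<alpha>, \<beta>) \<in> le \<longrightarrow> (\<alpha> + \<gamma>, \<beta> + \<gamma>) \<in> le) \<and>
     (\<forall>\<alpha>\<in>multi_indices N. (0, \<alpha>) \<in> le)"

definition degree_compatible :: "nat \<Rightarrow> ((nat \<Rightarrow> nat) \<times> (nat \<Rightarrow> nat)) set \<Rightarrow> bool" where
  "degree_compatible N le \<longleftrightarrow>
     (\<forall>\<alpha>\<in>multi_indices N. \<forall>\<beta>\<in>multi_indices N.
        total_degree N \<alpha> < total_degree N \<beta> \<longrightarrow> (\<alpha>, \<beta>) \<in> le)"

text \<open>
  Associative unital algebras over a field. The class \<open>ring_1\<close> excludes only the zero ring, in which
  the family of monomials is not a basis.
\<close>

locale associative_algebra = vector_space scale
  for scale :: "'k::field \<Rightarrow> 'r::ring_1 \<Rightarrow> 'r" +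
  assumes scale_mult_left: "scale c a * b = scale c (a * b)"
    and scale_mult_right: "a * scale c b = scale c (a * b)"

locale algebra_with_generators = associative_algebra scale
  for scale :: "'k::field \<Rightarrow> 'r::ring_1 \<Rightarrow> 'r" +
  fixes N :: nat and x :: "nat \<Rightarrow> 'r" and le :: "((nat \<Rightarrow> nat) \<times> (nat \<Rightarrow> nat)) set"
begin

text \<open>The factors are multiplied in the order $x_1^{\alpha_1}\cdots x_N^{\alpha_N}$.\<close>

definition mono :: "(nat \<Rightarrow> nat) \<Rightarrow> 'r" where
  "mono \<alpha> = prod_list (map (\<lambda>i. x i ^ \<alpha> i) [1..<Suc N])"

definition monomials :: "'r set" where
  "monomials = mono ` multi_indices N"

definition supp :: "'r \<Rightarrow> (nat \<Rightarrow> nat) set" where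
  "supp f = {\<alpha> \<in> multi_indices N. representation monomials f (mono \<alpha>) \<noteq> 0}"

text \<open>The exponent of the leading monomial; meaningful for nonzero elements only.\<close>

definition lm_exponent :: "'r \<Rightarrow> (nat \<Rightarrow> nat)" where
  "lm_exponent f = (THE \<alpha>. \<alpha> \<in> supp f \<and> (\<forall>\<beta>\<in>supp f. (\<beta>, \<alpha>) \<in> le))"

text \<open>\<open>lm_less f \<gamma>\<close> is $\mathrm{lm}(f) < x^\gamma$, where $\mathrm{lm}(0)=0$ is smaller than every monomial.\<close>

definition lm_less :: "'r \<Rightarrow> (nat \<Rightarrow> nat) \<Rightarrow> bool" where
  "lm_less f \<gamma> \<longleftrightarrow> f = 0 \<or> ((lm_exponent f, \<gamma>) \<in> le \<and> lm_exponent f \<noteq> \<gamma>)"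

definition commutation_relation :: "nat \<Rightarrow> nat \<Rightarrow> 'k \<Rightarrow> 'r \<Rightarrow> bool" where
  "commutation_relation i j c p \<longleftrightarrow>
     c \<noteq> 0 \<and> x j * x i = scale c (x i * x j) + p \<and> lm_less p (unit_index i + unit_index j)"

definition words :: "nat \<Rightarrow> 'r set" where
  "words e = {prod_list (map x is) |is. set is \<subseteq> {1..N} \<and> length is \<le> e}"

text \<open>The degree of a nonzero element; the value at zero is an artefact.\<close>

definition deg :: "'r \<Rightarrow> nat" where
  "deg f = (LEAST e. f \<in> span (words e))"

definition deg_at_most :: "'r \<Rightarrow> real \<Rightarrow> bool" where
  "deg_at_most f b \<longleftrightarrow> f = 0 \<or> real (deg f) \<le> b"

end

locale solvable_type_algebra = algebra_with_generators scale N x le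
  for scale :: "'k::field \<Rightarrow> 'r::ring_1 \<Rightarrow> 'r"
    and N :: nat and x :: "nat \<Rightarrow> 'r" and le :: "((nat \<Rightarrow> nat) \<times> (nat \<Rightarrow> nat)) set" +
  assumes monomial_ordering: "monomial_ordering N le"
    and mono_inj: "inj_on mono (multi_indices N)"
    and monomials_independent: "independent monomials"
    and monomials_span: "span monomials = UNIV"
    and commutation: "1 \<le> i \<Longrightarrow> i < j \<Longrightarrow> j \<le> N \<Longrightarrow> \<exists>c p. commutation_relation i j c p"

text \<open>
  The pair \<open>c\<close>, \<open>p\<close> in a commutation relation is uniquely determined, as $x_i x_j$ does not
  occur in \<open>p\<close>.
\<close>

locale quadric_solvable_type_algebra = solvable_type_algebra scale N x le
  for scale :: "'k::field \<Rightarrow> 'r::ring_1 \<Rightarrow> 'r"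
    and N :: nat and x :: "nat \<Rightarrow> 'r" and le :: "((nat \<Rightarrow> nat) \<times> (nat \<Rightarrow> nat)) set" +
  assumes quadric: "1 \<le> i \<Longrightarrow> i < j \<Longrightarrow> j \<le> N \<Longrightarrow> commutation_relation i j c p \<Longrightarrow>
    p \<in> span (mono ` {\<alpha> \<in> multi_indices N. total_degree N \<alpha> \<le> 2})"

text \<open>Elements of $R^n$ are functions on \<open>{1..n}\<close>, extended by zero to all of \<open>nat\<close>.\<close>

definition tuples :: "nat \<Rightarrow> (nat \<Rightarrow> 'r::ring_1) set" where
  "tuples n = {y. \<forall>i. i \<notin> {1..n} \<longrightarrow> y i = 0}"

definition left_solutions :: "nat \<Rightarrow> (nat \<Rightarrow> 'r::ring_1) \<Rightarrow> (nat \<Rightarrow> 'r) set" where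
  "left_solutions n F = {y \<in> tuples n. (\<Sum>i = 1..n. y i * F i) = 0}"

definition left_submodule :: "(nat \<Rightarrow> 'r::ring_1) set \<Rightarrow> bool" where
  "left_submodule M \<longleftrightarrow>
     0 \<in> M \<and> (\<forall>y\<in>M. \<forall>z\<in>M. y + z \<in> M) \<and> (\<forall>r. \<forall>y\<in>M. (\<lambda>i. r * y i) \<in> M)"

definition degree_bound :: "nat \<Rightarrow> nat \<Rightarrow> real" where
  "degree_bound N d = 2 * ((real d)\<^sup>2 / 2 + real d) ^ (2 ^ (N - 1))"

end

theory Submission
  imports Defs
begin

text \<open>
  Since the ordering is degree-compatible, leading exponents are additive and respect degrees, so the
  spaces \<open>I s\<close> of combinations $\sum_i y_i f_i$ with $\deg y_i \leq s - d$ form a homogeneous left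
  ideal of the Rees algebra of \<open>R\<close>, whose leading exponents form a monomial ideal in $N + 1$
  variables. Adding the generators one at a time expresses the Hilbert function of the Rees algebra as
  that of the monomials outside the leading ideal, plus that of a free module generated in degree
  \<open>d\<close>, plus those of complements of monomial ideals shifted by \<open>d\<close>. Following Dube, each of these
  is decomposed into standard cones. Comparing Hilbert functions bounds the number of cones of
  dimension at least $m$ roughly by the square of that for $m + 1$, hence the degrees of the minimal
  generators of the leading ideal by $D(N,d)$. Membership follows by reduction, and Schreyer's
  argument with S-pairs, whose degree is at most $2D(N,d)$, bounds the syzygies.
\<close>

section \<open>Cone decompositions\<close>

text \<open>The degree of an element of the left ideal does not control the degrees needed to
  represent it. The homogenizing variable records the difference: an element of \<open>I s\<close>
  counts as a form of degree s whatever its own degree is, so a generator of the leading ideal in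
  degree at most D comes with coefficients of degree at most D - d. Noncommutativity enters only
  through correction terms with smaller leading exponent.

  In the equation of Hilbert functions a free module cancels against the same one shifted by d.
  Hence no cones of dimension N + 1 occur, exactly d have dimension N, and at most d^2 have
  dimension N - 1. The degrees below d need not contain cones and are counted as an offset d; this
  gives 2d + d^2 = 2(d^2/2 + d), and squaring takes over from one dimension to the next. For
  syzygies, reducing an S-pair of degree at most 2D costs D more, whence 3D.\<close>

definition indices :: "nat set \<Rightarrow> (nat \<Rightarrow> nat) set" where
  "indices V = {\<xi>. \<forall>i. i \<notin> V \<longrightarrow> \<xi> i = 0}"

definition down_closed :: "nat set \<Rightarrow> (nat \<Rightarrow> nat) set \<Rightarrow> bool" where
  "down_closed V M \<longleftrightarrow> M \<subseteq> indices V \<and> (\<forall>\<xi>\<in>M. \<forall>\<eta>\<le>\<xi>. \<eta> \<in> M)"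

definition hilb :: "nat set \<Rightarrow> (nat \<Rightarrow> nat) set \<Rightarrow> nat \<Rightarrow> int" where
  "hilb V M s = int (card {\<xi>\<in>M. sum \<xi> V = s})"

section \<open>Integer sequences as power series: summation, differencing, shifting\<close>

definition partial_sums :: "(nat \<Rightarrow> int) \<Rightarrow> nat \<Rightarrow> int" where
  "partial_sums f s = (\<Sum>e\<le>s. f e)"

definition shift :: "(nat \<Rightarrow> int) \<Rightarrow> nat \<Rightarrow> int" where
  "shift f s = (if s = 0 then 0 else f (s - 1))"

text \<open>Sequences are coefficients of formal power series: \<open>partial_sums\<close>,
  \<open>diff\<close> and \<open>shift\<close> multiply by 1/(1 - t), 1 - t and t, and
  \<open>delta k\<close> is t^k. A cone of dimension m and degree e thus has Hilbert function
  \<open>(partial_sums ^^ m) (delta e)\<close>. Values are integers because differences of Hilbert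
  functions can be negative.\<close>

definition diff :: "(nat \<Rightarrow> int) \<Rightarrow> nat \<Rightarrow> int" where
  "diff f s = f s - shift f s"

definition delta :: "nat \<Rightarrow> nat \<Rightarrow> int" where
  "delta k e = (if e = k then 1 else 0)"

lemma partial_sums_diff [simp]: "partial_sums (diff f) = f"
proof
  fix s show "partial_sums (diff f) s = f s"
    by (induction s) (auto simp: partial_sums_def diff_def shift_def)
qed

lemma diff_partial_sums [simp]: "diff (partial_sums f) = f"
  by (rule ext, rename_tac s, case_tac s) (auto simp: partial_sums_def diff_def shift_def)

lemma partial_sums_add: "partial_sums (f + g) = partial_sums f + partial_sums g"
  by (auto simp: partial_sums_def sum.distrib fun_eq_iff)

lemma partial_sums_funpow_add:
  "(partial_sums ^^ m) (f + g) = (partial_sums ^^ m) f + (partial_sums ^^ m) g"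
  by (induction m) (simp_all add: partial_sums_add del: plus_fun_apply zero_fun_apply)

lemma shift_add: "shift (f + g) = shift f + shift g"
  by (auto simp: shift_def fun_eq_iff)

lemma shift_funpow_add: "(shift ^^ k) (f + g) = (shift ^^ k) f + (shift ^^ k) g"
  by (induction k) (simp_all add: shift_add del: plus_fun_apply zero_fun_apply)

lemma shift_zero [simp]: "shift 0 = 0"
  by (auto simp: shift_def fun_eq_iff)

lemma shift_funpow_apply: "(shift ^^ k) f s = (if s < k then 0 else f (s - k))"
  by (induction k arbitrary: s) (auto simp: shift_def)

lemma shift_sum: "shift (\<Sum>i\<in>A. f i) = (\<Sum>i\<in>A. shift (f i))"
  by (induction A rule: infinite_finite_induct) (simp_all add: shift_add del: plus_fun_apply zero_fun_apply)

lemma shift_funpow_sum: "(shift ^^ k) (\<Sum>i\<in>A. f i) = (\<Sum>i\<in>A. (shift ^^ k) (f i))"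
  by (induction k) (simp_all add: shift_sum)

lemma partial_sums_zero [simp]: "partial_sums 0 = 0"
  by (auto simp: partial_sums_def fun_eq_iff)

lemma partial_sums_funpow_zero [simp]: "(partial_sums ^^ m) 0 = 0"
  by (induction m) (simp_all del: plus_fun_apply zero_fun_apply)

lemma partial_sums_sum: "partial_sums (\<Sum>i\<in>A. f i) = (\<Sum>i\<in>A. partial_sums (f i))"
  by (induction A rule: infinite_finite_induct) (simp_all add: partial_sums_add del: plus_fun_apply zero_fun_apply)

lemma partial_sums_funpow_sum:
  "(partial_sums ^^ m) (\<Sum>i\<in>A. f i) = (\<Sum>i\<in>A. (partial_sums ^^ m) (f i))"
  by (induction m) (simp_all add: partial_sums_sum)

lemma partial_sums_shift: "partial_sums (shift f) = shift (partial_sums f)"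
proof
  fix s show "partial_sums (shift f) s = shift (partial_sums f) s"
    by (cases s) (auto simp: partial_sums_def shift_def sum.atMost_Suc_shift simp del: sum.atMost_Suc)
qed

lemma partial_sums_funpow_shift: "(partial_sums ^^ m) (shift f) = shift ((partial_sums ^^ m) f)"
  by (induction m) (simp_all add: partial_sums_shift)

lemma partial_sums_funpow_shift_funpow:
  "(partial_sums ^^ m) ((shift ^^ k) f) = (shift ^^ k) ((partial_sums ^^ m) f)"
  by (induction k) (simp_all add: partial_sums_funpow_shift)

lemma shift_delta: "(shift ^^ k) (delta 0) = delta k"
  by (auto simp: shift_funpow_apply delta_def fun_eq_iff)

section \<open>Hilbert functions of sets of exponents\<close>

lemma finite_indices_degree: "finite V \<Longrightarrow> finite {\<xi>\<in>indices V. sum \<xi> V = s}"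
proof -
  assume V: "finite V"
  have "{\<xi>\<in>indices V. sum \<xi> V = s} \<subseteq> {\<xi>. \<forall>i. (i \<in> V \<longrightarrow> \<xi> i \<in> {..s}) \<and> (i \<notin> V \<longrightarrow> \<xi> i = 0)}"
    using V by (auto simp: indices_def intro: member_le_sum)
  then show ?thesis
    using finite_set_of_finite_funs[OF V, of "{..s}" 0] by (rule finite_subset) simp
qed

lemma unit_index_add_degree:
  assumes "finite V" "i \<in> V"
  shows "sum (\<xi> + unit_index i) V = Suc (sum \<xi> V)"
  using assms by (simp add: sum.distrib unit_index_def)

lemma remove_unit_index: "0 < \<xi> i \<Longrightarrow> \<xi> - unit_index i + unit_index i = \<xi>"
  by (auto simp: unit_index_def fun_eq_iff)

text \<open>Monomials are sorted by whether the variable i divides them; those that it divides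
  correspond, after one division, to the colon set in one degree less.\<close>

lemma hilb_split:
  assumes V: "finite V" "i \<in> V" and M: "M \<subseteq> indices V"
  shows "hilb V M = hilb (V - {i}) {\<xi>\<in>M. \<xi> i = 0}
           + shift (hilb V {\<xi>\<in>indices V. \<xi> + unit_index i \<in> M})"
proof
  fix s
  let ?A = "{\<xi>\<in>M. \<xi> i = 0 \<and> sum \<xi> (V - {i}) = s}"
  let ?B = "{\<xi>\<in>M. 0 < \<xi> i \<and> sum \<xi> V = s}"
  let ?C = "{\<xi>\<in>indices V. \<xi> + unit_index i \<in> M \<and> Suc (sum \<xi> V) = s}"
  have split: "{\<xi>\<in>M. sum \<xi> V = s} = ?A \<union> ?B" and dis: "?A \<inter> ?B = {}"
  proof -
    have "sum \<xi> V = sum \<xi> (V - {i})" if "\<xi> i = 0" for \<xi> :: "nat \<Rightarrow> nat"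
      using sum.remove[OF V, of \<xi>] that by simp
    then show "{\<xi>\<in>M. sum \<xi> V = s} = ?A \<union> ?B" "?A \<inter> ?B = {}" by auto
  qed
  have "finite {\<xi>\<in>M. sum \<xi> V = s}"
    using M by (intro finite_subset[OF _ finite_indices_degree[OF V(1), of s]]) auto
  then have "card {\<xi>\<in>M. sum \<xi> V = s} = card ?A + card ?B"
    unfolding split using dis by (simp add: card_Un_disjoint)
  moreover have "card ?B = card ?C"
  proof (rule bij_betw_same_card[of "\<lambda>\<xi>. \<xi> - unit_index i"], rule bij_betw_byWitness[where f' = "\<lambda>\<xi>. \<xi> + unit_index i"])
    show "\<forall>\<xi>\<in>?B. \<xi> - unit_index i + unit_index i = \<xi>"
      by (simp add: remove_unit_index)
    show "(\<lambda>\<xi>. \<xi> - unit_index i) ` ?B \<subseteq> ?C"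
    proof (rule image_subsetI)
      fix \<xi> assume \<xi>: "\<xi> \<in> ?B"
      then have "\<xi> - unit_index i \<in> indices V"
        using M by (auto simp: indices_def)
      with \<xi> show "\<xi> - unit_index i \<in> ?C"
        using unit_index_add_degree[OF V, of "\<xi> - unit_index i"] by (simp add: remove_unit_index)
    qed
    show "(\<lambda>\<xi>. \<xi> + unit_index i) ` ?C \<subseteq> ?B"
      using V by (auto simp: unit_index_add_degree simp del: plus_fun_apply) (simp add: unit_index_def)
  qed auto
  moreover have "?C = (if s = 0 then {} else {\<xi>\<in>indices V. \<xi> + unit_index i \<in> M \<and> sum \<xi> V = s - 1})"
    by auto
  ultimately show "hilb V M s = (hilb (V - {i}) {\<xi>\<in>M. \<xi> i = 0}
           + shift (hilb V {\<xi>\<in>indices V. \<xi> + unit_index i \<in> M})) s"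
    by (simp add: hilb_def shift_def conj_assoc)
qed

text \<open>Dividing by a variable returns the same full set of exponents, so the difference of the
  Hilbert function is the one for one variable less.\<close>

lemma hilb_indices: "finite V \<Longrightarrow> hilb V (indices V) = (partial_sums ^^ card V) (delta 0)"
proof (induction V rule: finite_induct)
  case empty
  have "indices {} = {\<lambda>_. 0}" by (auto simp: indices_def)
  then have "{\<xi>\<in>indices {}. sum \<xi> {} = s} = (if s = 0 then {\<lambda>_. 0} else {})" for s by auto
  then show ?case by (auto simp: hilb_def delta_def fun_eq_iff)
next
  case (insert i V)
  let ?h = "hilb (insert i V) (indices (insert i V))"
  have a: "{\<xi>\<in>indices (insert i V). \<xi> i = 0} = indices V"
    using insert.hyps(2) by (auto simp: indices_def) metis
  have b: "{\<xi>\<in>indices (insert i V). \<xi> + unit_index i \<in> indices (insert i V)} = indices (insert i V)"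
    by (auto simp: indices_def unit_index_def)
  have "?h = hilb V (indices V) + shift ?h"
    using hilb_split[of "insert i V" i "indices (insert i V)"] insert.hyps unfolding a b by simp
  then have "diff ?h = hilb V (indices V)"
    by (auto simp: fun_eq_iff diff_def)
  then have "?h = partial_sums (hilb V (indices V))"
    by (metis partial_sums_diff)
  then show ?case using insert by simp
qed

section \<open>Dickson's lemma and descending chains of order ideals\<close>

lemma dickson_sequence:
  fixes \<xi> :: "nat \<Rightarrow> nat \<Rightarrow> nat"
  assumes "finite V" "\<And>k. \<xi> k \<in> indices V"
  shows "\<exists>r::nat \<Rightarrow> nat. strict_mono r \<and> (\<forall>i j. i \<le> j \<longrightarrow> \<xi> (r i) \<le> \<xi> (r j))"
proof -
  have "\<exists>r::nat \<Rightarrow> nat. strict_mono r \<and> (\<forall>v\<in>V. \<forall>i j. i \<le> j \<longrightarrow> \<xi> (r i) v \<le> \<xi> (r j) v)"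
    using assms(1)
  proof (induction V rule: finite_induct)
    case empty
    show ?case by (rule exI[of _ id]) (auto simp: strict_mono_def)
  next
    case (insert v V)
    then obtain r :: "nat \<Rightarrow> nat"
      where r: "strict_mono r" "\<forall>v\<in>V. \<forall>i j. i \<le> j \<longrightarrow> \<xi> (r i) v \<le> \<xi> (r j) v"
      by blast
    obtain q :: "nat \<Rightarrow> nat" where q: "strict_mono q" "monoseq (\<lambda>k. \<xi> (r (q k)) v)"
      using seq_monosub[of "\<lambda>k. \<xi> (r k) v"] by auto
    \<comment> \<open>An antitone sequence of naturals is constant from the point \<open>p\<close>
      where it attains its minimum, so its tail is monotone as well.\<close>
    have "\<exists>p. \<forall>i j. i \<le> j \<longrightarrow> \<xi> (r (q (i + p))) v \<le> \<xi> (r (q (j + p))) v"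
    proof (cases "\<forall>m n. m \<le> n \<longrightarrow> \<xi> (r (q m)) v \<le> \<xi> (r (q n)) v")
      case True
      then show ?thesis by (intro exI[of _ 0]) auto
    next
      case False
      then have dec: "m \<le> n \<Longrightarrow> \<xi> (r (q n)) v \<le> \<xi> (r (q m)) v" for m n
        using q(2) by (auto simp: monoseq_def)
      obtain p where p: "\<And>n. \<xi> (r (q p)) v \<le> \<xi> (r (q n)) v"
        using ex_has_least_nat[of "\<lambda>_. True" 0 "\<lambda>n. \<xi> (r (q n)) v"] by auto
      then show ?thesis
        using dec[of p] by (intro exI[of _ p]) (meson le_add2 order_trans)
    qed
    then obtain p where p: "\<And>i j. i \<le> j \<Longrightarrow> \<xi> (r (q (i + p))) v \<le> \<xi> (r (q (j + p))) v"
      by blast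
    show ?case
    proof (intro exI[of _ "\<lambda>k. r (q (k + p))"] conjI ballI allI impI)
      show "strict_mono (\<lambda>k. r (q (k + p)))"
        using r(1) q(1) by (auto simp: strict_mono_def)
      fix w i j assume w: "w \<in> insert v V" and ij: "(i::nat) \<le> j"
      have "q (i + p) \<le> q (j + p)"
        using q(1) ij by (simp add: strict_mono_less_eq)
      then show "\<xi> (r (q (i + p))) w \<le> \<xi> (r (q (j + p))) w"
        using w p[OF ij] r(2) by auto
    qed
  qed
  then obtain r :: "nat \<Rightarrow> nat"
    where r: "strict_mono r" "\<forall>v\<in>V. \<forall>i j. i \<le> j \<longrightarrow> \<xi> (r i) v \<le> \<xi> (r j) v"
    by blast
  have "\<xi> (r i) v \<le> \<xi> (r j) v" if "i \<le> j" for i j v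
    using r(2) assms(2) that by (cases "v \<in> V") (auto simp: indices_def)
  then show ?thesis using r(1) by (auto simp: le_fun_def)
qed

text \<open>Along a descending chain choose \<open>\<xi> i\<close> in
  \<open>M i - M (Suc i)\<close>. By Dickson some later choice dominates an earlier one, and
  down-closure puts the earlier one back into a set that it had left. This lets
  \<open>cone_data_exists\<close> recurse on the colon set with respect to a variable.\<close>

lemma wf_down_closed:
  assumes "finite V"
  shows "wf {(M', M). down_closed V M' \<and> down_closed V M \<and> M' \<subset> M}"
proof (subst wf_iff_no_infinite_down_chain, rule notI, elim exE)
  fix M :: "nat \<Rightarrow> (nat \<Rightarrow> nat) set"
  assume "\<forall>i. (M (Suc i), M i) \<in> {(M', M). down_closed V M' \<and> down_closed V M \<and> M' \<subset> M}"
  then have M: "down_closed V (M i)" "M (Suc i) \<subset> M i" for i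
    by auto
  obtain \<xi> where \<xi>: "\<And>i. \<xi> i \<in> M i - M (Suc i)"
    using psubset_imp_ex_mem[OF M(2)] by metis
  obtain r :: "nat \<Rightarrow> nat" where r: "strict_mono r" "\<And>i j. i \<le> j \<Longrightarrow> \<xi> (r i) \<le> \<xi> (r j)"
  proof -
    have "\<xi> k \<in> indices V" for k
      using \<xi>[of k] M(1)[of k] unfolding down_closed_def by blast
    then show thesis
      using dickson_sequence[OF assms, of \<xi>] that by blast
  qed
  have anti: "M j \<subseteq> M i" if "i \<le> j" for i j
    using M(2) by (intro lift_Suc_antimono_le[OF _ that]) auto
  have "Suc (r 0) \<le> r 1"
    using r(1) by (simp add: strict_mono_def Suc_leI)
  then have "\<xi> (r 1) \<in> M (Suc (r 0))"
    using anti \<xi> by blast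
  then have "\<xi> (r 0) \<in> M (Suc (r 0))"
    using r(2)[of 0 1] M(1) unfolding down_closed_def by blast
  then show False using \<xi> by blast
qed

text \<open>
  \<open>\<alpha> m e\<close> is the number of cones of dimension \<open>m\<close> and degree \<open>e\<close> in a standard cone decomposition of
  the monomials in \<open>M\<close>. The last condition bounds the degrees of the minimal generators of the
  complement of \<open>M\<close>.
\<close>

definition cone_data :: "nat set \<Rightarrow> (nat \<Rightarrow> nat) set \<Rightarrow> (nat \<Rightarrow> nat \<Rightarrow> int) \<Rightarrow> bool" where
  "cone_data V M \<alpha> \<longleftrightarrow>
     (\<forall>n\<ge>card V. hilb V M = (\<Sum>m\<le>n. (partial_sums ^^ m) (\<alpha> m))) \<and>
     (\<forall>m e. 0 \<le> \<alpha> m e) \<and> (\<forall>m. finite {e. \<alpha> m e \<noteq> 0}) \<and>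
     (\<forall>m e. \<alpha> m e \<noteq> 0 \<longrightarrow> (\<exists>U\<subseteq>V. card U = m \<and> indices U \<subseteq> M)) \<and>
     (\<forall>U\<subseteq>V. indices U \<subseteq> M \<longrightarrow> (\<exists>m\<ge>card U. \<alpha> m 0 \<noteq> 0)) \<and>
     (\<forall>m e e'. \<alpha> m e \<noteq> 0 \<longrightarrow> e' \<le> e \<longrightarrow> (\<exists>m'\<ge>m. \<alpha> m' e' \<noteq> 0)) \<and>
     (\<forall>g. (\<forall>m e. \<alpha> m e \<noteq> 0 \<longrightarrow> e < g) \<longrightarrow>
        (\<forall>\<xi>\<in>indices V - M. \<exists>\<eta>\<in>indices V - M. \<eta> \<le> \<xi> \<and> sum \<eta> V \<le> g))"

lemma cone_dataD:
  assumes "cone_data V M \<alpha>"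
  shows cone_data_hilb: "card V \<le> n \<Longrightarrow> hilb V M = (\<Sum>m\<le>n. (partial_sums ^^ m) (\<alpha> m))"
    and cone_data_nonneg: "0 \<le> \<alpha> m e"
    and cone_data_finite: "finite {e. \<alpha> m e \<noteq> 0}"
    and cone_data_dim: "\<alpha> m e \<noteq> 0 \<Longrightarrow> \<exists>U\<subseteq>V. card U = m \<and> indices U \<subseteq> M"
    and cone_data_top: "U \<subseteq> V \<Longrightarrow> indices U \<subseteq> M \<Longrightarrow> \<exists>m\<ge>card U. \<alpha> m 0 \<noteq> 0"
    and cone_data_standard: "\<alpha> m e \<noteq> 0 \<Longrightarrow> e' \<le> e \<Longrightarrow> \<exists>m'\<ge>m. \<alpha> m' e' \<noteq> 0"
    and cone_data_generators: "(\<And>m e. \<alpha> m e \<noteq> 0 \<Longrightarrow> e < g) \<Longrightarrow> \<xi> \<in> indices V - M \<Longrightarrow>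
      \<exists>\<eta>\<in>indices V - M. \<eta> \<le> \<xi> \<and> sum \<eta> V \<le> g"
proof -
  note d = assms[unfolded cone_data_def]
  show "card V \<le> n \<Longrightarrow> hilb V M = (\<Sum>m\<le>n. (partial_sums ^^ m) (\<alpha> m))"
    using d[THEN conjunct1] by (elim allE impE)
  show "0 \<le> \<alpha> m e"
    using d[THEN conjunct2, THEN conjunct1] by (elim allE)
  show "finite {e. \<alpha> m e \<noteq> 0}"
    using d[THEN conjunct2, THEN conjunct2, THEN conjunct1] by (elim allE)
  show "\<alpha> m e \<noteq> 0 \<Longrightarrow> \<exists>U\<subseteq>V. card U = m \<and> indices U \<subseteq> M"
    using d[THEN conjunct2, THEN conjunct2, THEN conjunct2, THEN conjunct1] by (elim allE impE)
  show "U \<subseteq> V \<Longrightarrow> indices U \<subseteq> M \<Longrightarrow> \<exists>m\<ge>card U. \<alpha> m 0 \<noteq> 0"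
    using d[THEN conjunct2, THEN conjunct2, THEN conjunct2, THEN conjunct2, THEN conjunct1]
    by (elim allE impE)
  show "\<alpha> m e \<noteq> 0 \<Longrightarrow> e' \<le> e \<Longrightarrow> \<exists>m'\<ge>m. \<alpha> m' e' \<noteq> 0"
    using d[THEN conjunct2, THEN conjunct2, THEN conjunct2, THEN conjunct2, THEN conjunct2, THEN conjunct1]
    by (elim allE impE)
  show "(\<And>m e. \<alpha> m e \<noteq> 0 \<Longrightarrow> e < g) \<Longrightarrow> \<xi> \<in> indices V - M \<Longrightarrow>
      \<exists>\<eta>\<in>indices V - M. \<eta> \<le> \<xi> \<and> sum \<eta> V \<le> g"
    using d[THEN conjunct2, THEN conjunct2, THEN conjunct2, THEN conjunct2, THEN conjunct2, THEN conjunct2,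
        rule_format, of g \<xi>] .
qed

lemma cone_data_full:
  assumes "finite V"
  shows "cone_data V (indices V) (\<lambda>m. if m = card V then delta 0 else 0)"
proof -
  have "hilb V (indices V) = (\<Sum>m\<le>n. (partial_sums ^^ m) (if m = card V then delta 0 else 0))"
    if "n \<ge> card V" for n
  proof -
    have "(\<Sum>m\<le>n. (partial_sums ^^ m) (if m = card V then delta 0 else 0))
        = (\<Sum>m\<le>n. if m = card V then (partial_sums ^^ card V) (delta 0) else 0)"
      by (intro sum.cong) auto
    then show ?thesis
      using that by (simp add: hilb_indices[OF assms])
  qed
  then show ?thesis
    unfolding cone_data_def using assms by (auto simp: delta_def card_mono split: if_splits)
qed

lemma cone_data_empty: "cone_data V {} (\<lambda>_. 0)"
proof -
  have "(\<lambda>_. 0) \<in> indices U" for U by (simp add: indices_def)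
  moreover have "\<exists>\<eta>\<in>indices V. \<eta> \<le> \<xi> \<and> sum \<eta> V \<le> g" for \<xi> g
    by (rule bexI[of _ "\<lambda>_. 0"]) (auto simp: indices_def le_fun_def)
  moreover have "hilb V {} = 0" by (auto simp: hilb_def fun_eq_iff)
  ultimately show ?thesis
    unfolding cone_data_def by (simp add: zero_fun_def[symmetric]) blast
qed

text \<open>
  Splitting off a variable outside a coordinate subspace of maximal dimension keeps a cone of
  that dimension in degree 0, which is what makes the resulting decomposition standard.
\<close>

lemma cone_data_exists:
  assumes "finite V" "down_closed V M"
  shows "\<exists>\<alpha>. cone_data V M \<alpha>"
  using assms
proof (induction "card V" arbitrary: V M rule: less_induct)
  case (less V)
  note IH_V = less.hyps and V = less.prems(1)
  show ?case using less.prems(2)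
  proof (induction M rule: wf_induct_rule[OF wf_down_closed[OF V]])
    case (1 M)
    note M = 1(2)
    have Msub: "M \<subseteq> indices V" and Mdown: "\<And>\<xi> \<eta>. \<xi> \<in> M \<Longrightarrow> \<eta> \<le> \<xi> \<Longrightarrow> \<eta> \<in> M"
      using M unfolding down_closed_def by auto
    consider "M = {}" | "M = indices V" | "M \<noteq> {}" "M \<noteq> indices V" by blast
    then show ?case
    proof cases
      case 3
      have zero: "(\<lambda>_. 0) \<in> M"
        using 3(1) Mdown by (auto simp: le_fun_def)
      let ?P = "\<lambda>U. U \<subseteq> V \<and> indices U \<subseteq> M"
      have "?P {}" using zero by (auto simp: indices_def simp flip: fun_eq_iff)
      then have "\<exists>U. ?P U \<and> (\<forall>U'. ?P U' \<longrightarrow> card U' \<le> card U)"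
        using ex_has_greatest_nat[where P = ?P and k = "{}" and f = card and b = "Suc (card V)"]
          card_mono[OF V] \<open>?P {}\<close> by (simp add: less_Suc_eq_le)
      then obtain U where "?P U \<and> (\<forall>U'. ?P U' \<longrightarrow> card U' \<le> card U)"
        by (elim exE)
      then have U: "U \<subseteq> V" "indices U \<subseteq> M"
        and Umax: "\<And>U'. U' \<subseteq> V \<Longrightarrow> indices U' \<subseteq> M \<Longrightarrow> card U' \<le> card U"
        by simp_all
      have "U \<noteq> V" using U(2) Msub 3(2) by blast
      then obtain i where i: "i \<in> V" "i \<notin> U" using U(1) by blast
      have finU: "finite U" using U(1) V finite_subset by blast
      define M0 where "M0 = {\<xi>\<in>M. \<xi> i = 0}"
      define M1 where "M1 = {\<xi>\<in>indices V. \<xi> + unit_index i \<in> M}"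
      have le_add: "\<xi> \<le> \<xi> + unit_index i" for \<xi> :: "nat \<Rightarrow> nat"
        by (auto simp: le_fun_def)
      have M1M: "M1 \<subseteq> M"
        unfolding M1_def using Mdown le_add by blast
      \<comment> \<open>If dividing by the variable i changed nothing, \<open>M\<close> would
        contain every exponent supported on \<open>insert i U\<close>, against the maximality of
        \<open>U\<close>. So the recursion to \<open>M1\<close> really descends.\<close>
      have "M1 \<noteq> M"
      proof
        assume eq: "M1 = M"
        have "\<xi> \<in> M" if "\<xi> \<in> indices (insert i U)" for \<xi>
          using that
        proof (induction "\<xi> i" arbitrary: \<xi>)
          case 0
          have "\<xi> j = 0" if "j \<notin> U" for j
            using 0 that by (cases "j = i") (auto simp: indices_def)
          then have "\<xi> \<in> indices U"
            by (simp add: indices_def)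
          then show ?case using U(2) by blast
        next
          case (Suc k)
          then have "\<xi> - unit_index i \<in> M1"
            unfolding eq by (intro Suc.hyps(1)) (auto simp: indices_def unit_index_def)
          then show ?case
            using Suc.hyps(2) by (simp add: M1_def remove_unit_index)
        qed
        then have "card (insert i U) \<le> card U"
          using i(1) U(1) by (intro Umax) auto
        then show False using i(2) finU by simp
      qed
      with M1M have M1sub: "M1 \<subset> M" by blast
      have M1down: "down_closed V M1"
        unfolding down_closed_def M1_def
      proof (intro conjI ballI allI impI)
        fix \<xi> \<eta> assume a: "\<xi> \<in> {\<xi> \<in> indices V. \<xi> + unit_index i \<in> M}" "\<eta> \<le> \<xi>"
        then have "\<eta> + unit_index i \<le> \<xi> + unit_index i"
          by (auto simp: le_fun_def)
        moreover have "\<eta> \<in> indices V" using a by (auto simp: indices_def le_fun_def) (metis le_zero_eq)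
        ultimately show "\<eta> \<in> {\<xi> \<in> indices V. \<xi> + unit_index i \<in> M}"
          using a Mdown by blast
      qed auto
      have M0down: "down_closed (V - {i}) M0"
        unfolding down_closed_def M0_def
        using Msub Mdown by (auto simp: indices_def) (metis le_fun_def le_zero_eq)
      obtain \<alpha>0 where \<alpha>0: "cone_data (V - {i}) M0 \<alpha>0"
        using IH_V[OF card_Diff1_less[OF V i(1)] finite_Diff[OF V] M0down] by blast
      obtain \<alpha>1 where \<alpha>1: "cone_data V M1 \<alpha>1"
        using 1(1)[of M1] M1down M M1sub by blast
      define \<alpha> where "\<alpha> m = \<alpha>0 m + shift (\<alpha>1 m)" for m
      have nn: "0 \<le> \<alpha>0 m e" "0 \<le> \<alpha>1 m e" for m e
        using cone_data_nonneg[OF \<alpha>0] cone_data_nonneg[OF \<alpha>1] by auto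
      have nz: "\<alpha> m e \<noteq> 0 \<longleftrightarrow> \<alpha>0 m e \<noteq> 0 \<or> (e \<noteq> 0 \<and> \<alpha>1 m (e - 1) \<noteq> 0)" for m e
        using nn[of m e] nn[of m "e - 1"] by (auto simp: \<alpha>_def shift_def)
      have top: "\<exists>m\<ge>card U'. \<alpha> m 0 \<noteq> 0" if U': "U' \<subseteq> V" "indices U' \<subseteq> M" for U'
      proof -
        \<comment> \<open>As i is not in \<open>U\<close>, the maximal subspace survives in
          \<open>M0\<close>; the degree-0 cone that it forces there has at least the dimension of
          any coordinate subspace in \<open>M\<close>.\<close>
        have "indices U \<subseteq> M0" using U i by (auto simp: M0_def indices_def)
        then have "\<exists>m\<ge>card U. \<alpha>0 m 0 \<noteq> 0"
          using U(1) i(2) by (intro cone_data_top[OF \<alpha>0]) auto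
        then show ?thesis using Umax[OF U'] nz by (meson order_trans)
      qed
      have dim: "\<exists>U'\<subseteq>V. card U' = m \<and> indices U' \<subseteq> M" if "\<alpha> m e \<noteq> 0" for m e
      proof -
        have "\<exists>U' \<subseteq> V. card U' = m \<and> indices U' \<subseteq> M" if "U \<subseteq> V" "card U = m" "indices U \<subseteq> M'" "M' \<subseteq> M" for U M'
          using that by blast
        moreover have "M0 \<subseteq> M" "V - {i} \<subseteq> V" by (auto simp: M0_def)
        moreover have "(\<exists>U'\<subseteq>V - {i}. card U' = m \<and> indices U' \<subseteq> M0) \<or> (\<exists>U'\<subseteq>V. card U' = m \<and> indices U' \<subseteq> M1)"
          using that nz[of m e] cone_data_dim[OF \<alpha>0, of m e] cone_data_dim[OF \<alpha>1, of m "e - 1"] by blast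
        ultimately show ?thesis using M1M by (metis order_trans)
      qed
      have "cone_data V M \<alpha>"
        unfolding cone_data_def
      proof (intro conjI allI impI ballI)
        fix n assume n: "card V \<le> n"
        \<comment> \<open>The free upper limit in \<open>cone_data\<close> allows both pieces, over
          \<open>V - {i}\<close> and over \<open>V\<close>, to be summed up to the same n.\<close>
        then have n': "card (V - {i}) \<le> n" using V i(1) by simp
        have "hilb V M = hilb (V - {i}) M0 + shift (hilb V M1)"
          unfolding M0_def M1_def by (rule hilb_split[OF V i(1) Msub])
        also have "\<dots> = (\<Sum>m\<le>n. (partial_sums ^^ m) (\<alpha>0 m)) + shift (\<Sum>m\<le>n. (partial_sums ^^ m) (\<alpha>1 m))"
          by (simp only: cone_data_hilb[OF \<alpha>0 n'] cone_data_hilb[OF \<alpha>1 n])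
        also have "\<dots> = (\<Sum>m\<le>n. (partial_sums ^^ m) (\<alpha> m))"
          by (simp add: shift_sum \<alpha>_def partial_sums_funpow_add partial_sums_funpow_shift sum.distrib)
        finally show "hilb V M = (\<Sum>m\<le>n. (partial_sums ^^ m) (\<alpha> m))" .
      next
        fix m e show "0 \<le> \<alpha> m e"
          using nn by (auto simp: \<alpha>_def shift_def)
      next
        fix m
        have "{e. \<alpha> m e \<noteq> 0} \<subseteq> {e. \<alpha>0 m e \<noteq> 0} \<union> Suc ` {e. \<alpha>1 m e \<noteq> 0}"
        proof
          fix e assume "e \<in> {e. \<alpha> m e \<noteq> 0}"
          then show "e \<in> {e. \<alpha>0 m e \<noteq> 0} \<union> Suc ` {e. \<alpha>1 m e \<noteq> 0}"
            using nz[of m e] by (cases e) auto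
        qed
        moreover have "finite ({e. \<alpha>0 m e \<noteq> 0} \<union> Suc ` {e. \<alpha>1 m e \<noteq> 0})"
          using cone_data_finite[OF \<alpha>0] cone_data_finite[OF \<alpha>1] by blast
        ultimately show "finite {e. \<alpha> m e \<noteq> 0}" by (rule finite_subset)
      next
        fix m e assume "\<alpha> m e \<noteq> 0"
        then show "\<exists>U'\<subseteq>V. card U' = m \<and> indices U' \<subseteq> M" by (rule dim)
      next
        fix U' assume "U' \<subseteq> V" "indices U' \<subseteq> M"
        then show "\<exists>m\<ge>card U'. \<alpha> m 0 \<noteq> 0" by (rule top)
      next
        fix m e e' assume a: "\<alpha> m e \<noteq> 0" "e' \<le> e"
        show "\<exists>m'\<ge>m. \<alpha> m' e' \<noteq> 0"
        \<comment> \<open>The cones of \<open>M1\<close> move up by one degree and leave degree 0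
          empty; there the witness comes from the maximal subspace. In positive degrees each piece
          supplies its own witness.\<close>
        proof (cases "e' = 0")
          case True
          then show ?thesis using dim[OF a(1)] top by metis
        next
          case False
          from a(1) nz consider "\<alpha>0 m e \<noteq> 0" | "e \<noteq> 0" "\<alpha>1 m (e - 1) \<noteq> 0" by blast
          then show ?thesis
          proof cases
            case 1
            then have "\<exists>m'\<ge>m. \<alpha>0 m' e' \<noteq> 0" using a(2) by (rule cone_data_standard[OF \<alpha>0])
            then show ?thesis using nz by blast
          next
            case 2
            then have "\<exists>m'\<ge>m. \<alpha>1 m' (e' - 1) \<noteq> 0"
              using a(2) by (intro cone_data_standard[OF \<alpha>1, of m "e - 1"]) auto
            then show ?thesis using nz False by blast
          qed
        qed
      next
        fix g \<xi> assume g: "\<forall>m e. \<alpha> m e \<noteq> 0 \<longrightarrow> e < g" and \<xi>: "\<xi> \<in> indices V - M"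
        show "\<exists>\<eta>\<in>indices V - M. \<eta> \<le> \<xi> \<and> sum \<eta> V \<le> g"
        proof (cases "\<xi> i = 0")
          case True
          have "\<And>m e. \<alpha>0 m e \<noteq> 0 \<Longrightarrow> e < g" using g nz by blast
          moreover have "\<xi> \<in> indices (V - {i}) - M0" using True \<xi> by (auto simp: M0_def indices_def)
          ultimately obtain \<eta> where \<eta>: "\<eta> \<in> indices (V - {i}) - M0" "\<eta> \<le> \<xi>" "sum \<eta> (V - {i}) \<le> g"
            using cone_data_generators[OF \<alpha>0] by blast
          have "\<eta> i = 0" using \<eta>(1) by (auto simp: indices_def)
          then have "sum \<eta> V \<le> g" using \<eta>(3) sum.remove[OF V i(1), of \<eta>] by simp
          moreover have "\<eta> \<in> indices V - M" using \<eta>(1) \<open>\<eta> i = 0\<close> by (auto simp: M0_def indices_def)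
          ultimately show ?thesis using \<eta>(2) by blast
        next
          case False
          \<comment> \<open>\<open>M\<close> is nonempty and so has a cone in degree 0; hence
            \<open>g\<close> is positive and the subtraction in \<open>g - 1\<close> does not
            truncate.\<close>
          have gpos: "0 < g" using g top[of "{}"] \<open>?P {}\<close> by blast
          have "e < g - 1" if "\<alpha>1 m e \<noteq> 0" for m e
          proof -
            from that have "\<alpha> m (Suc e) \<noteq> 0" using nz[of m "Suc e"] by simp
            then show ?thesis using g[rule_format, of m "Suc e"] by simp
          qed
          moreover have "\<xi> - unit_index i \<in> indices V - M1"
            using False \<xi> by (auto simp: M1_def remove_unit_index) (auto simp: indices_def)
          ultimately obtain \<eta> where \<eta>: "\<eta> \<in> indices V - M1" "\<eta> \<le> \<xi> - unit_index i" "sum \<eta> V \<le> g - 1"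
            using cone_data_generators[OF \<alpha>1, of "g - 1"] by blast
          have "\<eta> + unit_index i \<le> (\<xi> - unit_index i) + unit_index i"
            using \<eta>(2) by (auto simp: le_fun_def)
          then have "\<eta> + unit_index i \<le> \<xi>" using False by (simp add: remove_unit_index)
          moreover have "\<eta> + unit_index i \<in> indices V - M"
            using \<eta>(1) i(1) by (auto simp: M1_def indices_def unit_index_def)
          moreover have "sum (\<eta> + unit_index i) V \<le> g"
            using \<eta>(3) gpos by (simp only: unit_index_add_degree[OF V i(1)])
          ultimately show ?thesis by blast
        qed
      qed
      then show ?thesis by blast
    qed (use cone_data_empty cone_data_full[OF V] in blast)+
  qed
qed

section \<open>Counting cones\<close>

text \<open>If q bounds \<open>\<sigma> (Suc k)\<close> and \<open>\<pi> k + 1\<close>, then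
  \<open>\<sigma>\<close> at k + 2 is at most \<sigma> (k + 1) * (\<pi> k + 1) \<le> q^2, and \<pi>
  (k + 1) + 1 \<le> q (q - 1) + 1 \<le> q^2. The added 1 is what closes the induction.\<close>

lemma squaring_bound:
  fixes \<sigma> \<pi> :: "nat \<Rightarrow> real"
  assumes rec: "\<And>k. 1 \<le> k \<Longrightarrow> k < K \<Longrightarrow> \<sigma> (Suc k) \<le> \<sigma> k + \<pi> k"
    "\<And>k. 1 \<le> k \<Longrightarrow> k < K \<Longrightarrow> \<pi> (Suc k) \<le> \<sigma> (Suc k) * \<pi> k"
    and nonneg: "\<And>k. 0 \<le> \<sigma> k" "\<And>k. 0 \<le> \<pi> k"
    and start: "1 \<le> Q" "1 \<le> l" "\<sigma> (Suc l) \<le> Q" "\<pi> l + 1 \<le> Q"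
    and k: "l \<le> k" "k < K"
  shows "\<sigma> (Suc k) \<le> Q ^ 2 ^ (k - l) \<and> \<pi> k + 1 \<le> Q ^ 2 ^ (k - l)"
  using k
proof (induction k rule: dec_induct)
  case base
  then show ?case using start by simp
next
  case (step k)
  define q where "q = Q ^ 2 ^ (k - l)"
  have q: "\<sigma> (Suc k) \<le> q" "\<pi> k + 1 \<le> q" "1 \<le> q"
    using step start(1) by (auto simp: q_def)
  have "q\<^sup>2 = Q ^ 2 ^ (Suc k - l)"
    using step.hyps by (simp add: q_def Suc_diff_le power_mult[symmetric] mult.commute)
  moreover have "\<pi> (Suc k) \<le> \<sigma> (Suc k) * \<pi> k"
    using step start(2) by (intro rec) auto
  moreover have "\<sigma> (Suc (Suc k)) \<le> \<sigma> (Suc k) + \<pi> (Suc k)"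
    using step start(2) by (intro rec) auto
  moreover have "\<sigma> (Suc k) * (\<pi> k + 1) \<le> q * q" "\<sigma> (Suc k) * \<pi> k \<le> q * (q - 1)"
    using q nonneg(1)[of "Suc k"] nonneg(2)[of k] by (intro mult_mono; simp)+
  ultimately show ?case
    using q(3) by (auto simp: power2_eq_square algebra_simps)
qed

text \<open>Let X = d^2/2 + d. For d at least 2 one has 2X \<le> X^2, so X^2 bounds
  \<open>\<sigma> 2\<close> and \<open>\<pi> 1 + 1\<close>, and squaring can start at once. For d =
  1 this fails, as X is only 3/2: the bounds 2, 3, 6, 24 are computed by hand, and only 24 lies
  below the matching power X^8, so squaring starts there. The first three fit because of the factor
  2 in the bound.\<close>

lemma degree_bound_recursion:
  fixes \<sigma> \<pi> :: "nat \<Rightarrow> real"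
  assumes rec: "\<And>k. 1 \<le> k \<Longrightarrow> k < K \<Longrightarrow> \<sigma> (Suc k) \<le> \<sigma> k + \<pi> k"
    "\<And>k. 1 \<le> k \<Longrightarrow> k < K \<Longrightarrow> \<pi> (Suc k) \<le> \<sigma> (Suc k) * \<pi> k"
    and nonneg: "\<And>k. 0 \<le> \<sigma> k" "\<And>k. 0 \<le> \<pi> k"
    and start: "\<sigma> 1 \<le> 2 * real d" "\<pi> 1 \<le> (real d)\<^sup>2" and K: "1 \<le> K"
  shows "\<sigma> K \<le> degree_bound K d"
proof -
  define X where "X = (real d)\<^sup>2 / 2 + real d"
  have bound: "degree_bound K d = 2 * X ^ 2 ^ (K - 1)"
    by (simp add: degree_bound_def X_def)
  consider "d = 0" | "d = 1" | "2 \<le> d" by linarith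
  then show ?thesis
  proof cases
    case 1
    have "\<sigma> (Suc k) \<le> 0 \<and> \<pi> (Suc k) \<le> 0" if "k < K" for k
      using that
    proof (induction k)
      case 0
      then show ?case using start 1 by simp
    next
      case (Suc k)
      then have "\<sigma> (Suc (Suc k)) \<le> 0" using rec(1)[of "Suc k"] by simp
      moreover from this have "\<pi> (Suc (Suc k)) \<le> 0"
        using rec(2)[of "Suc k"] Suc nonneg(1)[of "Suc (Suc k)"] by simp
      ultimately show ?case by simp
    qed
    from this[of "K - 1"] K have "\<sigma> K \<le> 0" by simp
    then show ?thesis by (simp add: degree_bound_def 1 power_0_left)
  next
    case 2
    have X: "X = 3 / 2" by (simp add: X_def 2)
    have s1: "\<sigma> 1 \<le> 2" "\<pi> 1 \<le> 1" using start 2 by simp_all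
    have s2: "\<sigma> 2 \<le> 3" if "1 < K" using rec(1)[of 1] s1 that by (simp add: numeral_2_eq_2)
    have p2: "\<pi> 2 \<le> 3" if "1 < K"
      using rec(2)[of 1] s1 s2[OF that] that mult_mono[of "\<sigma> 2" 3 "\<pi> 1" 1] nonneg
      by (simp add: numeral_2_eq_2)
    have s3: "\<sigma> 3 \<le> 6" if "2 < K"
      using rec(1)[of 2] s2 p2 that by (simp add: numeral_3_eq_3 numeral_2_eq_2)
    have p3: "\<pi> 3 \<le> 18" if "2 < K"
      using rec(2)[of 2] p2 s3[OF that] that mult_mono[of "\<sigma> 3" 6 "\<pi> 2" 3] nonneg
      by (simp add: numeral_3_eq_3 numeral_2_eq_2)
    have s4: "\<sigma> 4 \<le> 24" if "3 < K"
      using rec(1)[of 3] s3 p3 that by (simp add: numeral_eq_Suc)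
    consider "K = 1" | "K = 2" | "K = 3" | "3 < K" using K by linarith
    then show ?thesis
    proof cases
      case 4
      have "\<sigma> (Suc (K - 1)) \<le> 24 ^ 2 ^ (K - 1 - 3)"
        using squaring_bound[of K \<sigma> \<pi> 24 3 "K - 1", OF rec nonneg] s4 p3 4 by (simp add: numeral_eq_Suc)
      also have "\<dots> \<le> (X ^ 8) ^ 2 ^ (K - 1 - 3)"
        by (intro power_mono) (auto simp: X field_simps)
      also have "\<dots> = X ^ 2 ^ (K - 1)"
      proof -
        have "(8::nat) * 2 ^ (K - 1 - 3) = 2 ^ (3 + (K - 1 - 3))" by (simp only: power_add) simp
        then show ?thesis using 4 by (simp add: power_mult[symmetric])
      qed
      also have "\<dots> \<le> 2 * X ^ 2 ^ (K - 1)" by (simp add: X)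
      finally show ?thesis using 4 by (simp add: bound)
    qed (use s1 s2 s3 in \<open>auto simp: degree_bound_def 2 power_numeral_reduce\<close>)
  next
    case 3
    then have d: "2 \<le> real d" by simp
    then have "2 * 2 \<le> real d * real d" by (intro mult_mono) auto
    then have X4: "4 \<le> X" using d by (simp add: X_def power2_eq_square)
    have XX: "2 * X \<le> X\<^sup>2" using mult_right_mono[of 2 X X] X4 by (simp add: power2_eq_square)
    show ?thesis
    proof (cases "K = 1")
      case True
      then show ?thesis using order_trans[OF start(1), of "2 * real d + (real d)\<^sup>2"]
        by (simp add: degree_bound_def add.commute)
    next
      case False
      have s2: "\<sigma> 2 \<le> X\<^sup>2"
        using rec(1)[of 1] False K start XX by (simp add: X_def numeral_2_eq_2)
      have p1: "\<pi> 1 + 1 \<le> X\<^sup>2"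
        using XX d start(2) by (simp add: X_def)
      have "\<sigma> (Suc (K - 1)) \<le> (X\<^sup>2) ^ 2 ^ (K - 1 - 1)"
        using squaring_bound[of K \<sigma> \<pi> "X\<^sup>2" 1 "K - 1", OF rec nonneg] s2 p1 one_le_power[of X 2] X4 False K
        by (simp add: Suc_1[symmetric] del: Suc_1 One_nat_def)
      also have "\<dots> = X ^ 2 ^ (K - 1)"
      proof -
        have "(2::nat) * 2 ^ (K - 1 - 1) = 2 ^ (Suc (K - 1 - 1))" by simp
        also have "Suc (K - 1 - 1) = K - 1" using False K by simp
        finally show ?thesis by (simp only: power_mult[symmetric])
      qed
      also have "\<dots> \<le> 2 * X ^ 2 ^ (K - 1)" using X4 by simp
      finally show ?thesis using K by (simp add: bound)
    qed
  qed
qed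

lemma sum_lessThan_add:
  "(\<Sum>e<k + l. f e) = (\<Sum>e<k. f e) + (\<Sum>e<l. f (k + e))" for f :: "nat \<Rightarrow> int"
  by (induction l) simp_all

text \<open>
  The functions \<open>G j\<close> are the backward differences of the partial Hilbert functions. Their positive
  mass \<open>P j\<close> and the number \<open>S j\<close> of cones of dimension at least \<open>j\<close> (offset by \<open>d\<close>) control each
  other, as \<open>G j\<close> is summed from \<open>G (Suc j)\<close> and lives on an interval of length \<open>S (Suc j)\<close>.
\<close>

lemma cone_count_bound:
  fixes \<gamma> G :: "nat \<Rightarrow> nat \<Rightarrow> int"
  assumes n: "2 \<le> n"
    and G0: "G 0 = \<gamma> 0"
    and G_Suc: "\<And>j. j < n \<Longrightarrow> G (Suc j) = \<gamma> (Suc j) + diff (G j)"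
    and G_top: "G n = delta 0 - delta d"
    and nonneg: "\<And>m e. 0 \<le> \<gamma> m e"
    and zero: "\<And>m e. m \<le> n \<Longrightarrow> E \<le> e \<Longrightarrow> \<gamma> m e = 0" "\<And>m e. m \<le> n \<Longrightarrow> E \<le> e \<Longrightarrow> G m e = 0"
    and interval: "\<And>m e e'. m \<le> n \<Longrightarrow> \<gamma> m e \<noteq> 0 \<Longrightarrow> d \<le> e' \<Longrightarrow> e' \<le> e \<Longrightarrow> \<exists>m'\<ge>m. m' \<le> n \<and> \<gamma> m' e' \<noteq> 0"
  shows "\<exists>g. real g \<le> degree_bound (n - 1) d \<and> (\<forall>m\<le>n. \<forall>e. \<gamma> m e \<noteq> 0 \<longrightarrow> e < g)"
proof -
  define tot where "tot f = (\<Sum>e\<le>E. f e)" for f :: "nat \<Rightarrow> int"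
  define S where "S j = int d + (\<Sum>i=j..n. tot (\<gamma> i))" for j
  define P where "P j = (\<Sum>e\<le>E. max 0 (G j e))" for j
  have psum: "(\<Sum>e'\<le>e. diff f e') = f e" for f e
    using fun_cong[OF partial_sums_diff, of f e] by (simp only: partial_sums_def)
  have dE: "d \<le> E"
  proof (rule ccontr)
    assume "\<not> d \<le> E"
    then have "G n d = - 1" "G n d = 0" using G_top zero(2)[of n d] by (auto simp: delta_def)
    then show False by simp
  qed
  \<comment> \<open>A finitely supported sequence has differences with sum 0, so of the recursion
    for \<open>G j\<close> only the mass of \<open>\<gamma> j\<close> is left.\<close>
  have totG: "tot (G j) = tot (\<gamma> j)" if "j \<le> n" for j
  proof (cases j)
    case (Suc k)
    then have "tot (G j) = tot (\<gamma> j) + tot (diff (G k))"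
      using that by (simp add: G_Suc tot_def sum.distrib)
    also have "tot (diff (G k)) = 0"
      using zero(2)[of k E] that Suc by (simp add: tot_def psum)
    finally show ?thesis by simp
  qed (simp add: G0)
  have tot_nonneg: "0 \<le> tot (\<gamma> j)" for j
    by (simp add: tot_def nonneg sum_nonneg)
  have "tot (G n) = 0"
    using dE by (simp add: G_top tot_def delta_def sum_subtractf)
  \<comment> \<open>The masses of \<open>delta 0\<close> and \<open>delta d\<close> cancel, so there
    are no cones of the top dimension \<open>n\<close>.\<close>
  then have "tot (\<gamma> n) = 0" by (simp add: totG)
  then have "\<gamma> n e = 0" if "e \<le> E" for e
    using that nonneg by (simp add: tot_def sum_nonneg_eq_0_iff)
  then have \<gamma>n: "\<gamma> n e = 0" for e
    using zero(1)[of n e] by (cases "e \<le> E") auto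
  have Sn: "S n = int d"
    by (simp add: S_def \<open>tot (\<gamma> n) = 0\<close>)
  have S_rec: "S j = S (Suc j) + tot (\<gamma> j)" if "j \<le> n" for j
    using that by (simp add: S_def sum.atLeast_Suc_atMost)
  have S_nonneg: "0 \<le> S j" for j
    by (simp add: S_def tot_nonneg sum_nonneg)
  have P_nonneg: "0 \<le> P j" for j
    by (simp add: P_def sum_nonneg)
  \<comment> \<open>Each degree from d to e would contain a cone of dimension at least m, which
    makes e - d + 1 cones. The offset d in \<open>S\<close> stands for the degrees below d, where no
    cone is guaranteed.\<close>
  have \<gamma>_zero: "\<gamma> m e = 0" if m: "m \<le> n" "S m \<le> int e" for m e
  proof (rule ccontr)
    assume nz: "\<gamma> m e \<noteq> 0"
    then have eE: "e < E" using zero(1)[OF m(1), of e] by (cases "E \<le> e") auto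
    have "1 \<le> (\<Sum>i=m..n. \<gamma> i e')" if "d \<le> e'" "e' \<le> e" for e'
    proof -
      obtain m' where m': "m \<le> m'" "m' \<le> n" "\<gamma> m' e' \<noteq> 0"
        using interval[OF m(1) nz \<open>d \<le> e'\<close> \<open>e' \<le> e\<close>] by blast
      then have "1 \<le> \<gamma> m' e'" using nonneg[of m' e'] by simp
      also have "\<dots> \<le> (\<Sum>i=m..n. \<gamma> i e')"
        using m' by (intro member_le_sum) (auto simp: nonneg)
      finally show ?thesis .
    qed
    then have "(\<Sum>e'\<in>{d..e}. 1) \<le> (\<Sum>e'\<in>{d..e}. \<Sum>i=m..n. \<gamma> i e')"
      by (intro sum_mono) auto
    also have "\<dots> \<le> (\<Sum>e'\<le>E. \<Sum>i=m..n. \<gamma> i e')"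
      using eE by (intro sum_mono2) (auto simp: nonneg sum_nonneg)
    also have "\<dots> = (\<Sum>i=m..n. tot (\<gamma> i))"
      unfolding tot_def by (rule sum.swap)
    finally show False
      using m(2) sum_nonneg[of "{m..n}" "\<lambda>i. tot (\<gamma> i)"] tot_nonneg by (auto simp: S_def)
  qed
  have dG: "diff (G j) e = G (Suc j) e - \<gamma> (Suc j) e" if "j < n" for j e
    using G_Suc[OF that] by simp
  \<comment> \<open>\<open>G j\<close> is read from its right end, where it vanishes: as long as no
    difference is met, it stays 0.\<close>
  have G_const: "G j e = 0" if "j < n" "\<And>e'. e < e' \<Longrightarrow> diff (G j) e' = 0" for j e
  proof -
    have "(\<Sum>e'\<le>e. diff (G j) e') = (\<Sum>e'\<le>max e E. diff (G j) e')"
      by (rule sum.mono_neutral_left) (auto intro: that(2))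
    then show ?thesis
      using zero(2)[of j "max e E"] that(1) by (simp add: psum)
  qed
  have G_supp: "G j e = 0" if "j < n" "S (Suc j) \<le> int e" for j e
    using that
  proof (induction "n - Suc j" arbitrary: j e)
    case 0
    then have j: "Suc j = n" by simp
    have "diff (G j) = delta 0 - delta d"
      using G_Suc[of j] j \<gamma>n G_top by (auto simp: fun_eq_iff)
    then have "G j e = (\<Sum>e'\<le>e. delta 0 e' - delta d e')"
      using psum[of "G j" e] by simp
    then show ?case
      using 0(3) Sn j by (simp add: delta_def sum_subtractf)
  next
    case (Suc k)
    have j: "k = n - Suc (Suc j)" "Suc j < n" using Suc.hyps(2) by auto
    have "diff (G j) e' = 0" if "e < e'" for e'
    proof -
      have "S (Suc j) \<le> int e'" "S (Suc (Suc j)) \<le> int e'"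
        using that Suc.prems(2) S_rec[of "Suc j"] tot_nonneg[of "Suc j"] j by auto
      then show ?thesis
        using Suc.hyps(1)[OF j] \<gamma>_zero[of "Suc j" e'] dG[OF Suc.prems(1)] j by simp
    qed
    then show ?case by (rule G_const[OF Suc.prems(1)])
  qed
  have G_le: "G j e \<le> (\<Sum>e'\<le>e. G (Suc j) e') - (\<Sum>e'\<le>e. \<gamma> (Suc j) e')" if "j < n" for j e
    using psum[of "G j" e] by (simp add: dG[OF that] sum_subtractf)
  \<comment> \<open>Dropping the subtracted cones leaves partial sums of \<open>G (Suc j)\<close>,
    each at most \<open>P (Suc j)\<close>, and only degrees below \<open>S (Suc j)\<close>
    contribute.\<close>
  have P_rec: "P j \<le> S (Suc j) * P (Suc j)" if j: "j < n" for j
  proof -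
    have "max 0 (G j e) \<le> (if int e < S (Suc j) then P (Suc j) else 0)" if e: "e \<le> E" for e
    proof (cases "int e < S (Suc j)")
      case True
      have "G j e \<le> (\<Sum>e'\<le>e. G (Suc j) e')"
        using G_le[OF j, of e] nonneg sum_nonneg[of "{..e}" "\<gamma> (Suc j)"] by simp
      also have "\<dots> \<le> (\<Sum>e'\<le>e. max 0 (G (Suc j) e'))" by (intro sum_mono) simp
      also have "\<dots> \<le> P (Suc j)" unfolding P_def using e by (intro sum_mono2) auto
      finally show ?thesis using True P_nonneg by simp
    next
      case False
      then show ?thesis using G_supp[OF j, of e] by simp
    qed
    then have "P j \<le> (\<Sum>e\<le>E. if int e < S (Suc j) then P (Suc j) else 0)"
      unfolding P_def by (intro sum_mono) auto
    also have "\<dots> = int (card {e. e \<le> E \<and> int e < S (Suc j)}) * P (Suc j)"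
      by (simp add: sum.If_cases Int_def)
    also have "\<dots> \<le> S (Suc j) * P (Suc j)"
    proof (intro mult_right_mono P_nonneg)
      have "{e. e \<le> E \<and> int e < S (Suc j)} \<subseteq> {..<nat (S (Suc j))}" by auto
      then have "card {e. e \<le> E \<and> int e < S (Suc j)} \<le> nat (S (Suc j))"
        using card_mono[OF finite_lessThan] by fastforce
      then show "int (card {e. e \<le> E \<and> int e < S (Suc j)}) \<le> S (Suc j)"
        using S_nonneg[of "Suc j"] by linarith
    qed
    finally show ?thesis .
  qed
  have S_P: "S j \<le> S (Suc j) + P j" if "j \<le> n" for j
  proof -
    have "tot (G j) \<le> P j" unfolding tot_def P_def by (intro sum_mono) simp
    then show ?thesis using S_rec[OF that] totG[OF that] by simp
  qed
  obtain q where q: "n = Suc (Suc q)"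
    using le_Suc_ex[OF n] by auto
  then have n1: "Suc (Suc q) = n" "Suc q < n" "q < n" "Suc q \<le> n" by auto
  have Gn1: "G (Suc q) e = (if e < d then 1 else 0)" for e
  proof -
    have "diff (G (Suc q)) = delta 0 - delta d"
      using G_Suc[of "Suc q"] n1 \<gamma>n G_top by (auto simp: fun_eq_iff)
    then have "G (Suc q) e = (\<Sum>e'\<le>e. delta 0 e' - delta d e')"
      using psum[of "G (Suc q)" e] by simp
    then show ?thesis by (auto simp: delta_def sum_subtractf)
  qed
  \<comment> \<open>\<open>G (n - 1)\<close> is the indicator of the degrees below d, so there are d
    cones of dimension n - 1; the offset contributes the other d.\<close>
  have S1: "S (Suc q) = 2 * int d"
  proof -
    have "tot (G (Suc q)) = (\<Sum>e\<le>E. if e < d then 1 else 0)" by (simp only: tot_def Gn1)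
    also have "\<dots> = int (card {e. e \<le> E \<and> e < d})" by (simp add: sum.If_cases Int_def)
    also have "{e. e \<le> E \<and> e < d} = {..<d}" using dE by auto
    finally show ?thesis using S_rec[of "Suc q"] totG[of "Suc q"] n1 Sn by simp
  qed
  have P2: "P q \<le> (int d)\<^sup>2"
  proof -
    \<comment> \<open>\<open>P_rec\<close> would give only 2d^2 here. The tent \<open>b\<close>,
      rising up to d and then falling, gives d^2: past d the cones of dimension n - 1 fill every
      degree up to their last one, and each lowers the partial sum by at least 1.\<close>
    define b where "b e = (if e < d then int e + 1 else if e < 2 * d then 2 * int d - 1 - int e else 0)" for e
    have "max 0 (G q e) \<le> b e" for e
    proof (cases "e < d")
      case True
      have "G q e \<le> (\<Sum>e'\<le>e. G (Suc q) e')"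
        using G_le[of q e] n1 nonneg sum_nonneg[of "{..e}" "\<gamma> (Suc q)"] by simp
      also have "\<dots> = int e + 1" using True by (simp add: Gn1)
      finally show ?thesis using True by (simp add: b_def)
    next
      case False
      show ?thesis
      proof (cases "\<exists>e''\<ge>e. \<gamma> (Suc q) e'' \<noteq> 0")
        case True
        then obtain e'' where e'': "e \<le> e''" "\<gamma> (Suc q) e'' \<noteq> 0" by blast
        have "1 \<le> \<gamma> (Suc q) e'" if e': "d \<le> e'" "e' \<le> e" for e'
        proof -
          obtain m' where m': "Suc q \<le> m'" "m' \<le> n" "\<gamma> m' e' \<noteq> 0"
            using interval[OF n1(4) e''(2) e'(1) order_trans[OF e'(2) e''(1)]] by blast
          then have "m' = Suc q" using \<gamma>n[of e'] q by (cases "m' = n") auto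
          then show ?thesis using m'(3) nonneg[of "Suc q" e'] by simp
        qed
        then have "(\<Sum>e'\<in>{d..e}. 1) \<le> (\<Sum>e'\<in>{d..e}. \<gamma> (Suc q) e')"
          by (intro sum_mono) auto
        also have "\<dots> \<le> (\<Sum>e'\<le>e. \<gamma> (Suc q) e')"
          by (intro sum_mono2) (auto simp: nonneg)
        finally have 1: "int e + 1 - int d \<le> (\<Sum>e'\<le>e. \<gamma> (Suc q) e')"
          using False by simp
        have "(\<Sum>e'\<le>e. G (Suc q) e') = int (card {e'. e' \<le> e \<and> e' < d})"
          by (simp add: Gn1 sum.If_cases Int_def)
        also have "{e'. e' \<le> e \<and> e' < d} = {..<d}" using False by auto
        finally have "G q e \<le> 2 * int d - 1 - int e"
          using G_le[of q e] n1 1 by simp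
        moreover have "int e < 2 * int d"
        proof (rule ccontr)
          assume "\<not> int e < 2 * int d"
          then have "\<gamma> (Suc q) e'' = 0" using e''(1) S1 n1 by (intro \<gamma>_zero) auto
          then show False using e''(2) by simp
        qed
        ultimately show ?thesis using False by (simp add: b_def)
      next
        \<comment> \<open>No cone of dimension n - 1 has degree e or more, so all later differences
          of \<open>G q\<close> vanish, and with them \<open>G q e\<close>.\<close>
        case False
        then have "G q e = 0"
          using \<open>\<not> e < d\<close> n1 by (intro G_const) (auto simp: dG Gn1)
        then show ?thesis by (simp add: b_def)
      qed
    qed
    then have "P q \<le> (\<Sum>e\<le>E. b e)"
      unfolding P_def by (intro sum_mono)
    also have "\<dots> \<le> (\<Sum>e<d + d + E + 1. b e)"
      by (intro sum_mono2) (auto simp: b_def)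
    also have "\<dots> = (\<Sum>e<d + d. b e)"
      by (rule sum.mono_neutral_right) (auto simp: b_def)
    \<comment> \<open>The tent is folded: the value at e and the one at d + e add up to d.\<close>
    also have "\<dots> = (\<Sum>e<d. b e + b (d + e))"
      by (simp only: sum_lessThan_add sum.distrib)
    also have "\<dots> = (\<Sum>e<d. int d)"
      by (intro sum.cong) (auto simp: b_def)
    finally show ?thesis by (simp add: power2_eq_square)
  qed
  \<comment> \<open>Step k of the recursion belongs to dimension n - k. As \<open>\<pi>\<close> is
    one dimension ahead of \<open>\<sigma>\<close>, the starting values are \<open>S (n - 1)\<close>
    and \<open>P (n - 2)\<close>.\<close>
  have "real_of_int (S (n - (n - 1))) \<le> degree_bound (n - 1) d"
  proof (rule degree_bound_recursion[where \<sigma> = "\<lambda>k. real_of_int (S (n - k))" and \<pi> = "\<lambda>k. real_of_int (P (n - 1 - k))"])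
    fix k assume k: "1 \<le> k" "k < n - 1"
    have e: "n - k = Suc (n - Suc k)" "n - 1 - k = n - Suc k" "n - 1 - k = Suc (n - 1 - Suc k)"
      using k by auto
    have "S (n - Suc k) \<le> S (n - k) + P (n - 1 - k)"
      using S_P[of "n - Suc k"] e by simp
    then show "real_of_int (S (n - Suc k)) \<le> real_of_int (S (n - k)) + real_of_int (P (n - 1 - k))"
      by (metis of_int_le_iff of_int_add)
    have "P (n - 1 - Suc k) \<le> S (n - Suc k) * P (n - 1 - k)"
      using P_rec[of "n - 1 - Suc k"] e k by simp
    then show "real_of_int (P (n - 1 - Suc k)) \<le> real_of_int (S (n - Suc k)) * real_of_int (P (n - 1 - k))"
      by (metis of_int_le_iff of_int_mult)
  next
    show "real_of_int (P (n - 1 - 1)) \<le> (real d)\<^sup>2"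
    proof -
      have "real_of_int (P q) \<le> real_of_int ((int d)\<^sup>2)" using P2 by (simp only: of_int_le_iff)
      then show ?thesis by (simp add: q)
    qed
  qed (use S_nonneg P_nonneg S1 q in auto)
  \<comment> \<open>\<open>S 1\<close> does not count cones of dimension 0. Their degrees are
    bounded through \<open>G 0 = \<gamma> 0\<close>, whose support already ends before
    \<open>S 1\<close>.\<close>
  moreover have "int e < S 1" if "m \<le> n" "\<gamma> m e \<noteq> 0" for m e
  proof (cases "m = 0")
    case True
    then have "G 0 e \<noteq> 0" using that G0 by simp
    then show ?thesis using G_supp[of 0 e] n by force
  next
    case False
    have "S j \<le> S 1" if "1 \<le> j" "j \<le> n" for j
      using that
    proof (induction j rule: dec_induct)
      case (step j)
      then show ?case using S_rec[of j] tot_nonneg[of j] by simp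
    qed simp
    then have "S m \<le> S 1" using False that by simp
    then show ?thesis using \<gamma>_zero[of m e] that by force
  qed
  ultimately show ?thesis
    using n S_nonneg[of 1] by (intro exI[of _ "nat (S 1)"]) (auto simp: zless_nat_eq_int_zless)
qed

section \<open>From the cone count to the degrees of generators\<close>

lemma inj_partial_sums_funpow: "(partial_sums ^^ n) f = (partial_sums ^^ n) g \<Longrightarrow> f = g"
proof (induction n)
  case (Suc n)
  then have "diff (partial_sums ((partial_sums ^^ n) f)) = diff (partial_sums ((partial_sums ^^ n) g))"
    by simp
  then show ?case using Suc.IH by simp
qed simp

lemma finite_support_bound:
  fixes \<gamma> :: "nat \<Rightarrow> nat \<Rightarrow> int"
  assumes "\<And>m. finite {e. \<gamma> m e \<noteq> 0}"
  obtains E where "\<And>m e. m \<le> n \<Longrightarrow> E \<le> e \<Longrightarrow> \<gamma> m e = 0"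
proof -
  have "finite (\<Union>m\<le>n. {e. \<gamma> m e \<noteq> 0})" using assms by blast
  then obtain E where "\<forall>e\<in>(\<Union>m\<le>n. {e. \<gamma> m e \<noteq> 0}). e < E"
    using finite_nat_set_iff_bounded by blast
  then show thesis using that[of E] by force
qed

text \<open>The cones of \<open>M\<close> are merged with those of all \<open>C i\<close>, the
  latter moved up by d. The merged family is standard only from degree d on, which is what
  \<open>cone_count_bound\<close> asks for. Cancelling the (N + 1)-fold summation in the equation of
  Hilbert functions then yields the top condition on \<open>G\<close>.\<close>

lemma generator_degree_bound:
  assumes V: "finite V" "card V = Suc N" and N: "1 \<le> N" and A: "finite A"
    and M: "down_closed V M" and C: "\<And>i. i \<in> A \<Longrightarrow> down_closed V (C i)"
    and hilbert: "hilb V (indices V)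
      = hilb V M + (shift ^^ d) (hilb V (indices V) + (\<Sum>i\<in>A. hilb V (C i)))"
    and \<xi>: "\<xi> \<in> indices V - M"
  shows "\<exists>\<eta>\<in>indices V - M. \<eta> \<le> \<xi> \<and> real (sum \<eta> V) \<le> degree_bound N d"
proof -
  define n where "n = Suc N"
  obtain \<alpha> where \<alpha>: "cone_data V M \<alpha>"
    using cone_data_exists[OF V(1) M] by blast
  have "\<forall>i\<in>A. \<exists>\<kappa>. cone_data V (C i) \<kappa>"
    using cone_data_exists[OF V(1) C] by blast
  then obtain \<kappa> where \<kappa>: "\<And>i. i \<in> A \<Longrightarrow> cone_data V (C i) (\<kappa> i)"
    by (elim bchoice[THEN exE]) blast
  define \<beta> where "\<beta> m = (\<Sum>i\<in>A. \<kappa> i m)" for m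
  define \<gamma> where "\<gamma> m = \<alpha> m + (shift ^^ d) (\<beta> m)" for m
  have sum_apply: "(\<Sum>i\<in>A. \<kappa> i m) e = (\<Sum>i\<in>A. \<kappa> i m e)" for m e
    using A by (induction A rule: finite_induct) auto
  have \<gamma>_eq: "\<gamma> m e = \<alpha> m e + (if e < d then 0 else \<Sum>i\<in>A. \<kappa> i m (e - d))" for m e
    by (simp add: \<gamma>_def shift_funpow_apply \<beta>_def sum_apply)
  have \<alpha>_nonneg: "0 \<le> \<alpha> m e" and \<kappa>_nonneg: "i \<in> A \<Longrightarrow> 0 \<le> \<kappa> i m e" for m e i
    using cone_data_nonneg[OF \<alpha>] cone_data_nonneg[OF \<kappa>] by auto
  have \<gamma>_nonneg: "0 \<le> \<gamma> m e" for m e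
    by (auto simp: \<gamma>_eq \<alpha>_nonneg \<kappa>_nonneg sum_nonneg)
  have sum_nz: "(\<Sum>i\<in>A. \<kappa> i m e) \<noteq> 0 \<longleftrightarrow> (\<exists>i\<in>A. \<kappa> i m e \<noteq> 0)" for m e
    using A \<kappa>_nonneg by (simp add: sum_nonneg_eq_0_iff)
  have \<gamma>_nz: "\<gamma> m e \<noteq> 0 \<longleftrightarrow> \<alpha> m e \<noteq> 0 \<or> (d \<le> e \<and> (\<exists>i\<in>A. \<kappa> i m (e - d) \<noteq> 0))" for m e
  proof -
    have "0 \<le> (\<Sum>i\<in>A. \<kappa> i m (e - d))" by (simp add: \<kappa>_nonneg sum_nonneg)
    then show ?thesis using \<alpha>_nonneg[of m e] sum_nz[of m "e - d"] by (auto simp: \<gamma>_eq)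
  qed
  have cone_le: "m \<le> n" if "cone_data V M' \<nu>" "\<nu> m e \<noteq> 0" for M' \<nu> m e
    using cone_data_dim[OF that] card_mono[OF V(1)] V(2) unfolding n_def by metis
  \<comment> \<open>Horner's scheme in 1 - t: \<open>G j\<close> is the sequence whose j-fold
    summation is the Hilbert function of all cones of dimension at most j.\<close>
  define G where "G = rec_nat (\<gamma> 0) (\<lambda>j g. \<gamma> (Suc j) + diff g)"
  have G_0: "G 0 = \<gamma> 0" and G_Suc: "G (Suc j) = \<gamma> (Suc j) + diff (G j)" for j
    by (simp_all add: G_def)
  have G_sum: "(partial_sums ^^ j) (G j) = (\<Sum>m\<le>j. (partial_sums ^^ m) (\<gamma> m))" for j
  proof (induction j)
    case (Suc j)
    have "(partial_sums ^^ Suc j) (G (Suc j))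
        = (partial_sums ^^ Suc j) (\<gamma> (Suc j)) + (partial_sums ^^ Suc j) (diff (G j))"
      by (simp only: G_Suc partial_sums_funpow_add)
    also have "(partial_sums ^^ Suc j) (diff (G j)) = (partial_sums ^^ j) (G j)"
      by (simp only: funpow_Suc_right o_apply partial_sums_diff)
    finally show ?case using Suc by (simp only: sum.atMost_Suc add.commute)
  qed (simp add: G_0)
  have "(partial_sums ^^ n) (delta 0)
      = (\<Sum>m\<le>n. (partial_sums ^^ m) (\<alpha> m)) + ((shift ^^ d) ((partial_sums ^^ n) (delta 0))
        + (\<Sum>i\<in>A. (shift ^^ d) (\<Sum>m\<le>n. (partial_sums ^^ m) (\<kappa> i m))))"
  proof -
    have "hilb V (indices V) = (partial_sums ^^ n) (delta 0)"
      using hilb_indices[OF V(1)] V(2) by (simp only: n_def)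
    moreover have "hilb V M = (\<Sum>m\<le>n. (partial_sums ^^ m) (\<alpha> m))"
      using V(2) by (intro cone_data_hilb[OF \<alpha>]) (simp add: n_def)
    moreover have "(\<Sum>i\<in>A. hilb V (C i)) = (\<Sum>i\<in>A. \<Sum>m\<le>n. (partial_sums ^^ m) (\<kappa> i m))"
      using V(2) by (intro sum.cong refl cone_data_hilb[OF \<kappa>]) (auto simp: n_def)
    ultimately show ?thesis
      using hilbert by (simp only: shift_funpow_add shift_funpow_sum)
  qed
  also have "(\<Sum>i\<in>A. (shift ^^ d) (\<Sum>m\<le>n. (partial_sums ^^ m) (\<kappa> i m)))
      = (\<Sum>m\<le>n. (partial_sums ^^ m) ((shift ^^ d) (\<beta> m)))"
    unfolding \<beta>_def shift_funpow_sum partial_sums_funpow_sum partial_sums_funpow_shift_funpow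
    by (rule sum.swap)
  also have "(shift ^^ d) ((partial_sums ^^ n) (delta 0)) = (partial_sums ^^ n) (delta d)"
    by (simp only: partial_sums_funpow_shift_funpow[symmetric] shift_delta)
  also have "(\<Sum>m\<le>n. (partial_sums ^^ m) (\<alpha> m)) + ((partial_sums ^^ n) (delta d)
        + (\<Sum>m\<le>n. (partial_sums ^^ m) ((shift ^^ d) (\<beta> m))))
      = (partial_sums ^^ n) (delta d) + (\<Sum>m\<le>n. (partial_sums ^^ m) (\<gamma> m))"
    by (simp only: \<gamma>_def partial_sums_funpow_add sum.distrib add_ac)
  also have "\<dots> = (partial_sums ^^ n) (delta d + G n)"
    by (simp only: G_sum partial_sums_funpow_add)
  finally have "delta 0 = delta d + G n"
    by (rule inj_partial_sums_funpow)
  then have G_top: "G n = delta 0 - delta d"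
    by (simp add: algebra_simps del: plus_fun_apply)
  have "finite {e. \<gamma> m e \<noteq> 0}" for m
  proof -
    have "{e. \<gamma> m e \<noteq> 0} \<subseteq> {e. \<alpha> m e \<noteq> 0} \<union> (\<Union>i\<in>A. (\<lambda>e. e + d) ` {e. \<kappa> i m e \<noteq> 0})"
    proof
      fix e assume "e \<in> {e. \<gamma> m e \<noteq> 0}"
      then consider "\<alpha> m e \<noteq> 0" | i where "d \<le> e" "i \<in> A" "\<kappa> i m (e - d) \<noteq> 0"
        using \<gamma>_nz by blast
      then show "e \<in> {e. \<alpha> m e \<noteq> 0} \<union> (\<Union>i\<in>A. (\<lambda>e. e + d) ` {e. \<kappa> i m e \<noteq> 0})"
      proof cases
        case (2 i)
        then have "e = (e - d) + d" "e - d \<in> {e. \<kappa> i m e \<noteq> 0}" by auto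
        then show ?thesis using 2(2) by blast
      qed simp
    qed
    moreover have "finite ({e. \<alpha> m e \<noteq> 0} \<union> (\<Union>i\<in>A. (\<lambda>e. e + d) ` {e. \<kappa> i m e \<noteq> 0}))"
      using cone_data_finite[OF \<alpha>] cone_data_finite[OF \<kappa>] A by blast
    ultimately show ?thesis by (rule finite_subset)
  qed
  then obtain E0 where E0: "\<And>m e. m \<le> n \<Longrightarrow> E0 \<le> e \<Longrightarrow> \<gamma> m e = 0"
    using finite_support_bound[of \<gamma> n] by blast
  \<comment> \<open>Each differencing may extend the support by one degree.\<close>
  have G_supp: "G j e = 0" if "j \<le> n" "E0 + j \<le> e" for j e
    using that
  proof (induction j arbitrary: e)
    case (Suc j)
    then have "G j e = 0" "G j (e - 1) = 0" "\<gamma> (Suc j) e = 0"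
      by (auto intro: E0)
    then show ?case by (simp add: G_Suc diff_def shift_def)
  qed (simp add: G_0 E0)
  have interval: "\<exists>m'\<ge>m. m' \<le> n \<and> \<gamma> m' e' \<noteq> 0" if nz: "\<gamma> m e \<noteq> 0" and e': "d \<le> e'" "e' \<le> e" for m e e'
  proof -
    from nz consider "\<alpha> m e \<noteq> 0" | i where "i \<in> A" "\<kappa> i m (e - d) \<noteq> 0"
      using \<gamma>_nz by blast
    then show ?thesis
    proof cases
      case 1
      then obtain m' where "m \<le> m'" "\<alpha> m' e' \<noteq> 0"
        using cone_data_standard[OF \<alpha> _ e'(2)] by blast
      then show ?thesis using \<gamma>_nz cone_le[OF \<alpha>] by blast
    next
      case (2 i)
      moreover have "e' - d \<le> e - d" using e' by simp
      ultimately obtain m' where "m \<le> m'" "\<kappa> i m' (e' - d) \<noteq> 0"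
        using cone_data_standard[OF \<kappa>] by blast
      then show ?thesis using \<gamma>_nz cone_le[OF \<kappa>] 2(1) e'(1) by blast
    qed
  qed
  have "\<exists>g. real g \<le> degree_bound (n - 1) d \<and> (\<forall>m\<le>n. \<forall>e. \<gamma> m e \<noteq> 0 \<longrightarrow> e < g)"
  proof (rule cone_count_bound[where E = "E0 + n", OF _ G_0 G_Suc G_top \<gamma>_nonneg])
    show "\<And>m e. m \<le> n \<Longrightarrow> E0 + n \<le> e \<Longrightarrow> G m e = 0" by (rule G_supp) auto
    show "\<And>m e. m \<le> n \<Longrightarrow> E0 + n \<le> e \<Longrightarrow> \<gamma> m e = 0" by (rule E0) auto
    show "2 \<le> n" using N by (simp add: n_def)
  qed (rule interval)
  then obtain g where g: "real g \<le> degree_bound N d" "\<And>m e. m \<le> n \<Longrightarrow> \<gamma> m e \<noteq> 0 \<Longrightarrow> e < g"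
    by (auto simp: n_def)
  have "e < g" if "\<alpha> m e \<noteq> 0" for m e
    using g(2) cone_le[OF \<alpha> that] \<gamma>_nz that by blast
  then obtain \<eta> where \<eta>: "\<eta> \<in> indices V - M" "\<eta> \<le> \<xi>" "sum \<eta> V \<le> g"
    using cone_data_generators[OF \<alpha> _ \<xi>] by blast
  have "real (sum \<eta> V) \<le> degree_bound N d"
    using order_trans[OF of_nat_mono[OF \<eta>(3)] g(1)] .
  then show ?thesis using \<eta>(1,2) by blast
qed

section \<open>Leading exponents\<close>

lemma (in vector_space) linear_span_mem:
  assumes "\<And>f g. \<phi> (f + g) = \<phi> f + \<phi> g" "\<And>c f. \<phi> (scale c f) = scale c (\<phi> f)"
    and "subspace T" "\<And>a. a \<in> A \<Longrightarrow> \<phi> a \<in> T" "p \<in> span A"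
  shows "\<phi> p \<in> T"
  using assms(5)
proof (rule span_induct)
  have "\<phi> 0 = scale 0 (\<phi> 0)" using assms(2)[of 0 0] by simp
  then have "\<phi> 0 = 0" by simp
  then show "subspace {p. \<phi> p \<in> T}"
    using assms(1-3) by (simp add: subspace_def)
qed (rule assms(4))

section \<open>Words, their contents and multi-indices\<close>

primrec inversions :: "nat list \<Rightarrow> nat" where
  "inversions [] = 0"
| "inversions (a # xs) = length (filter (\<lambda>b. b < a) xs) + inversions xs"

lemma inversions_swap: "i < j \<Longrightarrow> inversions (u @ i # j # v) < inversions (u @ j # i # v)"
  by (induction u) auto

lemma not_sorted_descent: "\<not> sorted xs \<Longrightarrow> \<exists>u j i v. xs = u @ j # i # v \<and> i < (j::nat)"
proof (induction xs)
  case (Cons a xs)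
  show ?case
  proof (cases "sorted xs")
    case True
    with Cons.prems obtain b xs' where "xs = b # xs'" "b < a"
      by (cases xs) (auto simp: not_le intro: order_trans)
    then show ?thesis by (intro exI[of _ "[]"]) auto
  next
    case False
    then obtain u j i v where "xs = u @ j # i # v" "i < j" using Cons.IH by blast
    then show ?thesis by (intro exI[of _ "a # u"]) auto
  qed
qed simp

definition content :: "nat list \<Rightarrow> nat \<Rightarrow> nat" where
  "content is = count_list is"

lemma content_append: "content (u @ v) = content u + content v"
  by (auto simp: content_def fun_eq_iff)

lemma content_Nil [simp]: "content [] = 0"
  by (auto simp: content_def fun_eq_iff)

lemma content_Cons: "content (j # is) = content is + unit_index j"
  by (auto simp: content_def unit_index_def fun_eq_iff)

lemma content_multi_indices: "set is \<subseteq> {1..N} \<Longrightarrow> content is \<in> multi_indices N"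
  unfolding content_def multi_indices_def by (auto simp: count_list_0_iff)

lemma multi_indices_add [intro]:
  "\<alpha> \<in> multi_indices N \<Longrightarrow> \<beta> \<in> multi_indices N \<Longrightarrow> \<alpha> + \<beta> \<in> multi_indices N"
  by (auto simp: multi_indices_def)

lemma zero_multi_indices [simp, intro]: "0 \<in> multi_indices N"
  by (auto simp: multi_indices_def)

lemma multi_indices_minus [intro]: "\<alpha> \<in> multi_indices N \<Longrightarrow> \<alpha> - \<beta> \<in> multi_indices N"
  by (auto simp: multi_indices_def)

lemma unit_index_multi_indices: "1 \<le> i \<Longrightarrow> i \<le> N \<Longrightarrow> unit_index i \<in> multi_indices N"
  by (auto simp: multi_indices_def unit_index_def)

lemma total_degree_add: "total_degree N (\<alpha> + \<beta>) = total_degree N \<alpha> + total_degree N \<beta>"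
  by (simp add: total_degree_def sum.distrib)

lemma total_degree_unit_index: "1 \<le> i \<Longrightarrow> i \<le> N \<Longrightarrow> total_degree N (unit_index i) = 1"
  by (simp add: total_degree_def unit_index_def)

lemma total_degree_zero [simp]: "total_degree N 0 = 0"
  by (simp add: total_degree_def)

lemma total_degree_mono: "\<alpha> \<le> \<beta> \<Longrightarrow> total_degree N \<alpha> \<le> total_degree N \<beta>"
  by (auto simp: total_degree_def le_fun_def intro: sum_mono)

lemma total_degree_content: "set is \<subseteq> {1..N} \<Longrightarrow> total_degree N (content is) = length is"
  by (induction "is") (auto simp: content_Cons total_degree_add total_degree_unit_index)

lemma finite_total_degree_le: "finite {\<alpha> \<in> multi_indices N. total_degree N \<alpha> \<le> s}"
proof -
  have "{\<alpha> \<in> multi_indices N. total_degree N \<alpha> \<le> s}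
      \<subseteq> {\<alpha>. \<forall>i. (i \<in> {1..N} \<longrightarrow> \<alpha> i \<in> {..s}) \<and> (i \<notin> {1..N} \<longrightarrow> \<alpha> i = 0)}"
  proof (intro subsetI, clarify)
    fix \<alpha> i assume a: "\<alpha> \<in> multi_indices N" "total_degree N \<alpha> \<le> s"
    have "\<alpha> i \<le> total_degree N \<alpha>" if "i \<in> {1..N}"
      unfolding total_degree_def using that by (intro member_le_sum) auto
    then show "(i \<in> {1..N} \<longrightarrow> \<alpha> i \<in> {..s}) \<and> (i \<notin> {1..N} \<longrightarrow> \<alpha> i = 0)"
      using a by (auto simp: multi_indices_def)
  qed
  then show ?thesis
    using finite_set_of_finite_funs[of "{1..N}" "{..s}" 0] by (rule finite_subset) auto
qed

text \<open>Peeling off the least variable that occurs fits \<open>mono_Cons\<close>: left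
  multiplication by x_j keeps a monomial in normal order when it contains no smaller
  variable.\<close>

lemma multi_index_induct [consumes 1, case_names zero add]:
  assumes "\<alpha> \<in> multi_indices N" and "P 0"
    and step: "\<And>\<beta> j. \<beta> \<in> multi_indices N \<Longrightarrow> 1 \<le> j \<Longrightarrow> j \<le> N \<Longrightarrow> (\<And>i. i < j \<Longrightarrow> \<beta> i = 0) \<Longrightarrow> P \<beta>
      \<Longrightarrow> P (\<beta> + unit_index j)"
  shows "P \<alpha>"
  using assms(1)
proof (induction "total_degree N \<alpha>" arbitrary: \<alpha>)
  case 0
  then have "\<alpha> i = 0" for i by (cases "i \<in> {1..N}") (auto simp: total_degree_def multi_indices_def)
  then have "\<alpha> = 0" by (simp add: fun_eq_iff)
  then show ?case using assms(2) by (simp del: zero_fun_apply)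
next
  case (Suc k)
  define j where "j = (LEAST j. \<alpha> j \<noteq> 0)"
  have "\<exists>j. \<alpha> j \<noteq> 0"
  proof (rule ccontr)
    assume "\<nexists>j. \<alpha> j \<noteq> 0"
    then show False using Suc.hyps(2) by (simp add: total_degree_def)
  qed
  then have j: "\<alpha> j \<noteq> 0" unfolding j_def by (rule LeastI_ex)
  have least: "\<alpha> i = 0" if "i < j" for i
    using not_less_Least[of i "\<lambda>j. \<alpha> j \<noteq> 0"] that by (auto simp: j_def)
  have jN: "1 \<le> j" "j \<le> N" using j Suc.prems by (auto simp: multi_indices_def)
  define \<beta> where "\<beta> = \<alpha> - unit_index j"
  have \<alpha>: "\<alpha> = \<beta> + unit_index j"
    using j by (auto simp: \<beta>_def unit_index_def fun_eq_iff)
  have "total_degree N \<alpha> = Suc (total_degree N \<beta>)"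
    using jN by (simp add: \<alpha> total_degree_add total_degree_unit_index)
  then have "P \<beta>"
    using Suc.prems Suc.hyps by (intro Suc.hyps(1)) (auto simp: \<beta>_def)
  then have "P (\<beta> + unit_index j)"
    using Suc.prems jN least by (intro step) (auto simp: \<beta>_def)
  then show ?case by (simp only: \<alpha>)
qed

section \<open>The ordering, leading terms and the degree filtration\<close>

locale degree_compatible_algebra = solvable_type_algebra scale N x le
  for scale :: "'k::field \<Rightarrow> 'r::ring_1 \<Rightarrow> 'r"
    and N :: nat and x :: "nat \<Rightarrow> 'r" and le :: "((nat \<Rightarrow> nat) \<times> (nat \<Rightarrow> nat)) set" +
  assumes degree_compatible: "degree_compatible N le"
begin

definition below :: "(nat \<Rightarrow> nat) \<Rightarrow> (nat \<Rightarrow> nat) set" where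
  "below \<gamma> = {\<delta> \<in> multi_indices N. (\<delta>, \<gamma>) \<in> le \<and> \<delta> \<noteq> \<gamma>}"

definition lower :: "(nat \<Rightarrow> nat) \<Rightarrow> 'r set" where
  "lower \<gamma> = span (mono ` below \<gamma>)"

text \<open>A relation instead of the function \<open>lm_exponent\<close>: zero simply has no lead.
  Stating the remainder condition by a span avoids extracting coefficients.\<close>

definition has_lead :: "'r \<Rightarrow> (nat \<Rightarrow> nat) \<Rightarrow> bool" where
  "has_lead f \<gamma> \<longleftrightarrow> \<gamma> \<in> multi_indices N \<and> (\<exists>c. c \<noteq> 0 \<and> f - scale c (mono \<gamma>) \<in> lower \<gamma>)"

text \<open>Degree-compatibility makes \<open>below \<gamma>\<close> finite, so the rank maps the
  ordering strictly monotonically into the naturals and serves as induction measure.\<close>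

definition rank :: "(nat \<Rightarrow> nat) \<Rightarrow> nat" where
  "rank \<gamma> = card (below \<gamma>)"

definition filtration :: "nat \<Rightarrow> 'r set" where
  "filtration s = span (mono ` {\<alpha> \<in> multi_indices N. total_degree N \<alpha> \<le> s})"

lemma linear_order_le: "linear_order_on (multi_indices N) le"
  using monomial_ordering by (simp add: monomial_ordering_def)

lemma le_antisym: "(\<alpha>, \<beta>) \<in> le \<Longrightarrow> (\<beta>, \<alpha>) \<in> le \<Longrightarrow> \<alpha> = \<beta>"
  using linear_order_le unfolding linear_order_on_def partial_order_on_def by (blast dest: antisymD)

lemma le_trans: "(\<alpha>, \<beta>) \<in> le \<Longrightarrow> (\<beta>, \<gamma>) \<in> le \<Longrightarrow> (\<alpha>, \<gamma>) \<in> le"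
  using linear_order_le unfolding linear_order_on_def partial_order_on_def preorder_on_def
  by (blast dest: transD)

lemma below_linear:
  "\<alpha> \<in> multi_indices N \<Longrightarrow> \<beta> \<in> multi_indices N \<Longrightarrow> \<alpha> \<noteq> \<beta> \<Longrightarrow> \<alpha> \<in> below \<beta> \<or> \<beta> \<in> below \<alpha>"
  using linear_order_le unfolding linear_order_on_def total_on_def below_def by blast

lemma below_add:
  assumes "\<alpha> \<in> below \<beta>" "\<beta> \<in> multi_indices N" "\<gamma> \<in> multi_indices N"
  shows "\<alpha> + \<gamma> \<in> below (\<beta> + \<gamma>)"
  using assms monomial_ordering unfolding monomial_ordering_def below_def by auto

lemma below_trans: "\<alpha> \<in> below \<beta> \<Longrightarrow> \<beta> \<in> below \<gamma> \<Longrightarrow> \<alpha> \<in> below \<gamma>"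
  unfolding below_def using le_trans le_antisym by blast

lemma below_irrefl: "\<alpha> \<notin> below \<alpha>"
  by (simp add: below_def)

lemma below_multi_indices: "\<alpha> \<in> below \<beta> \<Longrightarrow> \<alpha> \<in> multi_indices N"
  by (simp add: below_def)

lemma below_total_degree:
  assumes "\<alpha> \<in> below \<beta>" "\<beta> \<in> multi_indices N"
  shows "total_degree N \<alpha> \<le> total_degree N \<beta>"
proof (rule ccontr)
  assume "\<not> total_degree N \<alpha> \<le> total_degree N \<beta>"
  then have "(\<beta>, \<alpha>) \<in> le"
    using assms degree_compatible unfolding degree_compatible_def below_def by auto
  then show False using assms le_antisym unfolding below_def by blast
qed

lemma finite_below: "\<gamma> \<in> multi_indices N \<Longrightarrow> finite (below \<gamma>)"
  by (rule finite_subset[OF _ finite_total_degree_le[of N "total_degree N \<gamma>"]])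
    (auto simp: below_total_degree below_multi_indices)

lemma rank_less: "\<alpha> \<in> below \<beta> \<Longrightarrow> \<beta> \<in> multi_indices N \<Longrightarrow> rank \<alpha> < rank \<beta>"
  unfolding rank_def using below_trans below_irrefl
  by (intro psubset_card_mono finite_below) blast+

lemma subspace_lower: "subspace (lower \<gamma>)"
  by (simp add: lower_def)

lemma lower_mono: "\<alpha> \<in> below \<beta> \<Longrightarrow> lower \<alpha> \<subseteq> lower \<beta>"
  unfolding lower_def using below_trans by (intro span_mono) blast

lemma mono_in_lower: "\<alpha> \<in> below \<beta> \<Longrightarrow> mono \<alpha> \<in> lower \<beta>"
  unfolding lower_def by (auto intro: span_base)

lemma has_lead_multi_indices: "has_lead f \<gamma> \<Longrightarrow> \<gamma> \<in> multi_indices N"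
  by (simp add: has_lead_def)

lemma mono_notin_span:
  assumes "A \<subseteq> multi_indices N" "\<gamma> \<in> multi_indices N" "\<gamma> \<notin> A"
  shows "mono \<gamma> \<notin> span (mono ` A)"
proof
  assume *: "mono \<gamma> \<in> span (mono ` A)"
  have "mono \<gamma> \<notin> mono ` A"
    using assms mono_inj by (meson inj_on_image_mem_iff)
  then have "span (mono ` A) \<subseteq> span (monomials - {mono \<gamma>})"
    using assms(1) by (intro span_mono) (auto simp: monomials_def, metis imageI)
  with * have "mono \<gamma> \<in> span (monomials - {mono \<gamma>})" by blast
  moreover have "mono \<gamma> \<in> monomials" using assms(2) by (simp add: monomials_def)
  ultimately show False using monomials_independent unfolding dependent_def by blast
qed

lemma zero_no_lead: "\<not> has_lead 0 \<gamma>"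
proof
  assume "has_lead 0 \<gamma>"
  then obtain c where c: "\<gamma> \<in> multi_indices N" "c \<noteq> 0" "0 - scale c (mono \<gamma>) \<in> lower \<gamma>"
    unfolding has_lead_def by blast
  then have "scale c (mono \<gamma>) \<in> lower \<gamma>"
    using subspace_neg[OF subspace_lower, of "0 - scale c (mono \<gamma>)"] by simp
  then have "scale (inverse c) (scale c (mono \<gamma>)) \<in> lower \<gamma>"
    by (rule subspace_scale[OF subspace_lower])
  then show False
    using c mono_notin_span[of "below \<gamma>" \<gamma>] below_irrefl by (auto simp: lower_def below_def)
qed

lemma has_lead_lower: "has_lead f \<alpha> \<Longrightarrow> \<alpha> \<in> below \<beta> \<Longrightarrow> f \<in> lower \<beta>"
proof -
  assume "has_lead f \<alpha>" and \<alpha>: "\<alpha> \<in> below \<beta>"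
  then obtain c where "f - scale c (mono \<alpha>) \<in> lower \<beta>"
    using lower_mono[OF \<alpha>] unfolding has_lead_def by blast
  then have "(f - scale c (mono \<alpha>)) + scale c (mono \<alpha>) \<in> lower \<beta>"
    using subspace_lower mono_in_lower[OF \<alpha>] by (intro subspace_add subspace_scale)
  then show ?thesis by simp
qed

lemma has_lead_not_lower:
  assumes "has_lead f \<gamma>" shows "f \<notin> lower \<gamma>"
proof
  assume "f \<in> lower \<gamma>"
  obtain c where c: "\<gamma> \<in> multi_indices N" "c \<noteq> 0" "f - scale c (mono \<gamma>) \<in> lower \<gamma>"
    using assms unfolding has_lead_def by blast
  have "(f - scale c (mono \<gamma>)) - f \<in> lower \<gamma>"
    by (rule subspace_diff[OF subspace_lower c(3) \<open>f \<in> lower \<gamma>\<close>])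
  then have "has_lead 0 \<gamma>" using c(1,2) unfolding has_lead_def by (intro conjI exI[of _ c]) auto
  then show False using zero_no_lead by blast
qed

lemma has_lead_unique:
  assumes "has_lead f \<alpha>" "has_lead f \<beta>" shows "\<alpha> = \<beta>"
  using below_linear[of \<alpha> \<beta>] has_lead_lower has_lead_not_lower has_lead_multi_indices assms by blast

text \<open>Exponents are inserted in order of rank, so the newest lies above all others: either it
  is the lead or its coefficient is 0.\<close>

lemma span_has_lead:
  assumes "finite A" "A \<subseteq> multi_indices N" "f \<in> span (mono ` A)" "f \<noteq> 0"
  shows "\<exists>\<gamma>\<in>A. has_lead f \<gamma>"
  using assms
proof (induction A rule: finite_ranking_induct[where f = rank])
  case empty
  then show ?case by simp
next
  case (insert \<gamma> A)
  obtain c where c: "f - scale c (mono \<gamma>) \<in> span (mono ` A)"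
    using insert.prems(2) by (auto simp: span_breakdown_eq)
  show ?case
  proof (cases "\<gamma> \<in> A \<or> c = 0")
    case True
    then have "f \<in> span (mono ` A)"
      using insert.prems(2) c by (auto simp: insert_absorb)
    then show ?thesis using insert by auto
  next
    case False
    have "A \<subseteq> below \<gamma>"
    proof
      fix \<alpha> assume \<alpha>: "\<alpha> \<in> A"
      then have "\<not> \<gamma> \<in> below \<alpha>" using insert.hyps(2)[OF \<alpha>] rank_less insert.prems(1) by fastforce
      then show "\<alpha> \<in> below \<gamma>" using below_linear[of \<alpha> \<gamma>] False \<alpha> insert.prems(1) by blast
    qed
    then have "span (mono ` A) \<subseteq> lower \<gamma>"
      unfolding lower_def by (intro span_mono) blast
    then have "has_lead f \<gamma>"
      unfolding has_lead_def using c False insert.prems(1) by blast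
    then show ?thesis by blast
  qed
qed

lemma lower_has_lead:
  assumes "f \<in> lower \<gamma>" "f \<noteq> 0" "\<gamma> \<in> multi_indices N"
  shows "\<exists>\<delta>\<in>below \<gamma>. has_lead f \<delta>"
  using assms unfolding lower_def
  by (intro span_has_lead finite_below) (auto simp: below_def)

lemma filtration_has_lead:
  assumes "f \<in> filtration s" "f \<noteq> 0"
  shows "\<exists>\<gamma>. has_lead f \<gamma> \<and> total_degree N \<gamma> \<le> s"
  using span_has_lead[OF finite_total_degree_le _ assms(1)[unfolded filtration_def] assms(2)] by blast

lemma has_lead_filtration:
  "has_lead f \<gamma> \<Longrightarrow> f \<in> filtration s \<Longrightarrow> total_degree N \<gamma> \<le> s"
  using filtration_has_lead zero_no_lead has_lead_unique by metis

lemma subspace_filtration: "subspace (filtration s)"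
  by (simp add: filtration_def)

lemma filtration_mono: "s \<le> t \<Longrightarrow> filtration s \<subseteq> filtration t"
  unfolding filtration_def by (intro span_mono) auto

lemma mono_filtration:
  "\<alpha> \<in> multi_indices N \<Longrightarrow> total_degree N \<alpha> \<le> s \<Longrightarrow> mono \<alpha> \<in> filtration s"
  unfolding filtration_def by (intro span_base) auto

lemma filtration_exists: "\<exists>s. f \<in> filtration s"
proof -
  have "f \<in> span monomials" using monomials_span by simp
  then show ?thesis
  proof (induction rule: span_induct_alt)
    case base
    then show ?case by (auto simp: filtration_def intro: span_zero)
  next
    case (step c a f)
    then obtain s \<alpha> where s: "f \<in> filtration s" "a = mono \<alpha>" "\<alpha> \<in> multi_indices N"
      by (auto simp: monomials_def)
    then have "a \<in> filtration (max s (total_degree N \<alpha>))" "f \<in> filtration (max s (total_degree N \<alpha>))"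
      using mono_filtration[of \<alpha> "max s (total_degree N \<alpha>)"] filtration_mono[of s "max s (total_degree N \<alpha>)"]
      by auto
    then show ?case
      using subspace_filtration by (intro exI) (rule subspace_add subspace_scale; assumption?)+
  qed
qed

lemma lower_filtration: "\<gamma> \<in> multi_indices N \<Longrightarrow> lower \<gamma> \<subseteq> filtration (total_degree N \<gamma>)"
  unfolding lower_def filtration_def using below_total_degree below_multi_indices
  by (intro span_mono) blast

lemma has_lead_imp_filtration: "has_lead f \<gamma> \<Longrightarrow> f \<in> filtration (total_degree N \<gamma>)"
proof -
  assume f: "has_lead f \<gamma>"
  then obtain c where c: "f - scale c (mono \<gamma>) \<in> lower \<gamma>" and \<gamma>: "\<gamma> \<in> multi_indices N"
    unfolding has_lead_def by blast
  have "(f - scale c (mono \<gamma>)) + scale c (mono \<gamma>) \<in> filtration (total_degree N \<gamma>)"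
    using c \<gamma> lower_filtration mono_filtration subspace_filtration
    by (intro subspace_add subspace_scale) auto
  then show ?thesis by simp
qed

lemma has_lead_cancel:
  assumes "has_lead f \<gamma>" "has_lead g \<gamma>"
  shows "\<exists>c. f - scale c g \<in> lower \<gamma>"
proof -
  obtain a where a: "f - scale a (mono \<gamma>) \<in> lower \<gamma>"
    using assms(1) unfolding has_lead_def by blast
  obtain b where b: "b \<noteq> 0" "g - scale b (mono \<gamma>) \<in> lower \<gamma>"
    using assms(2) unfolding has_lead_def by blast
  have "(f - scale a (mono \<gamma>)) - scale (a / b) (g - scale b (mono \<gamma>)) \<in> lower \<gamma>"
    by (rule subspace_diff[OF subspace_lower a subspace_scale[OF subspace_lower b(2)]])
  then show ?thesis
    using b(1) by (intro exI[of _ "a / b"]) (simp add: scale_right_diff_distrib)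
qed

section \<open>Normal ordering of words and leading terms of products\<close>

lemma mono_Cons:
  assumes "1 \<le> j" "j \<le> N" "\<And>i. i < j \<Longrightarrow> \<beta> i = 0"
  shows "x j * mono \<beta> = mono (\<beta> + unit_index j)"
proof -
  have split: "[1..<Suc N] = [1..<j] @ j # [Suc j..<Suc N]"
    using assms(1,2) upt_add_eq_append[of 1 j "Suc N - j"] upt_conv_Cons[of j "Suc N"] by simp
  have one: "prod_list (map (\<lambda>i. x i ^ \<alpha> i) is) = 1" if "\<And>i. i \<in> set is \<Longrightarrow> \<alpha> i = 0" for \<alpha> "is"
    using that by (induction "is") auto
  have "map (\<lambda>i. x i ^ (\<beta> + unit_index j) i) [Suc j..<Suc N] = map (\<lambda>i. x i ^ \<beta> i) [Suc j..<Suc N]"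
    by (intro map_cong) (auto simp: unit_index_def)
  moreover have "(\<beta> + unit_index j) j = Suc (\<beta> j)" by (simp add: unit_index_def)
  moreover have "prod_list (map (\<lambda>i. x i ^ \<beta> i) [1..<j]) = 1"
    by (rule one) (simp add: assms(3))
  moreover have "prod_list (map (\<lambda>i. x i ^ (\<beta> + unit_index j) i) [1..<j]) = 1"
    by (rule one) (simp add: assms(3) unit_index_def)
  ultimately show ?thesis
    unfolding mono_def split map_append prod_list.append list.map prod_list.Cons
    by (simp only: power_Suc mult_1_left mult.assoc)
qed

lemma mono_zero [simp]: "mono 0 = 1"
proof -
  have "prod_list (map (\<lambda>i. x i ^ (0 :: nat \<Rightarrow> nat) i) is) = 1" for "is"
    by (induction "is") auto
  then show ?thesis unfolding mono_def .
qed

definition word :: "nat list \<Rightarrow> 'r" where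
  "word is = prod_list (map x is)"

lemma word_append: "word (u @ v) = word u * word v"
  by (simp add: word_def)

lemma mono_eq_word:
  assumes "\<alpha> \<in> multi_indices N"
  shows "\<exists>is. set is \<subseteq> {1..N} \<and> content is = \<alpha> \<and> word is = mono \<alpha>"
  using assms
proof (induction rule: multi_index_induct)
  case zero
  then show ?case by (intro exI[of _ "[]"]) (auto simp: word_def simp del: zero_fun_apply)
next
  case (add \<beta> j)
  then obtain "is" where "set is \<subseteq> {1..N}" "content is = \<beta>" "word is = mono \<beta>" by blast
  then show ?case
    using add.hyps mono_Cons[of j \<beta>]
    by (intro exI[of _ "j # is"]) (auto simp: word_def content_Cons simp del: plus_fun_apply)
qed

lemma word_sorted:
  assumes "sorted is" "set is \<subseteq> {1..N}"
  shows "word is = mono (content is)"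
  using assms
proof (induction "is")
  case (Cons j "is")
  have "content is i = 0" if "i < j" for i
    using Cons.prems(1) that by (auto simp: content_def count_list_0_iff)
  then show ?case
    using Cons mono_Cons[of j "content is"] by (simp add: word_def content_Cons del: plus_fun_apply)
qed (simp add: word_def)

text \<open>Translates the hypothesis on \<open>p\<close>, given by coefficients and a definite
  description, into a span condition. The support is finite, and its element of greatest rank
  satisfies the description.\<close>

lemma lm_less_lower:
  assumes "lm_less p \<gamma>" "\<gamma> \<in> multi_indices N"
  shows "p \<in> lower \<gamma>"
proof (cases "p = 0")
  case True
  then show ?thesis using subspace_lower subspace_0 by blast
next
  case False
  obtain s where s: "p \<in> filtration s" using filtration_exists by blast
  have "p \<in> span monomials" using monomials_span by simp
  then have rep: "(\<Sum>b | representation monomials p b \<noteq> 0. scale (representation monomials p b) b) = p"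
    using monomials_independent by (rule sum_nonzero_representation_eq[rotated])
  have sub: "{b. representation monomials p b \<noteq> 0} \<subseteq> mono ` supp p"
    using representation_ne_zero by (fastforce simp: supp_def monomials_def)
  have fin: "finite (supp p)"
  proof (rule finite_imageD)
    have "mono ` supp p \<subseteq> {b. representation monomials p b \<noteq> 0}" by (auto simp: supp_def)
    then show "finite (mono ` supp p)" using finite_representation finite_subset by blast
    show "inj_on mono (supp p)" using mono_inj by (rule inj_on_subset) (auto simp: supp_def)
  qed
  have MI: "supp p \<subseteq> multi_indices N" by (auto simp: supp_def)
  have ne: "supp p \<noteq> {}"
  proof
    assume "supp p = {}"
    then have "{b. representation monomials p b \<noteq> 0} = {}" using sub by blast
    then show False using rep False by (metis sum.empty)
  qed
  obtain \<alpha> where \<alpha>: "\<alpha> \<in> supp p" "\<And>\<beta>. \<beta> \<in> supp p \<Longrightarrow> rank \<beta> \<le> rank \<alpha>"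
    using obtains_MAX[OF fin ne, of rank] by (metis Max_ge fin finite_imageI imageI)
  have max: "\<beta> \<in> below \<alpha>" if "\<beta> \<in> supp p" "\<beta> \<noteq> \<alpha>" for \<beta>
    using \<alpha>(2)[OF that(1)] rank_less[of \<alpha> \<beta>] below_linear[of \<alpha> \<beta>] that \<alpha>(1) MI by fastforce
  have refl: "(\<alpha>, \<alpha>) \<in> le"
    using linear_order_le \<alpha>(1) MI
    unfolding linear_order_on_def partial_order_on_def preorder_on_def by (blast dest: refl_onD)
  have "lm_exponent p = \<alpha>"
    unfolding lm_exponent_def
  proof (rule the_equality)
    show "\<alpha> \<in> supp p \<and> (\<forall>\<beta>\<in>supp p. (\<beta>, \<alpha>) \<in> le)"
      using \<alpha>(1) max refl by (auto simp: below_def)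
    show "\<beta> = \<alpha>" if "\<beta> \<in> supp p \<and> (\<forall>\<delta>\<in>supp p. (\<delta>, \<beta>) \<in> le)" for \<beta>
      using that max \<alpha>(1) le_antisym unfolding below_def by blast
  qed
  then have \<alpha>\<gamma>: "\<alpha> \<in> below \<gamma>" using assms(1) False \<alpha>(1) MI by (auto simp: lm_less_def below_def)
  have "supp p \<subseteq> below \<gamma>" using max \<alpha>\<gamma> below_trans by blast
  then have "{b. representation monomials p b \<noteq> 0} \<subseteq> mono ` below \<gamma>" using sub by blast
  then have "(\<Sum>b | representation monomials p b \<noteq> 0. scale (representation monomials p b) b) \<in> lower \<gamma>"
    unfolding lower_def by (intro span_sum span_scale span_base) blast
  then show ?thesis by (simp only: rep)
qed

text \<open>
  Every word is brought into normal order by exchanging adjacent letters. An exchange lowers the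
  number of inversions, and the words it creates from \<open>p\<close> have smaller content.
\<close>

lemma word_leading_term:
  assumes "set is \<subseteq> {1..N}"
  shows "has_lead (word is) (content is)"
  using assms
proof (induction "is" rule: wf_induct_rule[OF wf_measures[of "[\<lambda>is. rank (content is), inversions]"]])
  case (1 "is")
  note IH = 1(1)
  have MI: "content is \<in> multi_indices N" using 1(2) by (rule content_multi_indices)
  show ?case
  proof (cases "sorted is")
    case True
    then show ?thesis
      using word_sorted[OF True 1(2)] MI subspace_lower subspace_0
      unfolding has_lead_def by (intro conjI exI[of _ 1]) auto
  next
    case False
    then obtain u j i v where "is": "is = u @ j # i # v" and ij: "i < j"
      using not_sorted_descent by blast
    have ijN: "1 \<le> i" "j \<le> N" "set u \<subseteq> {1..N}" "set v \<subseteq> {1..N}" using 1(2) "is" by auto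
    obtain c p where cp: "c \<noteq> 0" "x j * x i = scale c (x i * x j) + p"
        "lm_less p (unit_index i + unit_index j)"
      using commutation[OF ijN(1) ij ijN(2)] unfolding commutation_relation_def by blast
    let ?swap = "u @ i # j # v"
    have content: "content ?swap = content is"
      by (simp add: "is" content_append content_Cons add_ac del: plus_fun_apply)
    have UI: "unit_index i + unit_index j \<in> multi_indices N"
      using ijN ij by (intro multi_indices_add unit_index_multi_indices) auto
    have p: "p \<in> span (mono ` below (unit_index i + unit_index j))"
      using lm_less_lower[OF cp(3) UI] by (simp add: lower_def)
    have "has_lead (word ?swap) (content is)"
      using IH[of ?swap] content inversions_swap[OF ij, of u v] 1(2) "is" by simp
    then obtain c' where c': "c' \<noteq> 0" "word ?swap - scale c' (mono (content is)) \<in> lower (content is)"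
      unfolding has_lead_def by blast
    have upv: "word u * p * word v \<in> lower (content is)"
    proof (rule linear_span_mem[where \<phi> = "\<lambda>p. word u * p * word v", OF _ _ subspace_lower _ p])
      fix a assume "a \<in> mono ` below (unit_index i + unit_index j)"
      then obtain \<delta> where \<delta>: "\<delta> \<in> below (unit_index i + unit_index j)" "a = mono \<delta>" by blast
      obtain ds where ds: "set ds \<subseteq> {1..N}" "content ds = \<delta>" "word ds = mono \<delta>"
        using mono_eq_word[OF below_multi_indices[OF \<delta>(1)]] by blast
      let ?w = "u @ ds @ v"
      have "content is = (unit_index i + unit_index j) + (content u + content v)"
        by (simp add: "is" content_append content_Cons add_ac del: plus_fun_apply)
      moreover have "content ?w = \<delta> + (content u + content v)"
        by (simp add: content_append ds(2) add_ac del: plus_fun_apply)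
      ultimately have *: "content ?w \<in> below (content is)"
        using below_add[OF \<delta>(1) UI multi_indices_add[OF content_multi_indices content_multi_indices]] ijN
        by (simp only:)
      have "set ?w \<subseteq> {1..N}" using ijN ds by auto
      then have "has_lead (word ?w) (content ?w)"
        using IH[of ?w] rank_less[OF * MI] by simp
      then have "word ?w \<in> lower (content is)" using * by (rule has_lead_lower)
      then show "word u * a * word v \<in> lower (content is)"
        by (simp add: word_append ds(3) \<delta>(2) mult.assoc)
    qed (simp_all add: algebra_simps scale_mult_left scale_mult_right)
    have "word is = word u * (x j * x i) * word v"
      by (simp add: "is" word_def mult.assoc)
    also have "\<dots> = scale c (word ?swap) + word u * p * word v"
      by (simp add: cp(2) word_def algebra_simps scale_mult_left scale_mult_right)
    finally have "word is - scale (c * c') (mono (content is))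
        = scale c (word ?swap - scale c' (mono (content is))) + word u * p * word v"
      by (simp add: scale_right_diff_distrib)
    also have "\<dots> \<in> lower (content is)"
      using c'(2) upv subspace_lower by (intro subspace_add subspace_scale)
    finally show ?thesis
      unfolding has_lead_def using MI cp(1) c'(1) by (intro conjI exI[of _ "c * c'"]) auto
  qed
qed

lemma mono_mult_has_lead:
  assumes "\<alpha> \<in> multi_indices N" "\<beta> \<in> multi_indices N"
  shows "has_lead (mono \<alpha> * mono \<beta>) (\<alpha> + \<beta>)"
proof -
  obtain u v where "set u \<subseteq> {1..N}" "content u = \<alpha>" "word u = mono \<alpha>"
    and "set v \<subseteq> {1..N}" "content v = \<beta>" "word v = mono \<beta>"
    using mono_eq_word[OF assms(1)] mono_eq_word[OF assms(2)] by blast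
  then show ?thesis
    using word_leading_term[of "u @ v"] by (simp add: word_append content_append del: plus_fun_apply)
qed

lemma mult_span_mem:
  assumes "f \<in> span A" "g \<in> span B" "subspace T" "\<And>a b. a \<in> A \<Longrightarrow> b \<in> B \<Longrightarrow> a * b \<in> T"
  shows "f * g \<in> T"
proof -
  have "a * g \<in> T" if "a \<in> A" for a
    by (rule linear_span_mem[where \<phi> = "\<lambda>g. a * g", OF _ _ assms(3) _ assms(2)])
      (auto simp: algebra_simps scale_mult_right assms(4) that)
  then show ?thesis
    by (intro linear_span_mem[where \<phi> = "\<lambda>f. f * g", OF _ _ assms(3) _ assms(1)])
      (auto simp: algebra_simps scale_mult_left)
qed

text \<open>With each factor split into leading term and lower part, compatibility with addition
  puts three of the four products below \<alpha> + \<beta>; the fourth has the nonzero coefficient a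
  b c. In particular R has no zero divisors.\<close>

lemma has_lead_mult:
  assumes f: "has_lead f \<alpha>" and g: "has_lead g \<beta>"
  shows "has_lead (f * g) (\<alpha> + \<beta>)"
proof -
  have MI: "\<alpha> \<in> multi_indices N" "\<beta> \<in> multi_indices N"
    using f g has_lead_multi_indices by auto
  obtain a where a: "a \<noteq> 0" "f - scale a (mono \<alpha>) \<in> lower \<alpha>" using f unfolding has_lead_def by blast
  obtain b where b: "b \<noteq> 0" "g - scale b (mono \<beta>) \<in> lower \<beta>" using g unfolding has_lead_def by blast
  obtain c where c: "c \<noteq> 0" "mono \<alpha> * mono \<beta> - scale c (mono (\<alpha> + \<beta>)) \<in> lower (\<alpha> + \<beta>)"
    using mono_mult_has_lead[OF MI] unfolding has_lead_def by blast
  let ?f = "f - scale a (mono \<alpha>)" and ?g = "g - scale b (mono \<beta>)"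
  have low: "mono \<delta> * mono \<epsilon> \<in> lower (\<alpha> + \<beta>)"
    if "\<delta> \<in> below \<alpha> \<and> (\<epsilon> = \<beta> \<or> \<epsilon> \<in> below \<beta>) \<or> \<delta> = \<alpha> \<and> \<epsilon> \<in> below \<beta>" for \<delta> \<epsilon>
  proof -
    have "\<delta> + \<epsilon> \<in> below (\<alpha> + \<beta>)"
      using that below_add[of \<delta> \<alpha> \<beta>] below_add[of \<epsilon> \<beta> \<alpha>] below_add[of \<epsilon> \<beta> \<delta>]
        below_trans[of "\<delta> + \<epsilon>" "\<delta> + \<beta>" "\<alpha> + \<beta>"] MI below_multi_indices
      by (auto simp: add.commute)
    moreover have "\<delta> \<in> multi_indices N" "\<epsilon> \<in> multi_indices N"
      using that MI below_multi_indices by auto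
    ultimately show ?thesis using mono_mult_has_lead has_lead_lower by blast
  qed
  have "?f * ?g \<in> lower (\<alpha> + \<beta>)"
    by (rule mult_span_mem[OF a(2)[unfolded lower_def] b(2)[unfolded lower_def] subspace_lower])
      (auto intro: low)
  moreover have "?f * mono \<beta> \<in> lower (\<alpha> + \<beta>)"
    by (rule mult_span_mem[OF a(2)[unfolded lower_def] _ subspace_lower, of "mono \<beta>" "{mono \<beta>}"])
      (auto intro: low span_base)
  moreover have "mono \<alpha> * ?g \<in> lower (\<alpha> + \<beta>)"
    by (rule mult_span_mem[OF _ b(2)[unfolded lower_def] subspace_lower, of "mono \<alpha>" "{mono \<alpha>}"])
      (auto intro: low span_base)
  ultimately have "?f * ?g + scale b (?f * mono \<beta>) + scale a (mono \<alpha> * ?g)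
      + scale (a * b) (mono \<alpha> * mono \<beta> - scale c (mono (\<alpha> + \<beta>))) \<in> lower (\<alpha> + \<beta>)"
    using c(2) subspace_lower by (intro subspace_add subspace_scale)
  also have "?f * ?g + scale b (?f * mono \<beta>) + scale a (mono \<alpha> * ?g)
      + scale (a * b) (mono \<alpha> * mono \<beta> - scale c (mono (\<alpha> + \<beta>)))
      = f * g - scale (a * b * c) (mono (\<alpha> + \<beta>))"
    by (simp add: algebra_simps scale_mult_left scale_mult_right scale_right_diff_distrib
        scale_left_commute)
  finally show ?thesis
    unfolding has_lead_def using MI a(1) b(1) c(1) by (intro conjI exI[of _ "a * b * c"]) (auto simp del: plus_fun_apply)
qed

lemma filtration_mult:
  assumes "f \<in> filtration s" "g \<in> filtration t"
  shows "f * g \<in> filtration (s + t)"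
proof (rule mult_span_mem[OF assms[unfolded filtration_def] subspace_filtration])
  fix a b assume "a \<in> mono ` {\<alpha> \<in> multi_indices N. total_degree N \<alpha> \<le> s}"
    "b \<in> mono ` {\<alpha> \<in> multi_indices N. total_degree N \<alpha> \<le> t}"
  then obtain \<alpha> \<beta> where *: "a = mono \<alpha>" "\<alpha> \<in> multi_indices N" "total_degree N \<alpha> \<le> s"
    "b = mono \<beta>" "\<beta> \<in> multi_indices N" "total_degree N \<beta> \<le> t" by blast
  then have "a * b \<in> filtration (total_degree N \<alpha> + total_degree N \<beta>)"
    using has_lead_imp_filtration[OF mono_mult_has_lead] by (simp add: total_degree_add)
  then show "a * b \<in> filtration (s + t)" using filtration_mono[OF add_mono] * by blast
qed

text \<open>Normal ordering does not raise the total degree, since under a degree-compatible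
  ordering a smaller exponent has no larger degree. Hence the degree defined by words can be read
  off from normal monomials.\<close>

lemma filtration_eq_span_words: "filtration s = span (words s)"
proof
  show "filtration s \<subseteq> span (words s)"
    unfolding filtration_def
  proof (rule span_minimal)
    show "mono ` {\<alpha> \<in> multi_indices N. total_degree N \<alpha> \<le> s} \<subseteq> span (words s)"
    proof (rule image_subsetI)
      fix \<alpha> assume \<alpha>: "\<alpha> \<in> {\<alpha> \<in> multi_indices N. total_degree N \<alpha> \<le> s}"
      then obtain "is" where "is": "set is \<subseteq> {1..N}" "content is = \<alpha>" "word is = mono \<alpha>"
        using mono_eq_word by blast
      then have "length is \<le> s" using \<alpha> total_degree_content[of "is" N] by simp
      then have "word is \<in> words s" using "is"(1) unfolding words_def word_def by blast
      then show "mono \<alpha> \<in> span (words s)" using "is"(3) by (metis span_base)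
    qed
  qed simp
  show "span (words s) \<subseteq> filtration s"
  proof (rule span_minimal[OF _ subspace_filtration])
    show "words s \<subseteq> filtration s"
    proof
      fix w assume "w \<in> words s"
      then obtain "is" where "is": "w = word is" "set is \<subseteq> {1..N}" "length is \<le> s"
        unfolding words_def word_def by blast
      then have "w \<in> filtration (length is)"
        using has_lead_imp_filtration[OF word_leading_term[OF "is"(2)]] total_degree_content[OF "is"(2)]
        by (simp only:)
      then show "w \<in> filtration s" using filtration_mono "is"(3) by blast
    qed
  qed
qed

lemma deg_filtration: "f \<in> filtration (deg f)"
  unfolding deg_def filtration_eq_span_words[symmetric]
  by (rule LeastI_ex[OF filtration_exists])

lemma deg_at_most_iff: "deg_at_most f (real s) \<longleftrightarrow> f \<in> filtration s"
proof
  assume "deg_at_most f (real s)"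
  then consider "f = 0" | "deg f \<le> s" by (auto simp: deg_at_most_def)
  then show "f \<in> filtration s"
    using deg_filtration filtration_mono subspace_0[OF subspace_filtration] by cases blast+
next
  assume "f \<in> filtration s"
  then have "deg f \<le> s"
    unfolding deg_def filtration_eq_span_words[symmetric] by (rule Least_le)
  then show "deg_at_most f (real s)" by (simp add: deg_at_most_def)
qed

end

section \<open>Hilbert functions of ideals in the Rees algebra\<close>

context degree_compatible_algebra
begin

section \<open>Leading exponents of subspaces\<close>

definition leads :: "'r set \<Rightarrow> (nat \<Rightarrow> nat) set" where
  "leads J = {\<gamma>. \<exists>f\<in>J. has_lead f \<gamma>}"

lemma has_lead_exists: "f \<noteq> 0 \<Longrightarrow> \<exists>\<gamma>. has_lead f \<gamma>"
  using filtration_exists filtration_has_lead by blast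

lemma has_lead_mono: "\<alpha> \<in> multi_indices N \<Longrightarrow> has_lead (mono \<alpha>) \<alpha>"
  unfolding has_lead_def using subspace_0[OF subspace_lower] by (intro conjI exI[of _ 1]) auto

lemma leads_zero [simp]: "leads {0} = {}"
  by (auto simp: leads_def zero_no_lead)

text \<open>Division with remainder in abstract form: subtracting a scalar multiple of an element of
  T \<inter> J with the same lead stays in J and lowers the rank. Dimension counts, membership and
  reduction are all instances.\<close>

lemma subset_if_leads:
  assumes J: "subspace J" and T: "subspace T"
    and lift: "\<And>\<gamma>. \<gamma> \<in> leads J \<Longrightarrow> \<exists>g\<in>T \<inter> J. has_lead g \<gamma>"
  shows "J \<subseteq> T"
proof
  fix f assume f: "f \<in> J"
  have "f \<in> T" if "has_lead f \<gamma>" "f \<in> J" for f \<gamma>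
    using that
  proof (induction "rank \<gamma>" arbitrary: f \<gamma> rule: less_induct)
    case less
    then obtain g where g: "g \<in> T" "g \<in> J" "has_lead g \<gamma>"
      using lift[of \<gamma>] by (auto simp: leads_def)
    obtain c where c: "f - scale c g \<in> lower \<gamma>"
      using has_lead_cancel[OF less.prems(1) g(3)] by blast
    have MI: "\<gamma> \<in> multi_indices N" using less.prems(1) has_lead_multi_indices by blast
    have "f - scale c g \<in> T"
    proof (cases "f - scale c g = 0")
      case True
      then show ?thesis using subspace_0[OF T] by simp
    next
      case False
      then obtain \<delta> where \<delta>: "\<delta> \<in> below \<gamma>" "has_lead (f - scale c g) \<delta>"
        using lower_has_lead[OF c _ MI] by blast
      moreover have "f - scale c g \<in> J"
        using J less.prems(2) g(2) by (intro subspace_diff subspace_scale) auto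
      ultimately show ?thesis using less.hyps[of \<delta>] rank_less[OF \<delta>(1) MI] by blast
    qed
    then have "(f - scale c g) + scale c g \<in> T"
      using subspace_add[OF T] subspace_scale[OF T g(1)] by blast
    then show ?case by simp
  qed
  then show "f \<in> T" using f has_lead_exists[of f] subspace_0[OF T] by (cases "f = 0") auto
qed

lemma independent_leads:
  assumes "finite \<Gamma>" "\<And>\<gamma>. \<gamma> \<in> \<Gamma> \<Longrightarrow> has_lead (g \<gamma>) \<gamma>"
  shows "independent (g ` \<Gamma>)"
  using assms
proof (induction \<Gamma> rule: finite_ranking_induct[where f = rank])
  case empty
  then show ?case by (simp add: independent_empty)
next
  case (insert \<gamma> A)
  show ?case
  proof (cases "\<gamma> \<in> A")
    case True
    then show ?thesis using insert by (simp add: insert_absorb)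
  next
    case False
    have "g ` A \<subseteq> lower \<gamma>"
    proof (rule image_subsetI)
      fix \<alpha> assume \<alpha>: "\<alpha> \<in> A"
      then have "has_lead (g \<alpha>) \<alpha>" "has_lead (g \<gamma>) \<gamma>" using insert.prems by auto
      moreover from this have "\<alpha> \<in> below \<gamma>"
        using below_linear[of \<alpha> \<gamma>] rank_less[of \<gamma> \<alpha>] insert.hyps(2)[OF \<alpha>] False \<alpha> has_lead_multi_indices
        by fastforce
      ultimately show "g \<alpha> \<in> lower \<gamma>" using has_lead_lower by blast
    qed
    then have "span (g ` A) \<subseteq> lower \<gamma>" by (rule span_minimal[OF _ subspace_lower])
    moreover have "g \<gamma> \<notin> lower \<gamma>" using has_lead_not_lower insert.prems by auto
    ultimately have "g \<gamma> \<notin> span (g ` A)" by blast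
    moreover have "independent (g ` A)" using insert by simp
    ultimately show ?thesis unfolding image_insert by (rule independent_insertI)
  qed
qed

lemma inj_on_leads: "(\<And>\<gamma>. \<gamma> \<in> \<Gamma> \<Longrightarrow> has_lead (g \<gamma>) \<gamma>) \<Longrightarrow> inj_on g \<Gamma>"
  by (rule inj_onI) (metis has_lead_unique)

lemma leads_degree: "J \<subseteq> filtration s \<Longrightarrow> leads J \<subseteq> {\<alpha> \<in> multi_indices N. total_degree N \<alpha> \<le> s}"
  using has_lead_filtration has_lead_multi_indices by (auto simp: leads_def)

lemma finite_leads: "J \<subseteq> filtration s \<Longrightarrow> finite (leads J)"
  by (rule finite_subset[OF leads_degree finite_total_degree_le])

text \<open>One element is taken for each leading exponent: distinct leads make them independent,
  and \<open>subset_if_leads\<close> makes them span.\<close>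

lemma basis_leads:
  assumes J: "subspace J" "J \<subseteq> filtration s"
  obtains B where "B \<subseteq> J" "span B = J" "independent B" "card B = card (leads J)" "finite B"
proof -
  have "\<forall>\<gamma>\<in>leads J. \<exists>f. f \<in> J \<and> has_lead f \<gamma>" by (auto simp: leads_def)
  then obtain g where g: "\<And>\<gamma>. \<gamma> \<in> leads J \<Longrightarrow> g \<gamma> \<in> J \<and> has_lead (g \<gamma>) \<gamma>" by metis
  have sub: "g ` leads J \<subseteq> J" using g by blast
  have "J \<subseteq> span (g ` leads J)"
  proof (rule subset_if_leads[OF J(1) subspace_span])
    fix \<gamma> assume "\<gamma> \<in> leads J"
    then show "\<exists>f\<in>span (g ` leads J) \<inter> J. has_lead f \<gamma>"
      using g by (intro bexI[of _ "g \<gamma>"]) (auto intro: span_base)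
  qed
  then have "span (g ` leads J) = J" using sub span_minimal[OF sub J(1)] by blast
  then show thesis
    using that[OF sub] independent_leads[OF finite_leads[OF J(2)], of g] g finite_leads[OF J(2)]
      inj_on_leads[of "leads J" g] by (simp add: card_image)
qed

lemma dim_eq_card_leads:
  assumes "subspace J" "J \<subseteq> filtration s"
  shows "dim J = card (leads J)"
  by (rule basis_leads[OF assms]) (metis dim_span_eq_card_independent)

text \<open>
  A family \<open>J\<close> with this property is a homogeneous left ideal of the Rees algebra of \<open>R\<close>. The set
  \<open>standard J\<close> consists of the exponents of the monomials outside its leading ideal, the exponent of
  the homogenizing variable being stored at index 0.
\<close>

definition rees_ideal :: "(nat \<Rightarrow> 'r set) \<Rightarrow> bool" where
  "rees_ideal J \<longleftrightarrow> (\<forall>s. subspace (J s) \<and> J s \<subseteq> filtration s \<and> J s \<subseteq> J (Suc s) \<and>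
     (\<forall>k\<in>{1..N}. \<forall>f\<in>J s. x k * f \<in> J (Suc s)))"

definition standard :: "(nat \<Rightarrow> 'r set) \<Rightarrow> (nat \<Rightarrow> nat) set" where
  "standard J = {\<xi> \<in> indices {0..N}. \<xi>(0 := 0) \<notin> leads (J (sum \<xi> {0..N}))}"

lemma rees_idealD:
  assumes "rees_ideal J"
  shows "subspace (J s)" "J s \<subseteq> filtration s" "J s \<subseteq> J (Suc s)"
    "1 \<le> k \<Longrightarrow> k \<le> N \<Longrightarrow> f \<in> J s \<Longrightarrow> x k * f \<in> J (Suc s)"
  using assms unfolding rees_ideal_def by auto

lemma rees_ideal_mono: "rees_ideal J \<Longrightarrow> s \<le> t \<Longrightarrow> J s \<subseteq> J t"
  using lift_Suc_mono_le[of J] rees_idealD(3) by blast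

lemma rees_ideal_mono_mult:
  assumes J: "rees_ideal J" and "\<beta> \<in> multi_indices N" "f \<in> J s"
  shows "mono \<beta> * f \<in> J (s + total_degree N \<beta>)"
  using assms(2)
proof (induction rule: multi_index_induct)
  case zero
  then show ?case using assms(3) by (simp del: zero_fun_apply)
next
  case (add \<beta> j)
  have "x j * (mono \<beta> * f) \<in> J (Suc (s + total_degree N \<beta>))"
    using rees_idealD(4)[OF J] add by blast
  then show ?case
    using add.hyps mono_Cons[of j \<beta>]
    by (simp add: total_degree_add total_degree_unit_index mult.assoc[symmetric] del: plus_fun_apply)
qed

lemma rees_ideal_leads_add:
  assumes J: "rees_ideal J" and "\<gamma> \<in> leads (J s)" "\<beta> \<in> multi_indices N" "s + total_degree N \<beta> \<le> t"
  shows "\<gamma> + \<beta> \<in> leads (J t)"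
proof -
  obtain f where f: "f \<in> J s" "has_lead f \<gamma>" using assms(2) by (auto simp: leads_def)
  have "mono \<beta> * f \<in> J t"
    using rees_ideal_mono_mult[OF J assms(3) f(1)] rees_ideal_mono[OF J assms(4)] by blast
  moreover have "has_lead (mono \<beta> * f) (\<gamma> + \<beta>)"
    using has_lead_mult[OF has_lead_mono[OF assms(3)] f(2)] by (simp only: add.commute)
  ultimately show ?thesis by (auto simp: leads_def)
qed

section \<open>Homogenization: exponents in N + 1 and in N variables\<close>

lemma sum_total_degree: "sum \<xi> {0..N} = \<xi> 0 + total_degree N (\<xi>(0 := 0))"
  by (simp add: total_degree_def sum.atLeast_Suc_atMost)

lemma dehomogenize: "\<xi> \<in> indices {0..N} \<Longrightarrow> \<xi>(0 := 0) \<in> multi_indices N"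
  by (auto simp: indices_def multi_indices_def)

lemma homogenize:
  assumes "\<alpha> \<in> multi_indices N" "total_degree N \<alpha> \<le> s"
  shows "\<alpha>(0 := s - total_degree N \<alpha>) \<in> indices {0..N}"
    "sum (\<alpha>(0 := s - total_degree N \<alpha>)) {0..N} = s"
    "\<alpha>(0 := 0) = \<alpha>"
proof -
  show "\<alpha>(0 := 0) = \<alpha>" using assms(1) by (auto simp: multi_indices_def fun_eq_iff)
  then show "sum (\<alpha>(0 := s - total_degree N \<alpha>)) {0..N} = s"
    using assms(2) by (subst sum_total_degree) (simp only: fun_upd_upd fun_upd_same le_add_diff_inverse2)
  show "\<alpha>(0 := s - total_degree N \<alpha>) \<in> indices {0..N}"
    using assms(1) by (auto simp: indices_def multi_indices_def)
qed

text \<open>A lead at \<eta> is carried to any \<xi> \<ge> \<eta> by multiplying with a monomial and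
  raising the level. The level may exceed what the monomial accounts for; that excess is the growth
  at index 0.\<close>

lemma down_closed_standard:
  assumes J: "rees_ideal J"
  shows "down_closed {0..N} (standard J)"
  unfolding down_closed_def
proof (intro conjI ballI allI impI)
  show "standard J \<subseteq> indices {0..N}" by (auto simp: standard_def)
  fix \<xi> \<eta> assume \<xi>: "\<xi> \<in> standard J" and le: "\<eta> \<le> \<xi>"
  have \<eta>: "\<eta> \<in> indices {0..N}"
    using \<xi> le by (auto simp: standard_def indices_def le_fun_def) (metis le_zero_eq)
  define \<beta> where "\<beta> = \<xi>(0 := 0) - \<eta>(0 := 0)"
  have \<beta>: "\<xi>(0 := 0) = \<eta>(0 := 0) + \<beta>"
    using le by (auto simp: \<beta>_def fun_eq_iff le_fun_def)
  have \<beta>_MI: "\<beta> \<in> multi_indices N"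
    using \<xi> dehomogenize unfolding \<beta>_def standard_def by blast
  have "total_degree N (\<xi>(0 := 0)) = total_degree N (\<eta>(0 := 0)) + total_degree N \<beta>"
    unfolding \<beta> by (rule total_degree_add)
  moreover have "\<eta> 0 \<le> \<xi> 0" using le by (simp add: le_fun_def)
  ultimately have "sum \<eta> {0..N} + total_degree N \<beta> \<le> sum \<xi> {0..N}"
    by (simp add: sum_total_degree)
  then have "\<xi>(0 := 0) \<in> leads (J (sum \<xi> {0..N}))" if "\<eta>(0 := 0) \<in> leads (J (sum \<eta> {0..N}))"
    unfolding \<beta> using rees_ideal_leads_add[OF J that \<beta>_MI] by blast
  then show "\<eta> \<in> standard J" using \<xi> \<eta> by (auto simp: standard_def)
qed

text \<open>In degree s the exponent at index 0 is determined by the others: it is s minus their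
  total degree.\<close>

lemma card_homogenize:
  "card {\<xi> \<in> indices {0..N}. P (\<xi>(0 := 0)) \<and> sum \<xi> {0..N} = s}
    = card {\<alpha> \<in> multi_indices N. P \<alpha> \<and> total_degree N \<alpha> \<le> s}"
proof (rule bij_betw_same_card[of "\<lambda>\<xi>. \<xi>(0 := 0)"],
    rule bij_betw_byWitness[where f' = "\<lambda>\<alpha>. \<alpha>(0 := s - total_degree N \<alpha>)"])
  show "(\<lambda>\<alpha>. \<alpha>(0 := s - total_degree N \<alpha>)) ` {\<alpha> \<in> multi_indices N. P \<alpha> \<and> total_degree N \<alpha> \<le> s}
      \<subseteq> {\<xi> \<in> indices {0..N}. P (\<xi>(0 := 0)) \<and> sum \<xi> {0..N} = s}"
    using homogenize by auto
  show "(\<lambda>\<xi>. \<xi>(0 := 0)) ` {\<xi> \<in> indices {0..N}. P (\<xi>(0 := 0)) \<and> sum \<xi> {0..N} = s}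
      \<subseteq> {\<alpha> \<in> multi_indices N. P \<alpha> \<and> total_degree N \<alpha> \<le> s}"
    using dehomogenize sum_total_degree by auto
  have "\<xi>(0 := sum \<xi> {0..N} - total_degree N (\<xi>(0 := 0))) = \<xi>" for \<xi>
    by (subst sum_total_degree) simp
  then show "\<forall>\<xi>\<in>{\<xi> \<in> indices {0..N}. P (\<xi>(0 := 0)) \<and> sum \<xi> {0..N} = s}.
      \<xi>(0 := 0, 0 := s - total_degree N (\<xi>(0 := 0))) = \<xi>"
    by auto
  show "\<forall>\<alpha>\<in>{\<alpha> \<in> multi_indices N. P \<alpha> \<and> total_degree N \<alpha> \<le> s}.
      \<alpha>(0 := s - total_degree N \<alpha>, 0 := 0) = \<alpha>"
    using homogenize(3) by auto
qed

lemma hilb_full: "hilb {0..N} (indices {0..N}) s = int (card {\<alpha> \<in> multi_indices N. total_degree N \<alpha> \<le> s})"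
  unfolding hilb_def using card_homogenize[of "\<lambda>_. True" s] by simp

lemma hilb_standard:
  assumes J: "rees_ideal J"
  shows "hilb {0..N} (standard J) s = hilb {0..N} (indices {0..N}) s - int (card (leads (J s)))"
proof -
  let ?A = "{\<alpha> \<in> multi_indices N. total_degree N \<alpha> \<le> s}"
  have sub: "leads (J s) \<subseteq> ?A" by (rule leads_degree[OF rees_idealD(2)[OF J]])
  have "{\<xi> \<in> standard J. sum \<xi> {0..N} = s}
      = {\<xi> \<in> indices {0..N}. \<xi>(0 := 0) \<notin> leads (J s) \<and> sum \<xi> {0..N} = s}"
    by (auto simp: standard_def)
  then have "card {\<xi> \<in> standard J. sum \<xi> {0..N} = s} = card (?A - leads (J s))"
    using card_homogenize[of "\<lambda>\<alpha>. \<alpha> \<notin> leads (J s)" s] by (simp add: set_diff_eq conj_ac)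
  then show ?thesis
    unfolding hilb_full
    using card_Diff_subset[OF finite_subset[OF sub finite_total_degree_le] sub]
      card_mono[OF finite_total_degree_le sub]
    by (simp add: hilb_def)
qed

section \<open>Partial ideals, colon ideals and their Hilbert functions\<close>

definition multipliers :: "nat \<Rightarrow> nat \<Rightarrow> 'r set" where
  "multipliers d s = (if d \<le> s then filtration (s - d) else {0})"

text \<open>The Rees ideal generated by the first k generators, each placed in degree d. Below level
  d the multipliers are set to zero explicitly, because \<open>s - d\<close> would truncate to 0 and
  let constants through.\<close>

primrec ideal_part :: "(nat \<Rightarrow> 'r) \<Rightarrow> nat \<Rightarrow> nat \<Rightarrow> nat \<Rightarrow> 'r set" where
  "ideal_part F d 0 s = {0}"
| "ideal_part F d (Suc k) s = {g + y * F (Suc k) |g y. g \<in> ideal_part F d k s \<and> y \<in> multipliers d s}"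

lemma ideal_part_SucI:
  "g \<in> ideal_part F d k s \<Longrightarrow> y \<in> multipliers d s \<Longrightarrow> g + y * F (Suc k) \<in> ideal_part F d (Suc k) s"
  by auto

text \<open>The colon ideal of the first k generators by the next one, regraded so that a multiplier
  at level s corresponds to a product at level s + d.\<close>

definition colon_part :: "(nat \<Rightarrow> 'r) \<Rightarrow> nat \<Rightarrow> nat \<Rightarrow> nat \<Rightarrow> 'r set" where
  "colon_part F d k s = {y \<in> filtration s. y * F (Suc k) \<in> ideal_part F d k (s + d)}"

lemma subspace_multipliers: "subspace (multipliers d s)"
  by (simp add: multipliers_def subspace_filtration subspace_single_0)

lemma multipliers_Suc: "multipliers d s \<subseteq> multipliers d (Suc s)"
  using filtration_mono[of "s - d" "Suc s - d"] subspace_0[OF subspace_filtration]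
  by (auto simp: multipliers_def)

lemma generator_filtration: "1 \<le> k \<Longrightarrow> k \<le> N \<Longrightarrow> x k \<in> filtration 1"
  unfolding filtration_eq_span_words words_def
  by (rule span_base) (auto intro!: exI[of _ "[k]"])

lemma generator_mult_filtration: "1 \<le> k \<Longrightarrow> k \<le> N \<Longrightarrow> f \<in> filtration s \<Longrightarrow> x k * f \<in> filtration (Suc s)"
  using filtration_mult[OF generator_filtration, of k f s] by simp

lemma generator_mult_multipliers:
  "1 \<le> k \<Longrightarrow> k \<le> N \<Longrightarrow> y \<in> multipliers d s \<Longrightarrow> x k * y \<in> multipliers d (Suc s)"
  using generator_mult_filtration[of k y "s - d"] subspace_0[OF subspace_filtration]
  by (auto simp: multipliers_def Suc_diff_le split: if_splits)

lemma ideal_part_rees: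
  assumes "\<And>i. i \<in> {1..k} \<Longrightarrow> F i \<in> filtration d"
  shows "rees_ideal (ideal_part F d k)"
  using assms
proof (induction k)
  case 0
  then show ?case
    using subspace_0[OF subspace_filtration] by (auto simp: rees_ideal_def subspace_single_0)
next
  case (Suc k)
  then have J: "rees_ideal (ideal_part F d k)" by simp
  have Fd: "F (Suc k) \<in> filtration d" using Suc.prems by simp
  show ?case
    unfolding rees_ideal_def
  proof (intro allI conjI ballI)
    fix s
    show "subspace (ideal_part F d (Suc k) s)"
      unfolding subspace_def
    proof (intro conjI ballI allI)
      show "0 \<in> ideal_part F d (Suc k) s"
        using subspace_0[OF rees_idealD(1)[OF J, of s]] subspace_0[OF subspace_multipliers[of d s]]
        by (auto intro!: exI[of _ 0])
      fix f assume "f \<in> ideal_part F d (Suc k) s"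
      then obtain g y where f: "f = g + y * F (Suc k)" "g \<in> ideal_part F d k s" "y \<in> multipliers d s"
        by auto
      {
        fix f' assume "f' \<in> ideal_part F d (Suc k) s"
        then obtain g' y' where f': "f' = g' + y' * F (Suc k)" "g' \<in> ideal_part F d k s" "y' \<in> multipliers d s"
          by auto
        have "f + f' = (g + g') + (y + y') * F (Suc k)" by (simp add: f f' algebra_simps)
        moreover have "g + g' \<in> ideal_part F d k s" "y + y' \<in> multipliers d s"
          using f f' subspace_add[OF rees_idealD(1)[OF J]] subspace_add[OF subspace_multipliers] by auto
        ultimately show "f + f' \<in> ideal_part F d (Suc k) s" by auto
      }
      fix c
      have "scale c f = scale c g + scale c y * F (Suc k)"
        by (simp add: f scale_right_distrib scale_mult_left)
      moreover have "scale c g \<in> ideal_part F d k s" "scale c y \<in> multipliers d s"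
        using f subspace_scale[OF rees_idealD(1)[OF J]] subspace_scale[OF subspace_multipliers] by auto
      ultimately show "scale c f \<in> ideal_part F d (Suc k) s" by auto
    qed
    have "y * F (Suc k) \<in> filtration s" if "y \<in> multipliers d s" for y
      using that filtration_mult[OF _ Fd, of y "s - d"] subspace_0[OF subspace_filtration]
      by (auto simp: multipliers_def split: if_splits)
    then show "ideal_part F d (Suc k) s \<subseteq> filtration s"
      using rees_idealD(2)[OF J, of s] by (auto intro!: subspace_add[OF subspace_filtration])
    show "ideal_part F d (Suc k) s \<subseteq> ideal_part F d (Suc k) (Suc s)"
      using rees_idealD(3)[OF J, of s] multipliers_Suc[of d s] by auto
    fix l f assume l: "l \<in> {1..N}" and "f \<in> ideal_part F d (Suc k) s"
    then obtain g y where f: "f = g + y * F (Suc k)" "g \<in> ideal_part F d k s" "y \<in> multipliers d s"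
      by auto
    have "x l * f = x l * g + (x l * y) * F (Suc k)" by (simp add: f algebra_simps)
    moreover have "x l * g \<in> ideal_part F d k (Suc s)" "x l * y \<in> multipliers d (Suc s)"
      using l f rees_idealD(4)[OF J] generator_mult_multipliers by auto
    ultimately show "x l * f \<in> ideal_part F d (Suc k) (Suc s)" by auto
  qed
qed

lemma colon_part_rees:
  assumes J: "rees_ideal (ideal_part F d k)"
  shows "rees_ideal (colon_part F d k)"
  unfolding rees_ideal_def
proof (intro allI conjI ballI)
  fix s
  have sub: "subspace (ideal_part F d k (s + d))" by (rule rees_idealD(1)[OF J])
  show "subspace (colon_part F d k s)"
    unfolding subspace_def colon_part_def
    using subspace_0[OF subspace_filtration] subspace_add[OF subspace_filtration]
      subspace_scale[OF subspace_filtration] subspace_0[OF sub] subspace_add[OF sub] subspace_scale[OF sub]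
    by (auto simp: distrib_right scale_mult_left)
  show "colon_part F d k s \<subseteq> filtration s" by (auto simp: colon_part_def)
  show "colon_part F d k s \<subseteq> colon_part F d k (Suc s)"
    using filtration_mono[of s "Suc s"] rees_idealD(3)[OF J, of "s + d"] by (auto simp: colon_part_def)
  fix l y assume "l \<in> {1..N}" "y \<in> colon_part F d k s"
  then show "x l * y \<in> colon_part F d k (Suc s)"
    using rees_idealD(4)[OF J, of l "y * F (Suc k)" "s + d"] generator_mult_filtration[of l y s]
    by (auto simp: colon_part_def mult.assoc)
qed

text \<open>Right multiplication by \<open>F (Suc k)\<close> maps \<open>filtration s\<close> onto
  the new ideal part modulo the old one, with the colon part as kernel, so dimensions add up.
  Dimensions are numbers of leads, and the monomials whose exponents are not leads of the colon part
  span a complement of the kernel.\<close>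

lemma card_leads_ideal_part_Suc:
  assumes F: "\<And>i. i \<in> {1..Suc k} \<Longrightarrow> F i \<in> filtration d"
  shows "card (leads (ideal_part F d (Suc k) (s + d))) + card (leads (colon_part F d k s))
    = card (leads (ideal_part F d k (s + d))) + card {\<alpha> \<in> multi_indices N. total_degree N \<alpha> \<le> s}"
proof -
  have J: "rees_ideal (ideal_part F d k)" "rees_ideal (ideal_part F d (Suc k))"
    using F by (auto intro!: ideal_part_rees)
  have K: "rees_ideal (colon_part F d k)" by (rule colon_part_rees[OF J(1)])
  let ?J = "ideal_part F d k (s + d)" and ?J' = "ideal_part F d (Suc k) (s + d)"
  let ?K = "colon_part F d k s" and ?A = "{\<alpha> \<in> multi_indices N. total_degree N \<alpha> \<le> s}"
  define C where "C = ?A - leads ?K"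
  define \<phi> where "\<phi> y = y * F (Suc k)" for y
  have \<phi>_add: "\<phi> (f + g) = \<phi> f + \<phi> g" and \<phi>_scale: "\<phi> (scale c f) = scale c (\<phi> f)" for f g c
    by (auto simp: \<phi>_def distrib_right scale_mult_left)
  have \<phi>_diff: "\<phi> (f - g) = \<phi> f - \<phi> g" for f g by (simp add: \<phi>_def left_diff_distrib)
  have subK: "leads ?K \<subseteq> ?A" by (rule leads_degree[OF rees_idealD(2)[OF K]])
  have finC: "finite C" unfolding C_def using finite_total_degree_le by blast
  have C_MI: "C \<subseteq> multi_indices N" by (auto simp: C_def)
  have monoC: "mono ` C \<subseteq> filtration s"
    by (auto simp: C_def intro: mono_filtration)
  obtain B where B: "B \<subseteq> ?J" "span B = ?J" "independent B" "card B = card (leads ?J)" "finite B"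
    using basis_leads[OF rees_idealD(1,2)[OF J(1)]] by blast
  \<comment> \<open>Such a y belongs to the colon part, so its lead is a lead of the colon part; but
    lying in the span of the monomials over \<open>C\<close>, it has its lead in
    \<open>C\<close>.\<close>
  have K_C: "y = 0" if y: "y \<in> span (mono ` C)" "\<phi> y \<in> ?J" for y
  proof (rule ccontr)
    assume "y \<noteq> 0"
    then obtain \<gamma> where \<gamma>: "\<gamma> \<in> C" "has_lead y \<gamma>"
      using span_has_lead[OF finC C_MI y(1)] by blast
    have "y \<in> filtration s"
      using y(1) span_minimal[OF monoC subspace_filtration] by blast
    then have "y \<in> ?K" using y(2) by (simp add: colon_part_def \<phi>_def)
    then show False using \<gamma> by (auto simp: C_def leads_def)
  qed
  have span_image: "\<exists>y\<in>span (mono ` C'). u = \<phi> y" if "u \<in> span (\<phi> ` mono ` C')" for u C'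
    using that
  proof (rule span_induct)
    show "\<exists>y\<in>span (mono ` C'). u = \<phi> y" if "u \<in> \<phi> ` mono ` C'" for u
      using that by (auto intro: span_base)
    show "subspace {u. \<exists>y\<in>span (mono ` C'). u = \<phi> y}"
      unfolding subspace_def
    proof (intro conjI ballI allI)
      show "0 \<in> {u. \<exists>y\<in>span (mono ` C'). u = \<phi> y}"
        by (auto simp: \<phi>_def intro!: bexI[of _ 0] span_zero)
    qed (auto simp: \<phi>_add[symmetric] \<phi>_scale[symmetric] intro: span_add span_scale)
  qed
  \<comment> \<open>The cardinality is carried along because it encodes that \<open>\<phi>\<close>
    identifies no two of the monomials and that their images avoid \<open>B\<close>.\<close>
  have indep: "independent (B \<union> \<phi> ` mono ` C') \<and> card (B \<union> \<phi> ` mono ` C') = card B + card C'"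
    if "finite C'" "C' \<subseteq> C" for C'
    using that
  proof (induction C' rule: finite_induct)
    case (insert \<gamma> C')
    have "\<phi> (mono \<gamma>) \<notin> span (B \<union> \<phi> ` mono ` C')"
    proof
      assume "\<phi> (mono \<gamma>) \<in> span (B \<union> \<phi> ` mono ` C')"
      then obtain j u where ju: "j \<in> ?J" "u \<in> span (\<phi> ` mono ` C')" "\<phi> (mono \<gamma>) = j + u"
        by (auto simp: span_Un B(2))
      then obtain y where y: "y \<in> span (mono ` C')" "u = \<phi> y" using span_image by blast
      have "y \<in> span (mono ` C)"
        using y(1) insert.prems span_mono[of "mono ` C'" "mono ` C"] by blast
      moreover have "mono \<gamma> \<in> span (mono ` C)" using insert.prems by (auto intro: span_base)
      moreover have "\<phi> (mono \<gamma> - y) \<in> ?J" using ju y by (simp add: \<phi>_diff)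
      ultimately have "mono \<gamma> - y = 0" by (intro K_C span_diff)
      then have "mono \<gamma> \<in> span (mono ` C')" using y(1) by simp
      then show False
        using mono_notin_span[of C' \<gamma>] insert.prems insert.hyps(2) C_MI by blast
    qed
    note notin = this
    then have "\<phi> (mono \<gamma>) \<notin> B \<union> \<phi> ` mono ` C'" by (rule contrapos_nn) (rule span_base)
    moreover have "finite (B \<union> \<phi> ` mono ` C')" using insert.hyps(1) B(5) by blast
    moreover have "independent (B \<union> \<phi> ` mono ` C')" "card (B \<union> \<phi> ` mono ` C') = card B + card C'"
      using insert by auto
    ultimately show ?case
      using insert.hyps independent_insertI[OF notin]
      by (simp only: image_insert Un_insert_right card_insert_disjoint add_Suc_right simp_thms)
  qed (use B in simp)
  \<comment> \<open>Each possible lead is attained either in the colon part or by a monomial over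
    \<open>C\<close>, so the two together fill the filtration.\<close>
  have "filtration s \<subseteq> {g + y |g y. g \<in> ?K \<and> y \<in> span (mono ` C)}"
  proof (rule subset_if_leads[OF subspace_filtration])
    show "subspace {g + y |g y. g \<in> ?K \<and> y \<in> span (mono ` C)}"
      by (rule subspace_sums[OF rees_idealD(1)[OF K] subspace_span])
    fix \<gamma> assume \<gamma>: "\<gamma> \<in> leads (filtration s)"
    show "\<exists>g\<in>{g + y |g y. g \<in> ?K \<and> y \<in> span (mono ` C)} \<inter> filtration s. has_lead g \<gamma>"
    proof (cases "\<gamma> \<in> leads ?K")
      case True
      then obtain g where g: "g \<in> ?K" "has_lead g \<gamma>" by (auto simp: leads_def)
      have "g = g + 0" by simp
      then have "g \<in> {g + y |g y. g \<in> ?K \<and> y \<in> span (mono ` C)}" using g(1) span_zero by blast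
      then show ?thesis using g rees_idealD(2)[OF K] by blast
    next
      case False
      then have "\<gamma> \<in> C" using \<gamma> leads_degree[of "filtration s" s] by (auto simp: C_def)
      then have m: "mono \<gamma> \<in> span (mono ` C)" "mono \<gamma> \<in> filtration s"
        using monoC by (auto intro: span_base)
      have "mono \<gamma> = 0 + mono \<gamma>" by simp
      then have "mono \<gamma> \<in> {g + y |g y. g \<in> ?K \<and> y \<in> span (mono ` C)}"
        using m(1) subspace_0[OF rees_idealD(1)[OF K]] by blast
      then show ?thesis using m(2) has_lead_mono \<open>\<gamma> \<in> C\<close> C_MI by blast
    qed
  qed
  note decomp = this
  have "?J' \<subseteq> span (B \<union> \<phi> ` mono ` C)"
  proof
    fix f assume "f \<in> ?J'"
    then obtain g y where f: "f = g + \<phi> y" "g \<in> ?J" "y \<in> filtration s"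
      by (auto simp: multipliers_def \<phi>_def)
    obtain y1 y2 where y: "y = y1 + y2" "y1 \<in> ?K" "y2 \<in> span (mono ` C)"
      using decomp f(3) by blast
    have "\<phi> y1 \<in> ?J" using y(2) by (simp add: colon_part_def \<phi>_def)
    moreover have "\<phi> y2 \<in> span (\<phi> ` mono ` C)"
      by (rule linear_span_mem[OF \<phi>_add \<phi>_scale subspace_span _ y(3)]) (auto intro: span_base)
    ultimately have "g + \<phi> y1 + \<phi> y2 \<in> span (B \<union> \<phi> ` mono ` C)"
      using f(2) subspace_add[OF rees_idealD(1)[OF J(1)]] unfolding span_Un B(2) by blast
    then show "f \<in> span (B \<union> \<phi> ` mono ` C)" by (simp add: f(1) y(1) \<phi>_add add.assoc)
  qed
  moreover have "B \<union> \<phi> ` mono ` C \<subseteq> ?J'"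
  proof -
    have "B \<subseteq> ?J'"
    proof
      fix b assume "b \<in> B"
      then have "b + 0 * F (Suc k) \<in> ?J'"
        using B(1) subspace_0[OF subspace_multipliers] by (intro ideal_part_SucI) auto
      then show "b \<in> ?J'" by (simp del: ideal_part.simps)
    qed
    moreover have "\<phi> y \<in> ?J'" if "y \<in> filtration s" for y
    proof -
      have "0 + y * F (Suc k) \<in> ?J'"
        using that subspace_0[OF rees_idealD(1)[OF J(1)]]
        by (intro ideal_part_SucI) (auto simp: multipliers_def)
      then show ?thesis by (simp add: \<phi>_def del: ideal_part.simps)
    qed
    ultimately show ?thesis using monoC by blast
  qed
  ultimately have "dim ?J' = card (B \<union> \<phi> ` mono ` C)"
    using indep[OF finC order.refl] by (intro dim_unique) auto
  then have "card (leads ?J') = card (leads ?J) + card C"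
    using dim_eq_card_leads[OF rees_idealD(1,2)[OF J(2)]] indep[OF finC order.refl] B(4) by simp
  moreover have "card C + card (leads ?K) = card ?A"
    unfolding C_def using card_Diff_subset[OF finite_subset[OF subK finite_total_degree_le] subK]
      card_mono[OF finite_total_degree_le subK] by simp
  ultimately show ?thesis by simp
qed

lemma ideal_part_less: "s < d \<Longrightarrow> ideal_part F d k s = {0}"
  by (induction k) (auto simp: multipliers_def)

lemma card_leads_ideal_part:
  assumes "\<And>i. i \<in> {1..k} \<Longrightarrow> F i \<in> filtration d"
  shows "int (card (leads (ideal_part F d k s)))
    = (\<Sum>j<k. (shift ^^ d) (hilb {0..N} (standard (colon_part F d j))) s)"
  using assms
proof (induction k)
  case (Suc k)
  have J: "rees_ideal (ideal_part F d k)" using Suc.prems by (intro ideal_part_rees) auto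
  have K: "rees_ideal (colon_part F d k)" by (rule colon_part_rees[OF J])
  have "int (card (leads (ideal_part F d (Suc k) s)))
    = int (card (leads (ideal_part F d k s))) + (shift ^^ d) (hilb {0..N} (standard (colon_part F d k))) s"
  proof (cases "s < d")
    case True
    then show ?thesis
      by (simp only: ideal_part_less shift_funpow_apply) simp
  next
    case False
    then show ?thesis
      using card_leads_ideal_part_Suc[of k F d "s - d"] Suc.prems
      by (simp add: shift_funpow_apply hilb_standard[OF K] hilb_full del: ideal_part.simps)
  qed
  then show ?case using Suc by simp
qed simp

text \<open>The first nonzero generator has zero colon ideal, as R has no zero divisors; its
  contribution is the full set of exponents and supplies the free summand in
  \<open>generator_degree_bound\<close>. The other generators supply the sets
  \<open>C i\<close>.\<close>

lemma leads_generated: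
  assumes N: "1 \<le> N" and F: "\<And>i. i \<in> {1..n} \<Longrightarrow> F i \<in> filtration d"
    and \<gamma>: "\<gamma> \<in> leads (ideal_part F d n s)"
  shows "\<exists>s' \<gamma>'. \<gamma>' \<in> leads (ideal_part F d n s') \<and> \<gamma>' \<le> \<gamma> \<and> real s' \<le> degree_bound N d"
proof -
  have J: "rees_ideal (ideal_part F d k)" if "k \<le> n" for k
    using that F by (intro ideal_part_rees) auto
  have K: "rees_ideal (colon_part F d k)" if "k < n" for k
    using that by (intro colon_part_rees J) auto
  have zero: "ideal_part F d k s = {0}" if "\<And>i. i \<in> {1..k} \<Longrightarrow> F i = 0" for k s
    using that subspace_0[OF subspace_multipliers] by (induction k) (auto intro: exI[of _ 0])
  define k where "k = (LEAST k. F (Suc k) \<noteq> 0)"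
  have "\<exists>i<n. F (Suc i) \<noteq> 0"
  proof (rule ccontr)
    assume "\<not> (\<exists>i<n. F (Suc i) \<noteq> 0)"
    then have "F i = 0" if "i \<in> {1..n}" for i
      using that by (cases i) auto
    then show False using \<gamma> zero by auto
  qed
  then obtain i where i: "i < n" "F (Suc i) \<noteq> 0" by blast
  have k: "F (Suc k) \<noteq> 0" "k < n"
    using i LeastI[of "\<lambda>k. F (Suc k) \<noteq> 0" i] Least_le[of "\<lambda>k. F (Suc k) \<noteq> 0" i] by (auto simp: k_def)
  have "F i = 0" if "i \<in> {1..k}" for i
    using that not_less_Least[of "i - 1" "\<lambda>k. F (Suc k) \<noteq> 0"] by (auto simp: k_def)
  then have "ideal_part F d k t = {0}" for t by (rule zero)
  moreover have "y * F (Suc k) \<noteq> 0" if "y \<noteq> 0" for y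
    using has_lead_exists[OF that] has_lead_exists[OF k(1)] has_lead_mult zero_no_lead by metis
  ultimately have "colon_part F d k t = {0}" for t
    using subspace_0[OF subspace_filtration] by (auto simp: colon_part_def)
  then have full: "standard (colon_part F d k) = indices {0..N}"
    by (auto simp: standard_def)
  define h c where "h = hilb {0..N} (indices {0..N})"
    and "c j = hilb {0..N} (standard (colon_part F d j))" for j
  have hilbert: "h = hilb {0..N} (standard (ideal_part F d n)) + (shift ^^ d) (h + (\<Sum>j\<in>{..<n} - {k}. c j))"
  proof
    fix t
    have "h t = hilb {0..N} (standard (ideal_part F d n)) t + (\<Sum>j<n. (shift ^^ d) (c j) t)"
      using hilb_standard[OF J[OF order.refl], of t] card_leads_ideal_part[of n F d t] F
      by (simp add: h_def c_def)
    also have "(\<Sum>j<n. (shift ^^ d) (c j) t)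
        = (shift ^^ d) h t + (\<Sum>j\<in>{..<n} - {k}. (shift ^^ d) (c j) t)"
      using k(2) full by (subst sum.remove[of _ k]) (auto simp: h_def c_def)
    also have "(\<Sum>j\<in>A. (shift ^^ d) (c j) t) = (\<Sum>j\<in>A. (shift ^^ d) (c j)) t" for A :: "nat set"
      by (induction A rule: infinite_finite_induct) auto
    finally show "h t = (hilb {0..N} (standard (ideal_part F d n))
        + (shift ^^ d) (h + (\<Sum>j\<in>{..<n} - {k}. c j))) t"
      by (simp only: shift_funpow_add shift_funpow_sum plus_fun_apply)
  qed
  have \<gamma>': "\<gamma> \<in> multi_indices N" "total_degree N \<gamma> \<le> s"
    using \<gamma> leads_degree[OF rees_idealD(2)[OF J[OF order.refl]]] by blast+
  \<comment> \<open>The lead \<gamma> at level s becomes an exponent of degree s, the gap being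
    stored at index 0. Conversely, the degree of an exponent \<open>\<eta>\<close> below it outside
    the standard set is the level at which \<open>\<eta>(0 := 0)\<close> is a lead.\<close>
  define \<xi> where "\<xi> = \<gamma>(0 := s - total_degree N \<gamma>)"
  have \<xi>: "\<xi> \<in> indices {0..N} - standard (ideal_part F d n)" "\<xi>(0 := 0) = \<gamma>"
    using homogenize[OF \<gamma>'] \<gamma> by (auto simp: \<xi>_def standard_def)
  have "\<exists>\<eta>\<in>indices {0..N} - standard (ideal_part F d n). \<eta> \<le> \<xi> \<and> real (sum \<eta> {0..N}) \<le> degree_bound N d"
  proof (rule generator_degree_bound[OF _ _ N _ _ _ hilbert[unfolded h_def c_def] \<xi>(1)])
    show "down_closed {0..N} (standard (ideal_part F d n))"
      by (rule down_closed_standard[OF J[OF order.refl]])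
    show "down_closed {0..N} (standard (colon_part F d j))" if "j \<in> {..<n} - {k}" for j
      using that by (intro down_closed_standard K) simp
  qed simp_all
  then obtain \<eta> where \<eta>: "\<eta> \<in> indices {0..N} - standard (ideal_part F d n)" "\<eta> \<le> \<xi>"
      "real (sum \<eta> {0..N}) \<le> degree_bound N d"
    by (elim bexE conjE)
  have "\<eta>(0 := 0) \<le> \<gamma>" using \<eta>(2) unfolding \<xi>(2)[symmetric] by (auto simp: le_fun_def)
  then show ?thesis using \<eta>(1,3) unfolding standard_def by blast
qed

end

section \<open>Membership and syzygies\<close>

text \<open>Keeps the degrees d + D, which arise from reducing the generators themselves, within
  3D.\<close>

lemma degree_bound_ge: "real d \<le> degree_bound N d"
proof (cases "d = 0")
  case False
  define X where "X = (real d)\<^sup>2 / 2 + real d"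
  have "real d \<le> X" by (simp add: X_def)
  moreover from this have "X ^ 1 \<le> X ^ 2 ^ (N - 1)"
    using False by (intro power_increasing) auto
  ultimately show ?thesis
    using False by (simp add: degree_bound_def X_def[symmetric])
qed (simp add: degree_bound_def power_0_left)

context degree_compatible_algebra
begin

section \<open>Tuples, evaluation and left submodules\<close>

definition evaluate :: "nat \<Rightarrow> (nat \<Rightarrow> 'r) \<Rightarrow> (nat \<Rightarrow> 'r) \<Rightarrow> 'r" where
  "evaluate n F y = (\<Sum>i = 1..n. y i * F i)"

definition tuple_scale :: "'k \<Rightarrow> (nat \<Rightarrow> 'r) \<Rightarrow> nat \<Rightarrow> 'r" where
  "tuple_scale c y = (\<lambda>i. scale c (y i))"

definition left_mult :: "'r \<Rightarrow> (nat \<Rightarrow> 'r) \<Rightarrow> nat \<Rightarrow> 'r" where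
  "left_mult r y = (\<lambda>i. r * y i)"

sublocale tuple: vector_space tuple_scale
  by unfold_locales
    (auto simp: tuple_scale_def fun_eq_iff scale_right_distrib scale_left_distrib)

lemma evaluate_add: "evaluate n F (y + z) = evaluate n F y + evaluate n F z"
  by (simp add: evaluate_def distrib_right sum.distrib)

lemma evaluate_scale: "evaluate n F (tuple_scale c y) = scale c (evaluate n F y)"
  by (simp add: evaluate_def tuple_scale_def scale_mult_left scale_sum_right)

lemma evaluate_diff: "evaluate n F (y - z) = evaluate n F y - evaluate n F z"
  by (simp add: evaluate_def left_diff_distrib sum_subtractf)

lemma evaluate_left_mult: "evaluate n F (left_mult r y) = r * evaluate n F y"
  by (simp add: evaluate_def left_mult_def mult.assoc sum_distrib_left)

lemma evaluate_zero [simp]: "evaluate n F 0 = 0"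
  by (simp add: evaluate_def)

lemma left_mult_add: "left_mult r (y + z) = left_mult r y + left_mult r z"
  by (auto simp: left_mult_def distrib_left fun_eq_iff)

lemma left_mult_add_left: "left_mult (r + s) y = left_mult r y + left_mult s y"
  by (auto simp: left_mult_def distrib_right fun_eq_iff)

lemma left_mult_diff: "left_mult r (y - z) = left_mult r y - left_mult r z"
  by (auto simp: left_mult_def right_diff_distrib fun_eq_iff)

lemma left_mult_scale: "left_mult r (tuple_scale c y) = tuple_scale c (left_mult r y)"
  by (auto simp: left_mult_def tuple_scale_def scale_mult_right fun_eq_iff)

lemma left_mult_scale_left: "left_mult (scale c r) y = tuple_scale c (left_mult r y)"
  by (auto simp: left_mult_def tuple_scale_def scale_mult_left fun_eq_iff)

lemma left_mult_left_mult: "left_mult r (left_mult s y) = left_mult (r * s) y"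
  by (auto simp: left_mult_def mult.assoc fun_eq_iff)

lemma left_solutions_iff: "y \<in> left_solutions n F \<longleftrightarrow> y \<in> tuples n \<and> evaluate n F y = 0"
  by (simp add: left_solutions_def evaluate_def)

lemma subspace_tuples: "tuple.subspace (tuples n)"
  by (auto simp: tuple.subspace_def tuples_def tuple_scale_def)

lemma left_mult_tuples: "y \<in> tuples n \<Longrightarrow> left_mult r y \<in> tuples n"
  by (auto simp: tuples_def left_mult_def)

lemma left_submodule_left_mult: "left_submodule M \<Longrightarrow> y \<in> M \<Longrightarrow> left_mult r y \<in> M"
  by (auto simp: left_submodule_def left_mult_def)

lemma left_submodule_subspace:
  assumes "left_submodule M" shows "tuple.subspace M"
proof -
  have "tuple_scale c y = left_mult (scale c 1) y" for c y
    by (simp add: left_mult_scale_left) (simp add: left_mult_def)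
  then show ?thesis
    using assms left_submodule_left_mult[OF assms] by (auto simp: tuple.subspace_def left_submodule_def)
qed

lemma left_submodule_left_solutions: "left_submodule (left_solutions n F)" for F :: "nat \<Rightarrow> 'r"
proof -
  have "y + z \<in> left_solutions n F" if "y \<in> left_solutions n F" "z \<in> left_solutions n F" for y z
    using that subspace_tuples[of n] by (auto simp: left_solutions_iff evaluate_add tuple.subspace_def)
  moreover have "(\<lambda>i. r * y i) \<in> left_solutions n F" if "y \<in> left_solutions n F" for r y
    using that left_mult_tuples[of y n r] evaluate_left_mult[of n F r y]
    by (simp add: left_solutions_iff left_mult_def)
  moreover have "0 \<in> left_solutions n F"
    using subspace_tuples[of n] by (auto simp: left_solutions_iff tuple.subspace_def)
  ultimately show ?thesis by (simp add: left_submodule_def)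
qed

lemma subspace_bounded_tuples: "tuple.subspace {y. \<forall>i. y i \<in> filtration e}"
  using subspace_filtration[of e] by (auto simp: tuple.subspace_def subspace_def tuple_scale_def)

text \<open>The recursive form serves counting one generator at a time; the form with tuples serves
  the statements about coefficients.\<close>

lemma ideal_part_evaluate:
  "f \<in> ideal_part F d n s \<longleftrightarrow> (\<exists>y\<in>tuples n. (\<forall>i. y i \<in> multipliers d s) \<and> evaluate n F y = f)"
proof
  assume "f \<in> ideal_part F d n s"
  then show "\<exists>y\<in>tuples n. (\<forall>i. y i \<in> multipliers d s) \<and> evaluate n F y = f"
  proof (induction n arbitrary: f)
    case 0
    then show ?case
      using subspace_0[OF subspace_multipliers] by (intro bexI[of _ 0]) (auto simp: tuples_def evaluate_def)
  next
    case (Suc n)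
    then obtain g y0 where f: "f = g + y0 * F (Suc n)" "g \<in> ideal_part F d n s" "y0 \<in> multipliers d s"
      by auto
    then obtain y where y: "y \<in> tuples n" "\<forall>i. y i \<in> multipliers d s" "evaluate n F y = g"
      using Suc.IH by blast
    have "evaluate n F (y(Suc n := y0)) = evaluate n F y"
      unfolding evaluate_def by (intro sum.cong) auto
    then have "evaluate (Suc n) F (y(Suc n := y0)) = f"
      using y(3) f(1) by (simp add: evaluate_def)
    moreover have "y(Suc n := y0) \<in> tuples (Suc n)" "\<forall>i. (y(Suc n := y0)) i \<in> multipliers d s"
      using y(1,2) f(3) by (auto simp: tuples_def)
    ultimately show ?case by blast
  qed
next
  assume "\<exists>y\<in>tuples n. (\<forall>i. y i \<in> multipliers d s) \<and> evaluate n F y = f"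
  then obtain y where y: "\<And>i. y i \<in> multipliers d s" "evaluate n F y = f" by blast
  have "evaluate n F y \<in> ideal_part F d n s"
  proof (induction n)
    case 0
    then show ?case by (simp add: evaluate_def)
  next
    case (Suc n)
    then have "evaluate n F y + y (Suc n) * F (Suc n) \<in> ideal_part F d (Suc n) s"
      using y(1) by (rule ideal_part_SucI)
    then show ?case by (simp add: evaluate_def del: ideal_part.simps)
  qed
  then show "f \<in> ideal_part F d n s" using y(2) by simp
qed

lemma tuple_bounded: "y \<in> tuples n \<Longrightarrow> \<exists>s. \<forall>i. y i \<in> filtration s"
proof -
  assume y: "y \<in> tuples n"
  have "\<forall>i. \<exists>s. y i \<in> filtration s" by (simp add: filtration_exists)
  from choice[OF this] obtain s where s: "\<And>i. y i \<in> filtration (s i)" by blast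
  have "y i \<in> filtration (\<Sum>j = 1..n. s j)" for i
  proof (cases "i \<in> {1..n}")
    case True
    then have "s i \<le> (\<Sum>j = 1..n. s j)" by (intro member_le_sum) auto
    then show ?thesis using s filtration_mono by blast
  next
    case False
    then show ?thesis using y subspace_0[OF subspace_filtration] by (simp add: tuples_def)
  qed
  then show ?thesis by blast
qed

lemma evaluate_ideal_part: "y \<in> tuples n \<Longrightarrow> \<exists>s. evaluate n F y \<in> ideal_part F d n s"
proof -
  assume y: "y \<in> tuples n"
  then obtain s where "\<forall>i. y i \<in> filtration s" using tuple_bounded by blast
  then have "\<forall>i. y i \<in> multipliers d (s + d)" by (simp add: multipliers_def)
  then show ?thesis using y ideal_part_evaluate by blast
qed

lemma multipliers_filtration: "s \<le> t \<Longrightarrow> multipliers d s \<subseteq> filtration t"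
  using filtration_mono[of "s - d" t] subspace_0[OF subspace_filtration] by (auto simp: multipliers_def)

end

section \<open>Bounded membership and reduction modulo a Groebner basis\<close>

locale bounded_leads = degree_compatible_algebra scale N x le
  for scale :: "'k::field \<Rightarrow> 'r::ring_1 \<Rightarrow> 'r"
    and N :: nat and x :: "nat \<Rightarrow> 'r" and le :: "((nat \<Rightarrow> nat) \<times> (nat \<Rightarrow> nat)) set" +
  fixes n d D :: nat and F :: "nat \<Rightarrow> 'r"
  assumes generators: "i \<in> {1..n} \<Longrightarrow> F i \<in> filtration d"
    and d_le_D: "d \<le> D"
    and generated: "\<gamma> \<in> leads (ideal_part F d n s) \<Longrightarrow>
      \<exists>s' \<gamma>'. \<gamma>' \<in> leads (ideal_part F d n s') \<and> \<gamma>' \<le> \<gamma> \<and> s' \<le> D"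
begin

abbreviation eval :: "(nat \<Rightarrow> 'r) \<Rightarrow> 'r" where
  "eval \<equiv> evaluate n F"

lemma rees: "rees_ideal (ideal_part F d n)"
  using generators by (intro ideal_part_rees) auto

text \<open>A lead of degree at most e is divisible by one that occurs at level at most D, so it
  recurs at level e + D. The element found there has the same lead, hence again degree at most e,
  and the reduction can go on.\<close>

lemma ideal_part_bound:
  assumes "f \<in> ideal_part F d n s" "f \<in> filtration e"
  shows "f \<in> ideal_part F d n (e + D)"
proof -
  \<comment> \<open>A common level containing both the given element and the reducing ones, so that
    differences stay in one subspace.\<close>
  define t where "t = max s (e + D)"
  have "ideal_part F d n t \<inter> filtration e \<subseteq> ideal_part F d n (e + D)"
  proof (rule subset_if_leads)
    show "subspace (ideal_part F d n t \<inter> filtration e)"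
      by (intro subspace_inter rees_idealD(1)[OF rees] subspace_filtration)
    show "subspace (ideal_part F d n (e + D))" by (rule rees_idealD(1)[OF rees])
    fix \<gamma> assume "\<gamma> \<in> leads (ideal_part F d n t \<inter> filtration e)"
    then obtain f where f: "f \<in> ideal_part F d n t" "f \<in> filtration e" "has_lead f \<gamma>"
      by (auto simp: leads_def)
    then obtain s' \<gamma>' where \<gamma>': "\<gamma>' \<in> leads (ideal_part F d n s')" "\<gamma>' \<le> \<gamma>" "s' \<le> D"
      using generated[of \<gamma> t] by (auto simp: leads_def)
    have \<gamma>: "\<gamma> = \<gamma>' + (\<gamma> - \<gamma>')" using \<gamma>'(2) by (auto simp: le_fun_def fun_eq_iff)
    have MI: "\<gamma> - \<gamma>' \<in> multi_indices N" using f(3) has_lead_multi_indices by blast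
    have "total_degree N (\<gamma> - \<gamma>') \<le> total_degree N \<gamma>"
      by (intro total_degree_mono) (simp add: le_fun_def)
    also have deg: "total_degree N \<gamma> \<le> e" using has_lead_filtration f by blast
    finally have "\<gamma>' + (\<gamma> - \<gamma>') \<in> leads (ideal_part F d n (e + D))"
      using \<gamma>' by (intro rees_ideal_leads_add[OF rees \<gamma>'(1) MI]) simp
    then obtain g where g: "g \<in> ideal_part F d n (e + D)" "has_lead g \<gamma>"
      unfolding \<gamma>[symmetric] by (auto simp: leads_def)
    moreover have "g \<in> ideal_part F d n t"
      using rees_ideal_mono[OF rees, of "e + D" t] g(1) by (auto simp: t_def)
    moreover have "g \<in> filtration e"
      using has_lead_imp_filtration[OF g(2)] filtration_mono[OF deg] by blast
    ultimately show "\<exists>g\<in>ideal_part F d n (e + D) \<inter> (ideal_part F d n t \<inter> filtration e). has_lead g \<gamma>"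
      by blast
  qed
  moreover have "f \<in> ideal_part F d n t"
    using rees_ideal_mono[OF rees, of s t] assms(1) by (auto simp: t_def)
  ultimately show ?thesis using assms(2) by blast
qed

text \<open>The pairs in \<open>basis\<close> represent a Groebner basis together with its leading exponents.\<close>

definition basis :: "((nat \<Rightarrow> 'r) \<times> (nat \<Rightarrow> nat)) set" where
  "basis = {(Y, \<gamma>). Y \<in> tuples n \<and> (\<forall>i. Y i \<in> filtration D) \<and> has_lead (eval Y) \<gamma> \<and> total_degree N \<gamma> \<le> D}"

text \<open>Multiplying tuples rather than their values keeps track of the coefficients.
  \<open>P\<close> restricts the leading exponent of the value of the multiple.\<close>

definition multiples :: "((nat \<Rightarrow> nat) \<Rightarrow> bool) \<Rightarrow> (nat \<Rightarrow> 'r) set" where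
  "multiples P = {left_mult (mono \<beta>) Y |\<beta> Y \<gamma>. (Y, \<gamma>) \<in> basis \<and> \<beta> \<in> multi_indices N \<and> P (\<beta> + \<gamma>)}"

lemma basis_multi_indices: "(Y, \<gamma>) \<in> basis \<Longrightarrow> \<gamma> \<in> multi_indices N"
  unfolding basis_def using has_lead_multi_indices by blast

lemma basis_divides:
  assumes "y \<in> tuples n" "has_lead (eval y) \<gamma>"
  shows "\<exists>Y \<gamma>'. (Y, \<gamma>') \<in> basis \<and> \<gamma>' \<le> \<gamma>"
proof -
  obtain s where "eval y \<in> ideal_part F d n s" using evaluate_ideal_part[OF assms(1)] by blast
  then obtain s' \<gamma>' where s': "\<gamma>' \<in> leads (ideal_part F d n s')" "\<gamma>' \<le> \<gamma>" "s' \<le> D"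
    using generated[of \<gamma> s] assms(2) by (auto simp: leads_def)
  then obtain g where g: "g \<in> ideal_part F d n s'" "has_lead g \<gamma>'" by (auto simp: leads_def)
  then obtain Y where Y: "Y \<in> tuples n" "\<And>i. Y i \<in> multipliers d s'" "eval Y = g"
    using ideal_part_evaluate by blast
  have "total_degree N \<gamma>' \<le> s'"
    using has_lead_filtration[OF g(2)] rees_idealD(2)[OF rees] g(1) by blast
  then have "(Y, \<gamma>') \<in> basis"
    using Y g s' multipliers_filtration[OF s'(3)] by (auto simp: basis_def)
  then show ?thesis using s'(2) by blast
qed

lemma multiple_has_lead:
  "(Y, \<gamma>) \<in> basis \<Longrightarrow> \<beta> \<in> multi_indices N \<Longrightarrow> has_lead (eval (left_mult (mono \<beta>) Y)) (\<beta> + \<gamma>)"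
  unfolding evaluate_left_mult basis_def by (intro has_lead_mult has_lead_mono) simp_all

lemma multiples_tuples: "tuple.span (multiples P) \<subseteq> tuples n"
  by (rule tuple.span_minimal[OF _ subspace_tuples])
    (auto simp: multiples_def basis_def intro: left_mult_tuples)

lemma left_mult_basis_span:
  assumes "r \<in> span (mono ` A)" "(Y, \<gamma>) \<in> basis" "A \<subseteq> multi_indices N" "\<And>\<beta>. \<beta> \<in> A \<Longrightarrow> P (\<beta> + \<gamma>)"
  shows "left_mult r Y \<in> tuple.span (multiples P)"
  using assms(1)
proof (rule span_induct)
  show "subspace {r. left_mult r Y \<in> tuple.span (multiples P)}"
    unfolding subspace_def
    by (auto simp: left_mult_add_left left_mult_scale_left intro: tuple.span_add tuple.span_scale)
      (auto simp: left_mult_def tuple.span_zero zero_fun_def[symmetric])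
  fix a assume "a \<in> mono ` A"
  then show "left_mult a Y \<in> tuple.span (multiples P)"
    using assms(2-4) unfolding multiples_def by (intro tuple.span_base) blast
qed

text \<open>
  Reduction modulo the basis. It is applied to \<open>W = lower \<delta>\<close> and to \<open>W = UNIV\<close>, where \<open>P\<close> describes
  the leading exponents that can occur in \<open>W\<close>.
\<close>

lemma reduction:
  assumes W: "subspace W" "\<And>f \<gamma>. has_lead f \<gamma> \<Longrightarrow> f \<in> W \<longleftrightarrow> P \<gamma>"
    and y: "y \<in> tuples n" "eval y \<in> W" "eval y \<in> filtration e"
  shows "\<exists>h\<in>tuple.span (multiples P). (\<forall>i. h i \<in> filtration (e + D)) \<and> eval h = eval y"
proof -
  let ?S = "tuple.span (multiples P) \<inter> {h. \<forall>i. h i \<in> filtration (e + D)}"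
  have image_subspace: "subspace (eval ` S)" if S: "tuple.subspace S" for S
    unfolding subspace_def
  proof (intro conjI ballI allI)
    show "0 \<in> eval ` S" using tuple.subspace_0[OF S] evaluate_zero by (metis image_eqI)
    show "f + g \<in> eval ` S" if "f \<in> eval ` S" "g \<in> eval ` S" for f g
      using that tuple.subspace_add[OF S] evaluate_add by (auto simp del: plus_fun_apply) (metis image_eqI)
    show "scale c f \<in> eval ` S" if "f \<in> eval ` S" for c f
      using that tuple.subspace_scale[OF S] evaluate_scale by (auto) (metis image_eqI)
  qed
  have "eval ` tuples n \<inter> (W \<inter> filtration e) \<subseteq> eval ` ?S"
  proof (rule subset_if_leads)
    show "subspace (eval ` tuples n \<inter> (W \<inter> filtration e))"
      by (intro subspace_inter image_subspace subspace_tuples W(1) subspace_filtration)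
    show "subspace (eval ` ?S)"
      by (intro image_subspace tuple.subspace_inter tuple.subspace_span subspace_bounded_tuples)
    fix \<gamma> assume "\<gamma> \<in> leads (eval ` tuples n \<inter> (W \<inter> filtration e))"
    then obtain y where y: "y \<in> tuples n" "eval y \<in> W" "eval y \<in> filtration e" "has_lead (eval y) \<gamma>"
      by (auto simp: leads_def)
    then obtain Y \<gamma>' where Y: "(Y, \<gamma>') \<in> basis" "\<gamma>' \<le> \<gamma>" using basis_divides by blast
    define \<beta> where "\<beta> = \<gamma> - \<gamma>'"
    have \<gamma>: "\<beta> + \<gamma>' = \<gamma>" using Y(2) by (auto simp: \<beta>_def le_fun_def fun_eq_iff)
    have MI: "\<beta> \<in> multi_indices N" unfolding \<beta>_def using y(4) has_lead_multi_indices by blast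
    have deg: "total_degree N \<gamma> \<le> e" using has_lead_filtration y by blast
    have "total_degree N \<beta> \<le> e"
      using deg total_degree_mono[of \<beta> \<gamma> N] by (simp add: \<beta>_def le_fun_def)
    then have "mono \<beta> \<in> filtration e" by (rule mono_filtration[OF MI])
    \<comment> \<open>The cofactor has degree at most e, as it divides a lead of that degree, and
      the entries of basis tuples have degree at most D.\<close>
    then have bounded: "\<forall>i. left_mult (mono \<beta>) Y i \<in> filtration (e + D)"
      using Y(1) by (auto simp: left_mult_def basis_def intro: filtration_mult)
    have "P \<gamma>" using W(2)[OF y(4)] y(2) by simp
    then have "left_mult (mono \<beta>) Y \<in> multiples P"
      unfolding multiples_def using Y(1) MI \<gamma> by blast
    then have mem: "left_mult (mono \<beta>) Y \<in> ?S" using bounded by (auto intro: tuple.span_base)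
    have lead: "has_lead (eval (left_mult (mono \<beta>) Y)) \<gamma>"
      using multiple_has_lead[OF Y(1) MI] by (simp only: \<gamma>)
    have "eval (left_mult (mono \<beta>) Y) \<in> W" using W(2)[OF lead] \<open>P \<gamma>\<close> by simp
    moreover have "eval (left_mult (mono \<beta>) Y) \<in> filtration e"
      using has_lead_imp_filtration[OF lead] filtration_mono[OF deg] by blast
    moreover have "left_mult (mono \<beta>) Y \<in> tuples n" using mem multiples_tuples by blast
    ultimately show "\<exists>g\<in>eval ` ?S \<inter> (eval ` tuples n \<inter> (W \<inter> filtration e)). has_lead g \<gamma>"
      using mem lead by blast
  qed
  then have "eval y \<in> eval ` ?S" using y by blast
  then show ?thesis by auto
qed

lemma reduction_lower:
  assumes "\<delta> \<in> multi_indices N" "y \<in> tuples n" "eval y \<in> lower \<delta>" "eval y \<in> filtration e"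
  shows "\<exists>h\<in>tuple.span (multiples (\<lambda>\<epsilon>. \<epsilon> \<in> below \<delta>)). (\<forall>i. h i \<in> filtration (e + D)) \<and> eval h = eval y"
proof (rule reduction[OF subspace_lower _ assms(2-4)])
  fix f \<gamma> assume f: "has_lead f \<gamma>"
  have "\<gamma> \<in> below \<delta>" if "f \<in> lower \<delta>"
    using lower_has_lead[OF that _ assms(1)] f zero_no_lead has_lead_unique by metis
  then show "f \<in> lower \<delta> \<longleftrightarrow> \<gamma> \<in> below \<delta>" using has_lead_lower[OF f] by blast
qed

section \<open>Schreyer's argument\<close>

context
  fixes M :: "(nat \<Rightarrow> 'r) set"
  assumes M: "left_submodule M" "M \<subseteq> left_solutions n F"
    and small: "\<And>y. y \<in> left_solutions n F \<Longrightarrow> (\<And>i. y i \<in> filtration (3 * D)) \<Longrightarrow> y \<in> M"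
begin

text \<open>\<open>M\<close> stands for the submodule generated by the solutions with entries of
  degree at most 3D, and the aim is that it contains all solutions. Congruence modulo
  \<open>M\<close> is built in by adding \<open>M\<close> to the spanning set.\<close>

definition span_modulo :: "((nat \<Rightarrow> nat) \<Rightarrow> bool) \<Rightarrow> (nat \<Rightarrow> 'r) set" where
  "span_modulo P = tuple.span (M \<union> multiples P)"

abbreviation span_below :: "(nat \<Rightarrow> nat) \<Rightarrow> (nat \<Rightarrow> 'r) set" where
  "span_below \<delta> \<equiv> span_modulo (\<lambda>\<epsilon>. \<epsilon> \<in> below \<delta>)"

abbreviation span_upto :: "(nat \<Rightarrow> nat) \<Rightarrow> (nat \<Rightarrow> 'r) set" where
  "span_upto \<delta> \<equiv> span_modulo (\<lambda>\<epsilon>. \<epsilon> = \<delta> \<or> \<epsilon> \<in> below \<delta>)"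

lemma subspace_span_modulo: "tuple.subspace (span_modulo P)"
  by (simp add: span_modulo_def)

lemma M_subset_span_modulo: "M \<subseteq> span_modulo P"
  by (auto simp: span_modulo_def intro: tuple.span_base)

lemma multiples_subset_span_modulo: "tuple.span (multiples P) \<subseteq> span_modulo P"
  unfolding span_modulo_def by (intro tuple.span_mono) blast

lemma span_modulo_mono: "(\<And>\<epsilon>. P \<epsilon> \<Longrightarrow> Q \<epsilon>) \<Longrightarrow> span_modulo P \<subseteq> span_modulo Q"
  unfolding span_modulo_def multiples_def by (intro tuple.span_mono) blast

text \<open>Normal ordering of a product of monomials creates terms with smaller exponents, so
  \<open>Q\<close> has to be closed downwards for the resulting multiples to remain
  admissible.\<close>

lemma left_mult_span_modulo:
  assumes h: "h \<in> span_modulo P" and A: "r \<in> span (mono ` A)" "A \<subseteq> multi_indices N"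
    and PQ: "\<And>\<alpha> \<epsilon>. \<alpha> \<in> A \<Longrightarrow> P \<epsilon> \<Longrightarrow> \<epsilon> \<in> multi_indices N \<Longrightarrow> Q (\<alpha> + \<epsilon>)"
    and down: "\<And>\<alpha> \<epsilon>. Q \<epsilon> \<Longrightarrow> \<epsilon> \<in> multi_indices N \<Longrightarrow> \<alpha> \<in> below \<epsilon> \<Longrightarrow> Q \<alpha>"
  shows "left_mult r h \<in> span_modulo Q"
  unfolding span_modulo_def
proof (rule tuple.linear_span_mem[where \<phi> = "left_mult r", OF left_mult_add left_mult_scale _ _ h[unfolded span_modulo_def]])
  show "tuple.subspace (tuple.span (M \<union> multiples Q))" by simp
  fix a assume "a \<in> M \<union> multiples P"
  then show "left_mult r a \<in> tuple.span (M \<union> multiples Q)"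
  proof
    assume "a \<in> M"
    then show ?thesis using left_submodule_left_mult[OF M(1)] by (auto intro: tuple.span_base)
  next
    assume "a \<in> multiples P"
    then obtain \<beta> Y \<gamma> where a: "a = left_mult (mono \<beta>) Y" "(Y, \<gamma>) \<in> basis" "\<beta> \<in> multi_indices N" "P (\<beta> + \<gamma>)"
      unfolding multiples_def by blast
    have \<gamma>: "\<gamma> \<in> multi_indices N" using basis_multi_indices a(2) by blast
    let ?B = "{\<epsilon> \<in> multi_indices N. Q (\<epsilon> + \<gamma>)}"
    have "r * mono \<beta> \<in> span (mono ` ?B)"
    proof (rule linear_span_mem[where \<phi> = "\<lambda>r. r * mono \<beta>", OF _ _ subspace_span _ A(1)])
      fix m assume "m \<in> mono ` A"
      then obtain \<alpha> where \<alpha>: "m = mono \<alpha>" "\<alpha> \<in> A" "\<alpha> \<in> multi_indices N" using A(2) by blast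
      have sum_MI: "\<alpha> + \<beta> \<in> multi_indices N" using \<alpha>(3) a(3) by blast
      have Q: "Q (\<alpha> + \<beta> + \<gamma>)"
        using PQ[OF \<alpha>(2) a(4)] a(3) \<gamma> by (auto simp: add.assoc simp del: plus_fun_apply)
      have "below (\<alpha> + \<beta>) \<subseteq> ?B"
      proof
        fix \<epsilon> assume \<epsilon>: "\<epsilon> \<in> below (\<alpha> + \<beta>)"
        then have "\<epsilon> + \<gamma> \<in> below (\<alpha> + \<beta> + \<gamma>)" using below_add sum_MI \<gamma> by blast
        then show "\<epsilon> \<in> ?B"
          using down[OF Q] sum_MI \<gamma> below_multi_indices[OF \<epsilon>] by blast
      qed
      then have "lower (\<alpha> + \<beta>) \<subseteq> span (mono ` ?B)"
        unfolding lower_def by (intro span_mono) blast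
      moreover have "mono (\<alpha> + \<beta>) \<in> span (mono ` ?B)"
        using sum_MI Q by (intro span_base) blast
      moreover obtain c where "mono \<alpha> * mono \<beta> - scale c (mono (\<alpha> + \<beta>)) \<in> lower (\<alpha> + \<beta>)"
        using mono_mult_has_lead[OF \<alpha>(3) a(3)] unfolding has_lead_def by blast
      ultimately have "(mono \<alpha> * mono \<beta> - scale c (mono (\<alpha> + \<beta>))) + scale c (mono (\<alpha> + \<beta>)) \<in> span (mono ` ?B)"
        by (intro span_add span_scale) blast+
      then show "m * mono \<beta> \<in> span (mono ` ?B)" by (simp add: \<alpha>(1) del: plus_fun_apply)
    qed (auto simp: distrib_right scale_mult_left)
    then have "left_mult (r * mono \<beta>) Y \<in> tuple.span (multiples Q)"
      by (rule left_mult_basis_span[OF _ a(2)]) auto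
    then show ?thesis
      using multiples_subset_span_modulo[of Q] by (auto simp: a(1) left_mult_left_mult span_modulo_def)
  qed
qed

text \<open>The S-pair \<open>Z\<close> is formed at the least common multiple \<tau> of the two
  leads, of degree at most 2D. Reducing its value gives a tuple \<open>h\<close> with entries of
  degree at most 3D, so \<open>Z - h\<close> is a solution small enough to lie in \<open>M\<close>.
  Multiplying by the remaining monomial, with exponent \<epsilon>, carries the relation from \<tau>
  to \<delta>.\<close>

lemma s_pair:
  assumes Y: "(Y, \<gamma>) \<in> basis" "(Y0, \<gamma>0) \<in> basis" "\<beta> \<in> multi_indices N" "\<beta>0 \<in> multi_indices N"
    and \<delta>: "\<beta> + \<gamma> = \<delta>" "\<beta>0 + \<gamma>0 = \<delta>"
  shows "\<exists>k. left_mult (mono \<beta>) Y - tuple_scale k (left_mult (mono \<beta>0) Y0) \<in> span_below \<delta>"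
proof -
  have MI: "\<gamma> \<in> multi_indices N" "\<gamma>0 \<in> multi_indices N"
    using basis_multi_indices Y by auto
  define \<tau> where "\<tau> = (\<lambda>i. max (\<gamma> i) (\<gamma>0 i))"
  define \<epsilon> where "\<epsilon> = \<delta> - \<tau>"
  define b where "b = \<tau> - \<gamma>"
  define b0 where "b0 = \<tau> - \<gamma>0"
  have \<tau>_le: "\<tau> i \<le> \<delta> i" for i
    using fun_cong[OF \<delta>(1), of i] fun_cong[OF \<delta>(2), of i] by (simp add: \<tau>_def)
  have eqs: "b + \<gamma> = \<tau>" "b0 + \<gamma>0 = \<tau>" "\<epsilon> + \<tau> = \<delta>" "\<epsilon> + b = \<beta>" "\<epsilon> + b0 = \<beta>0"
  proof -
    show "b + \<gamma> = \<tau>" "b0 + \<gamma>0 = \<tau>" by (auto simp: b_def b0_def \<tau>_def fun_eq_iff)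
    show e: "\<epsilon> + \<tau> = \<delta>" using \<tau>_le by (auto simp: \<epsilon>_def fun_eq_iff)
    then have "\<epsilon> + b + \<gamma> = \<beta> + \<gamma>" "\<epsilon> + b0 + \<gamma>0 = \<beta>0 + \<gamma>0"
      using \<open>b + \<gamma> = \<tau>\<close> \<open>b0 + \<gamma>0 = \<tau>\<close> \<delta> by (simp_all only: add.assoc)
    then show "\<epsilon> + b = \<beta>" "\<epsilon> + b0 = \<beta>0" by (simp_all only: add_right_cancel)
  qed
  have \<tau>_MI: "\<tau> \<in> multi_indices N" using MI by (auto simp: \<tau>_def multi_indices_def)
  have \<delta>_MI: "\<delta> \<in> multi_indices N" unfolding \<delta>(1)[symmetric] using Y(3) MI by blast
  have bMI: "b \<in> multi_indices N" "b0 \<in> multi_indices N" "\<epsilon> \<in> multi_indices N"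
    using \<tau>_MI \<delta>_MI by (auto simp: b_def b0_def \<epsilon>_def)
  have "total_degree N \<tau> \<le> total_degree N (\<gamma> + \<gamma>0)"
    by (intro total_degree_mono) (auto simp: \<tau>_def le_fun_def)
  also have "\<dots> \<le> 2 * D"
    using Y by (simp add: total_degree_add basis_def del: plus_fun_apply)
  finally have deg: "total_degree N \<tau> \<le> 2 * D" .
  have degb: "total_degree N b \<le> 2 * D" "total_degree N b0 \<le> 2 * D"
    using deg eqs(1,2) total_degree_add[of N b \<gamma>] total_degree_add[of N b0 \<gamma>0] by simp_all
  let ?v = "left_mult (mono b) Y" and ?w = "left_mult (mono b0) Y0"
  have "has_lead (eval ?v) (b + \<gamma>)" "has_lead (eval ?w) (b0 + \<gamma>0)"
    using multiple_has_lead[OF Y(1) bMI(1)] multiple_has_lead[OF Y(2) bMI(2)] .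
  then obtain k where k: "eval ?v - scale k (eval ?w) \<in> lower \<tau>"
    unfolding eqs using has_lead_cancel by blast
  define Z where "Z = ?v - tuple_scale k ?w"
  have Z_val: "eval Z \<in> lower \<tau>" using k by (simp add: Z_def evaluate_diff evaluate_scale)
  have Z_tuple: "Z \<in> tuples n"
    unfolding Z_def using Y by (intro tuple.subspace_diff tuple.subspace_scale subspace_tuples left_mult_tuples)
      (auto simp: basis_def)
  have y_bd: "left_mult (mono a) Y' \<in> {y. \<forall>i. y i \<in> filtration (3 * D)}"
    if "(Y', \<gamma>') \<in> basis" "a \<in> multi_indices N" "total_degree N a \<le> 2 * D" for a Y' \<gamma>'
    using that filtration_mult[OF mono_filtration[OF that(2,3)], of _ D]
    by (auto simp: left_mult_def basis_def)
  have Z_bound: "Z \<in> {y. \<forall>i. y i \<in> filtration (3 * D)}"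
    unfolding Z_def
    by (intro tuple.subspace_diff tuple.subspace_scale subspace_bounded_tuples
        y_bd[OF Y(1) bMI(1) degb(1)] y_bd[OF Y(2) bMI(2) degb(2)])
  have "eval Z \<in> filtration (2 * D)"
    using Z_val lower_filtration[OF \<tau>_MI] filtration_mono[OF deg] by blast
  then obtain h where h: "h \<in> tuple.span (multiples (\<lambda>\<epsilon>. \<epsilon> \<in> below \<tau>))"
      "\<forall>i. h i \<in> filtration (2 * D + D)" "eval h = eval Z"
    using reduction_lower[OF \<tau>_MI Z_tuple Z_val] by blast
  have "Z - h \<in> left_solutions n F"
    using tuple.subspace_diff[OF subspace_tuples Z_tuple subsetD[OF multiples_tuples h(1)]] h(3)
    by (simp add: left_solutions_iff evaluate_diff)
  moreover have "Z - h \<in> {y. \<forall>i. y i \<in> filtration (3 * D)}"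
    using h(2) by (intro tuple.subspace_diff[OF subspace_bounded_tuples Z_bound]) simp
  ultimately have "Z - h \<in> M" using small by blast
  then have "(Z - h) + h \<in> span_below \<tau>"
    using M_subset_span_modulo multiples_subset_span_modulo h(1) by (intro tuple.subspace_add[OF subspace_span_modulo]) blast+
  then have "Z \<in> span_below \<tau>" by (simp del: plus_fun_apply)
  then have \<epsilon>Z: "left_mult (mono \<epsilon>) Z \<in> span_below \<delta>"
  proof (rule left_mult_span_modulo)
    show "mono \<epsilon> \<in> span (mono ` {\<epsilon>})" by (simp add: span_base)
    show "\<alpha> + \<epsilon>' \<in> below \<delta>" if "\<alpha> \<in> {\<epsilon>}" "\<epsilon>' \<in> below \<tau>" for \<alpha> \<epsilon>'
      using that below_add[OF _ \<tau>_MI bMI(3)] unfolding eqs(3)[symmetric]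
      by (simp add: add.commute del: plus_fun_apply)
  qed (use bMI below_trans in auto)
  \<comment> \<open>\<open>mono \<epsilon> * mono a\<close> is a scalar multiple of
    \<open>mono (\<epsilon> + a)\<close> only up to lower terms, so the multiplied S-pair involves
    the given multiples only modulo smaller ones.\<close>
  have shift_mono: "\<exists>c. c \<noteq> 0 \<and> left_mult (mono \<epsilon>) (left_mult (mono a) Y') - tuple_scale c (left_mult (mono (\<epsilon> + a)) Y') \<in> span_below \<delta>"
    if a: "a \<in> multi_indices N" "(Y', \<gamma>') \<in> basis" "\<epsilon> + a + \<gamma>' = \<delta>" for a Y' \<gamma>'
  proof -
    obtain c where c: "c \<noteq> 0" "mono \<epsilon> * mono a - scale c (mono (\<epsilon> + a)) \<in> lower (\<epsilon> + a)"
      using mono_mult_has_lead[OF bMI(3) a(1)] unfolding has_lead_def by blast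
    have "\<epsilon> + a \<in> multi_indices N" using bMI a by blast
    then have "left_mult (mono \<epsilon> * mono a - scale c (mono (\<epsilon> + a))) Y'
        \<in> tuple.span (multiples (\<lambda>\<epsilon>. \<epsilon> \<in> below \<delta>))"
      using below_add basis_multi_indices[OF a(2)] unfolding a(3)[symmetric]
      by (intro left_mult_basis_span[OF c(2)[unfolded lower_def] a(2)]) (auto simp: below_def)
    moreover have "left_mult (mono \<epsilon> * mono a - scale c (mono (\<epsilon> + a))) Y'
        = left_mult (mono \<epsilon>) (left_mult (mono a) Y') - tuple_scale c (left_mult (mono (\<epsilon> + a)) Y')"
      by (auto simp: left_mult_def tuple_scale_def fun_eq_iff left_diff_distrib mult.assoc scale_mult_left)
    ultimately show ?thesis using c(1) multiples_subset_span_modulo by auto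
  qed
  obtain c where c: "c \<noteq> 0" "left_mult (mono \<epsilon>) ?v - tuple_scale c (left_mult (mono \<beta>) Y) \<in> span_below \<delta>"
    using shift_mono[OF bMI(1) Y(1)] unfolding eqs \<delta> by blast
  obtain c0 where c0: "left_mult (mono \<epsilon>) ?w - tuple_scale c0 (left_mult (mono \<beta>0) Y0) \<in> span_below \<delta>"
    using shift_mono[OF bMI(2) Y(2)] unfolding eqs \<delta> by blast
  have "tuple_scale (1 / c) (left_mult (mono \<epsilon>) Z
      - (left_mult (mono \<epsilon>) ?v - tuple_scale c (left_mult (mono \<beta>) Y))
      + tuple_scale k (left_mult (mono \<epsilon>) ?w - tuple_scale c0 (left_mult (mono \<beta>0) Y0))) \<in> span_below \<delta>"
    by (intro tuple.subspace_scale tuple.subspace_add tuple.subspace_diff subspace_span_modulo \<epsilon>Z c(2) c0)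
  also have "left_mult (mono \<epsilon>) Z
      - (left_mult (mono \<epsilon>) ?v - tuple_scale c (left_mult (mono \<beta>) Y))
      + tuple_scale k (left_mult (mono \<epsilon>) ?w - tuple_scale c0 (left_mult (mono \<beta>0) Y0))
      = tuple_scale c (left_mult (mono \<beta>) Y) - tuple_scale (k * c0) (left_mult (mono \<beta>0) Y0)"
    by (simp add: Z_def left_mult_diff left_mult_scale tuple.scale_right_diff_distrib del: plus_fun_apply)
  also have "tuple_scale (1 / c) \<dots> = left_mult (mono \<beta>) Y - tuple_scale (k * c0 / c) (left_mult (mono \<beta>0) Y0)"
    using c(1) by (simp add: tuple.scale_right_diff_distrib)
  finally show ?thesis by blast
qed

lemma eval_M: "y \<in> M \<Longrightarrow> eval y = 0"
  using M(2) by (auto simp: left_solutions_iff)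

lemma eval_span_below: "\<delta> \<in> multi_indices N \<Longrightarrow> y \<in> span_below \<delta> \<Longrightarrow> eval y \<in> lower \<delta>"
  unfolding span_modulo_def
proof (erule tuple.span_induct)
  assume \<delta>: "\<delta> \<in> multi_indices N"
  show "tuple.subspace {y. eval y \<in> lower \<delta>}"
    using subspace_lower[of \<delta>] by (auto simp: tuple.subspace_def subspace_def evaluate_add evaluate_scale)
  fix y assume "y \<in> M \<union> multiples (\<lambda>\<epsilon>. \<epsilon> \<in> below \<delta>)"
  then show "eval y \<in> lower \<delta>"
  proof
    assume "y \<in> M"
    then show ?thesis using eval_M subspace_0[OF subspace_lower] by simp
  next
    assume "y \<in> multiples (\<lambda>\<epsilon>. \<epsilon> \<in> below \<delta>)"
    then obtain \<beta> Y \<gamma> where y: "y = left_mult (mono \<beta>) Y" "(Y, \<gamma>) \<in> basis" "\<beta> \<in> multi_indices N" "\<beta> + \<gamma> \<in> below \<delta>"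
      unfolding multiples_def by blast
    then have "has_lead (eval y) (\<beta> + \<gamma>)"
      using multiple_has_lead by blast
    then show ?thesis using y(4) has_lead_lower by blast
  qed
qed

text \<open>By \<open>s_pair\<close>, all multiples with leading exponent \<delta> are scalar
  multiples of a single one, \<open>h0\<close>, modulo \<open>span_below \<delta>\<close>. The value
  of \<open>y\<close> has no term at \<delta> while that of \<open>h0\<close> has one, so the
  coefficient of \<open>h0\<close> is 0.\<close>

lemma span_upto_lower:
  assumes \<delta>: "\<delta> \<in> multi_indices N" and y: "y \<in> span_upto \<delta>" "eval y \<in> lower \<delta>"
  shows "y \<in> span_below \<delta>"
proof (cases "\<exists>\<beta> Y \<gamma>. (Y, \<gamma>) \<in> basis \<and> \<beta> \<in> multi_indices N \<and> \<beta> + \<gamma> = \<delta>")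
  case False
  then have "multiples (\<lambda>\<epsilon>. \<epsilon> = \<delta> \<or> \<epsilon> \<in> below \<delta>) \<subseteq> multiples (\<lambda>\<epsilon>. \<epsilon> \<in> below \<delta>)"
    unfolding multiples_def by blast
  then have "span_upto \<delta> \<subseteq> span_below \<delta>"
    unfolding span_modulo_def by (intro tuple.span_mono Un_mono order.refl)
  then show ?thesis using y(1) by (rule subsetD)
next
  case True
  then obtain \<beta>0 Y0 \<gamma>0 where Y0: "(Y0, \<gamma>0) \<in> basis" "\<beta>0 \<in> multi_indices N" "\<beta>0 + \<gamma>0 = \<delta>" by blast
  define h0 where "h0 = left_mult (mono \<beta>0) Y0"
  let ?S = "tuple.span (insert h0 (M \<union> multiples (\<lambda>\<epsilon>. \<epsilon> \<in> below \<delta>)))"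
  have "M \<union> multiples (\<lambda>\<epsilon>. \<epsilon> = \<delta> \<or> \<epsilon> \<in> below \<delta>) \<subseteq> ?S"
  proof
    fix h assume "h \<in> M \<union> multiples (\<lambda>\<epsilon>. \<epsilon> = \<delta> \<or> \<epsilon> \<in> below \<delta>)"
    then consider "h \<in> M \<union> multiples (\<lambda>\<epsilon>. \<epsilon> \<in> below \<delta>)"
      | \<beta> Y \<gamma> where "h = left_mult (mono \<beta>) Y" "(Y, \<gamma>) \<in> basis" "\<beta> \<in> multi_indices N" "\<beta> + \<gamma> = \<delta>"
      unfolding multiples_def by blast
    then show "h \<in> ?S"
    proof cases
      case 1
      then show ?thesis by (intro tuple.span_base) blast
    next
      case 2
      then show ?thesis
        using s_pair[OF 2(2) Y0(1) 2(3) Y0(2) 2(4) Y0(3)]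
        by (simp add: tuple.span_breakdown_eq h0_def span_modulo_def)
    qed
  qed
  then have "span_upto \<delta> \<subseteq> ?S" unfolding span_modulo_def by (intro tuple.span_minimal tuple.subspace_span)
  then have "y \<in> ?S" using y(1) by (rule subsetD)
  then obtain k where k: "y - tuple_scale k h0 \<in> span_below \<delta>"
    unfolding tuple.span_breakdown_eq span_modulo_def by blast
  have lead: "has_lead (eval h0) \<delta>"
    unfolding h0_def Y0(3)[symmetric] by (rule multiple_has_lead[OF Y0(1,2)])
  have "eval y - eval (y - tuple_scale k h0) \<in> lower \<delta>"
    by (rule subspace_diff[OF subspace_lower y(2) eval_span_below[OF \<delta> k]])
  then have "scale k (eval h0) \<in> lower \<delta>" by (simp add: evaluate_diff evaluate_scale)
  then have "scale (inverse k) (scale k (eval h0)) \<in> lower \<delta>" by (rule subspace_scale[OF subspace_lower])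
  then have "k = 0" using has_lead_not_lower[OF lead] by (cases "k = 0") auto
  then show ?thesis using k by simp
qed

text \<open>A linear combination involves finitely many multiples, and their exponents are linearly
  ordered, so one of them is largest.\<close>

lemma span_modulo_cases:
  assumes "y \<in> span_modulo P"
  shows "y \<in> M \<or> (\<exists>\<delta>\<in>multi_indices N. P \<delta> \<and> y \<in> span_upto \<delta>)"
  using assms unfolding span_modulo_def[of P]
proof (induction rule: tuple.span_induct_alt)
  case base
  then show ?case using tuple.subspace_0[OF left_submodule_subspace[OF M(1)]] by blast
next
  case (step c h y)
  have upto_mono: "span_upto \<delta> \<subseteq> span_upto \<delta>'" if "\<delta> \<in> below \<delta>'" for \<delta> \<delta>'
    using that below_trans by (intro span_modulo_mono) blast
  have h: "h \<in> M \<or> (\<exists>\<delta>\<in>multi_indices N. P \<delta> \<and> h \<in> span_upto \<delta>)"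
  proof (cases "h \<in> M")
    case False
    then obtain \<beta> Y \<gamma> where h: "h = left_mult (mono \<beta>) Y" "(Y, \<gamma>) \<in> basis" "\<beta> \<in> multi_indices N" "P (\<beta> + \<gamma>)"
      using step(1) unfolding multiples_def by blast
    then have "h \<in> multiples (\<lambda>\<epsilon>. \<epsilon> = \<beta> + \<gamma> \<or> \<epsilon> \<in> below (\<beta> + \<gamma>))"
      unfolding multiples_def by blast
    then have "h \<in> span_upto (\<beta> + \<gamma>)" unfolding span_modulo_def by (intro tuple.span_base) blast
    moreover have "\<beta> + \<gamma> \<in> multi_indices N" using h basis_multi_indices by blast
    ultimately show ?thesis using h(4) by blast
  qed simp
  have add: "tuple_scale c h + y \<in> span_upto \<delta>" if "h \<in> span_upto \<delta>" "y \<in> span_upto \<delta>" for \<delta>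
    using that subspace_span_modulo by (intro tuple.subspace_add tuple.subspace_scale)
  from h step(2) consider "h \<in> M" "y \<in> M"
    | \<delta> where "h \<in> M" "\<delta> \<in> multi_indices N" "P \<delta>" "y \<in> span_upto \<delta>"
    | \<delta> where "y \<in> M" "\<delta> \<in> multi_indices N" "P \<delta>" "h \<in> span_upto \<delta>"
    | \<delta> \<delta>' where "\<delta> \<in> multi_indices N" "P \<delta>" "h \<in> span_upto \<delta>" "\<delta>' \<in> multi_indices N" "P \<delta>'" "y \<in> span_upto \<delta>'"
    by blast
  then show ?case
  proof cases
    case 1
    then show ?thesis
      using left_submodule_subspace[OF M(1)] by (blast intro: tuple.subspace_add tuple.subspace_scale)
  next
    case (2 \<delta>)
    then show ?thesis using add[of \<delta>] M_subset_span_modulo by blast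
  next
    case (3 \<delta>)
    then show ?thesis using add[of \<delta>] M_subset_span_modulo by blast
  next
    case (4 \<delta> \<delta>')
    then consider "\<delta> = \<delta>'" | "\<delta> \<in> below \<delta>'" | "\<delta>' \<in> below \<delta>" using below_linear by blast
    then show ?thesis
    proof cases
      case 1
      then show ?thesis using 4 add[of \<delta>] by blast
    next
      case 2
      then show ?thesis using 4 add[of \<delta>'] upto_mono[OF 2] by blast
    next
      case 3
      then show ?thesis using 4 add[of \<delta>] upto_mono[OF 3] by blast
    qed
  qed
qed

text \<open>The value 0 lies in every \<open>lower \<delta>\<close>, so the largest exponent can be
  lowered again and again; since ranks are naturals, this ends in \<open>M\<close>.\<close>

lemma span_upto_solution:
  "\<delta> \<in> multi_indices N \<Longrightarrow> y \<in> span_upto \<delta> \<Longrightarrow> eval y = 0 \<Longrightarrow> y \<in> M"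
proof (induction "rank \<delta>" arbitrary: \<delta> rule: less_induct)
  case less
  have "y \<in> span_below \<delta>"
    using less.prems subspace_0[OF subspace_lower] by (intro span_upto_lower) auto
  then consider "y \<in> M" | \<delta>' where "\<delta>' \<in> multi_indices N" "\<delta>' \<in> below \<delta>" "y \<in> span_upto \<delta>'"
    using span_modulo_cases by blast
  then show ?case
  proof cases
    case (2 \<delta>')
    then show ?thesis using less.hyps[of \<delta>'] rank_less less.prems by blast
  qed
qed

text \<open>Provides the start of the descent. A unit tuple differs from the reduction of its value
  by a solution with entries of degree at most d + D \<le> 3D, hence by an element of
  \<open>M\<close>; every tuple is a left combination of unit tuples.\<close>

lemma tuples_subset_span_modulo: "tuples n \<subseteq> span_modulo (\<lambda>_. True)"
proof
  fix y :: "nat \<Rightarrow> 'r" assume y: "y \<in> tuples n"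
  define unit where "unit i = (\<lambda>j. if j = i then 1 else (0 :: 'r))" for i :: nat
  have unit: "unit i \<in> span_modulo (\<lambda>_. True)" if i: "i \<in> {1..n}" for i
  proof -
    have ut: "unit i \<in> tuples n" using i by (auto simp: unit_def tuples_def)
    have "eval (unit i) = F i"
      using i by (simp add: evaluate_def unit_def if_distrib[of "\<lambda>a. a * _"] cong: if_cong)
    then obtain h where h: "h \<in> tuple.span (multiples (\<lambda>_. True))" "\<forall>j. h j \<in> filtration (d + D)"
        "eval h = eval (unit i)"
      using reduction[OF subspace_UNIV, of "\<lambda>_. True" "unit i" d] ut generators[OF i] by auto
    have "unit i j \<in> filtration (3 * D)" for j
      using mono_filtration[of 0 "3 * D"] subspace_0[OF subspace_filtration]
      by (simp add: unit_def del: zero_fun_apply)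
    moreover have "h j \<in> filtration (3 * D)" for j
      using h(2) filtration_mono[of "d + D" "3 * D"] d_le_D by auto
    ultimately have "(unit i - h) j \<in> filtration (3 * D)" for j
      using subspace_diff[OF subspace_filtration] by simp
    moreover have "unit i - h \<in> left_solutions n F"
      using tuple.subspace_diff[OF subspace_tuples ut subsetD[OF multiples_tuples h(1)]] h(3)
      by (simp add: left_solutions_iff evaluate_diff)
    ultimately have "unit i - h \<in> M" using small by blast
    then have "(unit i - h) + h \<in> span_modulo (\<lambda>_. True)"
      using M_subset_span_modulo multiples_subset_span_modulo h(1) by (intro tuple.subspace_add[OF subspace_span_modulo]) blast+
    then show ?thesis by (simp del: plus_fun_apply)
  qed
  have "left_mult r h \<in> span_modulo (\<lambda>_. True)" if "h \<in> span_modulo (\<lambda>_. True)" for r h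
    using monomials_span by (intro left_mult_span_modulo[OF that, of r "multi_indices N"]) (auto simp: monomials_def)
  then have "(\<Sum>i\<in>{1..n}. left_mult (y i) (unit i)) \<in> span_modulo (\<lambda>_. True)"
    using unit by (intro tuple.subspace_sum[OF subspace_span_modulo]) blast
  moreover have "(\<Sum>i\<in>{1..n}. left_mult (y i) (unit i)) = y"
  proof
    fix j
    have "(\<Sum>i\<in>A. left_mult (y i) (unit i)) j = (\<Sum>i\<in>A. if i = j then y i else 0)" for A :: "nat set"
      by (induction A rule: infinite_finite_induct) (auto simp: left_mult_def unit_def)
    then show "(\<Sum>i\<in>{1..n}. left_mult (y i) (unit i)) j = y j"
      using y by (auto simp: tuples_def)
  qed
  ultimately show "y \<in> span_modulo (\<lambda>_. True)" by simp
qed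

lemma left_solutions_subset: "left_solutions n F \<subseteq> M"
proof
  fix y assume "y \<in> left_solutions n F"
  then have "y \<in> span_modulo (\<lambda>_. True)" "eval y = 0" using tuples_subset_span_modulo by (auto simp: left_solutions_iff)
  then show "y \<in> M" using span_modulo_cases span_upto_solution by blast
qed

end

text \<open>The hull of the small solutions is an admissible choice of \<open>M\<close>.\<close>

lemma left_solutions_hull:
  "left_submodule hull {y \<in> left_solutions n F. \<forall>i. y i \<in> filtration (3 * D)} = left_solutions n F"
  (is "left_submodule hull ?G = _")
proof
  show sub: "left_submodule hull ?G \<subseteq> left_solutions n F"
    by (rule hull_minimal) (auto simp: left_submodule_left_solutions)
  have "left_submodule (left_submodule hull ?G)"
    by (rule hull_in) (auto simp: left_submodule_def)
  then show "left_solutions n F \<subseteq> left_submodule hull ?G"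
    using sub by (rule left_solutions_subset) (auto intro: hull_inc)
qed

end

theorem corollary0p3:
  fixes scale :: "'k::field \<Rightarrow> 'r::ring_1 \<Rightarrow> 'r"
    and N n d :: nat
    and x F :: "nat \<Rightarrow> 'r"
    and f :: 'r
    and le :: "((nat \<Rightarrow> nat) \<times> (nat \<Rightarrow> nat)) set"
  defines "deg \<equiv> algebra_with_generators.deg scale N x"
    and "deg_at_most \<equiv> algebra_with_generators.deg_at_most scale N x"
  assumes "N \<ge> 1"
    and "quadric_solvable_type_algebra scale N x le"
    and "degree_compatible N le"
    and "\<forall>i\<in>{1..n}. deg_at_most (F i) (real d)"
  shows "((\<exists>y\<in>tuples n. (\<Sum>i = 1..n. y i * F i) = f) \<longrightarrow>
           (\<exists>y\<in>tuples n. (\<Sum>i = 1..n. y i * F i) = f \<and>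
              (\<forall>i\<in>{1..n}. deg_at_most (y i) (real (deg f) + degree_bound N d))))
       \<and> (\<exists>G \<subseteq> left_solutions n F.
            (\<forall>y\<in>G. \<forall>i\<in>{1..n}. deg_at_most (y i) (3 * degree_bound N d)) \<and>
            left_submodule hull G = left_solutions n F)"
proof -
  note deg_eq = deg_def and deg_at_most_eq = deg_at_most_def
  interpret quadric_solvable_type_algebra scale N x le by fact
  interpret degree_compatible_algebra scale N x le
    using \<open>degree_compatible N le\<close> by unfold_locales
  have F: "F i \<in> filtration d" if "i \<in> {1..n}" for i
    using \<open>\<forall>i\<in>{1..n}. deg_at_most (F i) (real d)\<close> that
    unfolding deg_at_most_eq deg_at_most_iff by (rule bspec)
  \<comment> \<open>Levels are naturals, so rounding the real bound down loses nothing.\<close>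
  define D where "D = nat \<lfloor>degree_bound N d\<rfloor>"
  have D: "real D \<le> degree_bound N d"
    using order_trans[OF of_nat_0_le_iff degree_bound_ge[of d N]] by (simp add: D_def)
  interpret bounded_leads scale N x le n d D F
  proof
    show "d \<le> D" unfolding D_def by (rule le_nat_floor[OF degree_bound_ge])
    fix \<gamma> s assume "\<gamma> \<in> leads (ideal_part F d n s)"
    then obtain s' \<gamma>' where "\<gamma>' \<in> leads (ideal_part F d n s')" "\<gamma>' \<le> \<gamma>" "real s' \<le> degree_bound N d"
      using leads_generated[where n = n and F = F, OF \<open>N \<ge> 1\<close> F] by blast
    then show "\<exists>s' \<gamma>'. \<gamma>' \<in> leads (ideal_part F d n s') \<and> \<gamma>' \<le> \<gamma> \<and> s' \<le> D"
      unfolding D_def using le_nat_floor by blast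
  qed (rule F)
  have bound: "deg_at_most g b" if "g \<in> filtration e" "real e \<le> b" for g e b
    using deg_at_most_iff[of g e] that unfolding deg_at_most_eq deg_at_most_def by auto
  show ?thesis
  proof (intro conjI impI)
    assume "\<exists>y\<in>tuples n. (\<Sum>i = 1..n. y i * F i) = f"
    then obtain s where "f \<in> ideal_part F d n s"
      using evaluate_ideal_part unfolding evaluate_def by blast
    then have "f \<in> ideal_part F d n (deg f + D)"
      unfolding deg_eq by (rule ideal_part_bound[OF _ deg_filtration])
    then obtain y where y: "y \<in> tuples n" "\<And>i. y i \<in> multipliers d (deg f + D)" "evaluate n F y = f"
      using ideal_part_evaluate by blast
    have "deg_at_most (y i) (real (deg f) + degree_bound N d)" for i
      using y(2)[of i] multipliers_filtration[of "deg f + D" "deg f + D" d] D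
      by (intro bound[of _ "deg f + D"]) auto
    then show "\<exists>y\<in>tuples n. (\<Sum>i = 1..n. y i * F i) = f \<and>
        (\<forall>i\<in>{1..n}. deg_at_most (y i) (real (deg f) + degree_bound N d))"
      using y(1,3) unfolding evaluate_def by blast
  next
    have "deg_at_most (y i) (3 * degree_bound N d)" if "y i \<in> filtration (3 * D)" for y :: "nat \<Rightarrow> 'r" and i
      using that D by (intro bound[of _ "3 * D"]) auto
    then show "\<exists>G\<subseteq>left_solutions n F. (\<forall>y\<in>G. \<forall>i\<in>{1..n}. deg_at_most (y i) (3 * degree_bound N d)) \<and>
        left_submodule hull G = left_solutions n F"
      using left_solutions_hull by (intro exI[of _ "{y \<in> left_solutions n F. \<forall>i. y i \<in> filtration (3 * D)}"]) auto
  qed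
qed

end
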